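(* Let $\ell,k\ge 1$ be integers, let $\Lambda=\ell\times k$ be the rectangular Young diagram with $\ell$ rows and $k$ columns, and let $\lambda,\mu,\nu\subseteq\Lambda$ be Young diagrams (straight shapes). Fix any standard Young tableaux $T_\lambda$, $T_\mu$, $T_\nu$ of respective shapes $\lambda,\mu,\nu$. Let $\mathrm{CARTONS}_{\lambda,\mu,\nu}$ be the set of all carton fillings with initial data $\emptyset$, $\Lambda$, $T_\lambda$, $T_\mu$, $T_\nu$ (as defined in the context). Then the Littlewood–Richardson coefficient $C_{\lambda,\mu,\nu}$ satisfies $$C_{\lambda,\mu,\nu}=\#\,\mathrm{CARTONS}_{\lambda,\mu,\nu}.$$
   Context: Littlewood–Richardson coefficient: $C_{\lambda,\mu,\nu}$ is the intersection number of three Schubert varieties in general position, indexed by $\lambda,\mu,\nu$, in the Grassmannian of $\ell$-dimensional planes in $\mathbb{C}^{\ell+k}$, i.e. $C_{\lambda,\mu,\nu}=\int \sigma_\lambda\sigma_\mu\sigma_\nu$, where $\sigma_\lambda$ is the Schubert class of codimension $|\lambda|$ (it is $0$ unless $|\lambda|+|\mu|+|\nu|=\ell k$). Equivalently, $C_{\lambda,\mu,\nu}=C_{\lambda,\mu}^{\nu^\vee}$, the coefficient of the Schur function $s_{\nu^\vee}$ in $s_\lambda s_\mu$, where $\nu^\vee$ is the straight shape obtained by rotating $\Lambda\setminus\nu$ by $180$ degrees. Shape chains: a standard Young tableau $T$ of shape $\sigma/\pi$ (entries $1,\dots,|\sigma/\pi|$, each used once, increasing along rows and down columns) is identified with its shape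 chain $\pi=\sigma_0\subset\sigma_1\subset\cdots\subset\sigma_{|\sigma/\pi|}=\sigma$ of Young diagrams, where $\sigma_i$ is obtained from $\sigma_{i-1}$ by adding the box of $T$ containing $i$. Carton: let $a=|\lambda|$, $b=|\mu|$, $c=|\nu|$. The carton is the surface of the box $[0,a]\times[0,b]\times[0,c]$ with the unit grid drawn on its six faces. Its vertices are the integer points $(x,y,z)$ of the box with $x\in\{0,a\}$ or $y\in\{0,b\}$ or $z\in\{0,c\}$; its edges are the unit segments in coordinate directions lying in a face; its squares are the unit grid squares lying in a face. Carton filling: an assignment of a Young diagram to each vertex of the carton such that (i) the shapes increase by exactly one box at a time when moving away from the corner $(0,0,0)$, i.e. along each grid edge, in the direction of increasing coordinate, exactly one box is added; (ii) every unit square of every face satisfies the Fomin growth assumptions: let $\gamma$ be the shape at the vertex of the square closest to $(0,0,0)$ (both varying coordinates smallest), $\beta$ the shape at the opposite vertex (both varying coordinates largest), and $\alpha,\delta$ the shapes at the other two vertices. Then (F1) if $\alpha$ is the unique shape strictly between $\gamma$ and $\beta$ (containing $\gamma$ and contained in $\beta$, with exactly one more box than $\gamma$), then $\delta=\alpha$; (F2) otherwise there is a unique such shape other than $\alpha$, and $\delta$ is this shape. (These conditions are symmetric in $\alpha$ and $\delta$.) Initial data: the corner $(0,0,0)$ is assigned $\emptyset$; the opposite corner $(a,b,c)$ is assigned $\Lambda$; the vertices $(i,0,0)$, $0\le i\le a$, are assigned the shape chain of $T_\lambda$; the vertices $(0,j,0)$, $0\le j\le b$, the shape chain of $T_\mu$;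 the vertices $(0,0,m)$, $0\le m\le c$, the shape chain of $T_\nu$. $\mathrm{CARTONS}_{\lambda,\mu,\nu}$ is the set of all carton fillings with these prescribed values. *)

theory Defs
  imports Main "HOL-Library.FuncSet" "HOL-Library.Multiset" "HOL-Library.Product_Plus"
begin

text \<open>Boxes are pairs (row, column), both counted from 0, rows downwards and columns to the right.\<close>

type_synonym diagram = "(nat \<times> nat) set"

definition young_diagram :: "diagram \<Rightarrow> bool" where
  "young_diagram D \<longleftrightarrow> finite D \<and>
     (\<forall>i j i' j'. (i, j) \<in> D \<longrightarrow> i' \<le> i \<longrightarrow> j' \<le> j \<longrightarrow> (i', j') \<in> D)"

definition rectangle :: "nat \<Rightarrow> nat \<Rightarrow> diagram" where
  "rectangle l k = {..<l} \<times> {..<k}"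

definition rotated_complement :: "nat \<Rightarrow> nat \<Rightarrow> diagram \<Rightarrow> diagram" where
  "rotated_complement l k D = (\<lambda>(i, j). (l - 1 - i, k - 1 - j)) ` (rectangle l k - D)"


section \<open>Standard tableaux and shape chains\<close>

text \<open>Only the values of \<open>T\<close> on the boxes of \<open>D\<close> are relevant.\<close>

definition standard_tableau :: "diagram \<Rightarrow> (nat \<times> nat \<Rightarrow> nat) \<Rightarrow> bool" where
  "standard_tableau D T \<longleftrightarrow> bij_betw T D {1..card D} \<and>
     (\<forall>i j j'. (i, j) \<in> D \<longrightarrow> (i, j') \<in> D \<longrightarrow> j < j' \<longrightarrow> T (i, j) < T (i, j')) \<and>
     (\<forall>i i' j. (i, j) \<in> D \<longrightarrow> (i', j) \<in> D \<longrightarrow> i < i' \<longrightarrow> T (i, j) < T (i', j))"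

primrec shape_chain :: "diagram \<Rightarrow> (nat \<times> nat \<Rightarrow> nat) \<Rightarrow> nat \<Rightarrow> diagram" where
  "shape_chain D T 0 = {}"
| "shape_chain D T (Suc n) = shape_chain D T n \<union> {p \<in> D. T p = Suc n}"


section \<open>Schur functions and Littlewood--Richardson coefficients\<close>

text \<open>
  A formal power series with integer coefficients in the variables \<open>x\<^sub>0, x\<^sub>1, \<dots>\<close> is
  represented by its coefficient function.  A monomial is encoded as the multiset of the
  indices of its variables, so that multiplication of monomials is addition of multisets.
\<close>

type_synonym series = "nat multiset \<Rightarrow> int"

text \<open>The set in the sum is finite, so this is the usual Cauchy product.\<close>

definition series_mult :: "series \<Rightarrow> series \<Rightarrow> series" where
  "series_mult f g M = (\<Sum>(A, B) \<in> {(A, B). A + B = M}. f A * g B)"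

definition semistandard_tableaux :: "diagram \<Rightarrow> (nat \<times> nat \<Rightarrow> nat) set" where
  "semistandard_tableaux D = {T \<in> D \<rightarrow>\<^sub>E UNIV.
     (\<forall>i j j'. (i, j) \<in> D \<longrightarrow> (i, j') \<in> D \<longrightarrow> j < j' \<longrightarrow> T (i, j) \<le> T (i, j')) \<and>
     (\<forall>i i' j. (i, j) \<in> D \<longrightarrow> (i', j) \<in> D \<longrightarrow> i < i' \<longrightarrow> T (i, j) < T (i', j))}"

definition schur :: "diagram \<Rightarrow> series" where
  "schur D M = int (card {T \<in> semistandard_tableaux D. image_mset T (mset_set D) = M})"

definition schur_expansion :: "series \<Rightarrow> (diagram \<Rightarrow> int) \<Rightarrow> bool" where
  "schur_expansion f c \<longleftrightarrow>
     finite {D. c D \<noteq> 0} \<and> (\<forall>D. c D \<noteq> 0 \<longrightarrow> young_diagram D) \<and>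
     (\<forall>M. f M = (\<Sum>D \<in> {D. c D \<noteq> 0}. c D * schur D M))"

text \<open>
  Since the Schur functions of Young diagrams form a basis of the ring of symmetric functions,
  the definite description below denotes the unique expansion whenever \<open>f\<close> is symmetric
  of bounded degree.
\<close>

definition schur_coeff :: "series \<Rightarrow> diagram \<Rightarrow> int" where
  "schur_coeff f D = (THE c. schur_expansion f c) D"

text \<open>
  The intersection number of three Schubert classes in the Grassmannian of \<open>l\<close>-planes in
  complex \<open>(l + k)\<close>-space, expressed as the coefficient of the Schur function of the rotated
  complement of the third shape in the product of the other two Schur functions.
\<close>

definition LR_coefficient :: "nat \<Rightarrow> nat \<Rightarrow> diagram \<Rightarrow> diagram \<Rightarrow> diagram \<Rightarrow> int" where
  "LR_coefficient l k la mu nu =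
     schur_coeff (series_mult (schur la) (schur mu)) (rotated_complement l k nu)"


section \<open>Cartons\<close>

type_synonym point = "nat \<times> nat \<times> nat"

definition carton_faces :: "nat \<Rightarrow> nat \<Rightarrow> nat \<Rightarrow> point set set" where
  "carton_faces a b c =
     {{0} \<times> {0..b} \<times> {0..c}, {a} \<times> {0..b} \<times> {0..c},
      {0..a} \<times> {0} \<times> {0..c}, {0..a} \<times> {b} \<times> {0..c},
      {0..a} \<times> {0..b} \<times> {0}, {0..a} \<times> {0..b} \<times> {c}}"

definition carton_vertices :: "nat \<Rightarrow> nat \<Rightarrow> nat \<Rightarrow> point set" where
  "carton_vertices a b c = \<Union> (carton_faces a b c)"

definition unit_steps :: "point set" where
  "unit_steps = {(1, 0, 0), (0, 1, 0), (0, 0, 1)}"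

text \<open>
  An edge is represented by its endpoint \<open>u\<close> closest to the origin and its direction \<open>d\<close>, a
  square by its vertex \<open>u\<close> closest to the origin and its two directions \<open>d\<close>, \<open>e\<close>.  It is not
  enough that all corners are carton vertices: they have to lie in a common face.
\<close>

definition carton_edges :: "nat \<Rightarrow> nat \<Rightarrow> nat \<Rightarrow> (point \<times> point) set" where
  "carton_edges a b c =
     {(u, d). d \<in> unit_steps \<and> (\<exists>F \<in> carton_faces a b c. {u, u + d} \<subseteq> F)}"

definition carton_squares :: "nat \<Rightarrow> nat \<Rightarrow> nat \<Rightarrow> (point \<times> point \<times> point) set" where
  "carton_squares a b c =
     {(u, d, e). d \<in> unit_steps \<and> e \<in> unit_steps \<and> d \<noteq> e \<and>
        (\<exists>F \<in> carton_faces a b c. {u, u + d, u + e, u + d + e} \<subseteq> F)}"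

definition adds_one_box :: "diagram \<Rightarrow> diagram \<Rightarrow> bool" where
  "adds_one_box D E \<longleftrightarrow> (\<exists>p. p \<notin> D \<and> E = insert p D)"

definition intermediate_shapes :: "diagram \<Rightarrow> diagram \<Rightarrow> diagram set" where
  "intermediate_shapes \<gamma> \<beta> =
     {\<rho>. young_diagram \<rho> \<and> \<gamma> \<subset> \<rho> \<and> \<rho> \<subset> \<beta> \<and> card \<rho> = card \<gamma> + 1}"

definition fomin_growth :: "diagram \<Rightarrow> diagram \<Rightarrow> diagram \<Rightarrow> diagram \<Rightarrow> bool" where
  "fomin_growth \<gamma> \<alpha> \<delta> \<beta> \<longleftrightarrow>
     (if intermediate_shapes \<gamma> \<beta> = {\<alpha>} then \<delta> = \<alpha>
      else intermediate_shapes \<gamma> \<beta> - {\<alpha>} = {\<delta>})"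

text \<open>
  Fillings are extensional functions (undefined outside the carton vertices), so that distinct
  functions are distinct fillings.
\<close>

definition carton_fillings :: "nat \<Rightarrow> nat \<Rightarrow> nat \<Rightarrow> (point \<Rightarrow> diagram) set" where
  "carton_fillings a b c =
     {f \<in> carton_vertices a b c \<rightarrow>\<^sub>E {D. young_diagram D}.
        (\<forall>(u, d) \<in> carton_edges a b c. adds_one_box (f u) (f (u + d))) \<and>
        (\<forall>(u, d, e) \<in> carton_squares a b c.
           fomin_growth (f u) (f (u + d)) (f (u + e)) (f (u + d + e)))}"

definition CARTONS :: "nat \<Rightarrow> nat \<Rightarrow> diagram \<Rightarrow> diagram \<Rightarrow> diagram \<Rightarrow>
    (nat \<times> nat \<Rightarrow> nat) \<Rightarrow> (nat \<times> nat \<Rightarrow> nat) \<Rightarrow> (nat \<times> nat \<Rightarrow> nat) \<Rightarrow>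
    (point \<Rightarrow> diagram) set" where
  "CARTONS l k la mu nu T_la T_mu T_nu =
     {f \<in> carton_fillings (card la) (card mu) (card nu).
        f (0, 0, 0) = {} \<and>
        f (card la, card mu, card nu) = rectangle l k \<and>
        (\<forall>i \<le> card la. f (i, 0, 0) = shape_chain la T_la i) \<and>
        (\<forall>j \<le> card mu. f (0, j, 0) = shape_chain mu T_mu j) \<and>
        (\<forall>m \<le> card nu. f (0, 0, m) = shape_chain nu T_nu m)}"

end

theory Submission
  imports Defs
begin

text \<open>
  A chain of Young diagrams is encoded by the word of contents of its successive boxes.  A growth
  square exchanges two adjacent letters if they differ by at least 2 and keeps them otherwise, so a
  growth rectangle computes the switching of two words.  Switching is an involution, preserves
  ascents, and respects Knuth moves of content words; since all chains from the empty diagram to a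
  given one are connected by such moves (Haiman), rectification is well defined.  Let
  \<open>lr la mu nu\<close> be the number of chains from \<open>la\<close> to \<open>nu\<close> that rectify to a fixed chain of \<open>mu\<close>.

  Semistandard tableaux correspond to words that increase on prescribed blocks.  As ascents
  are preserved, switching yields Pieri's rule both for Schur functions and for \<open>lr\<close>, and removing
  rows one at a time shows that \<open>lr\<close> gives the structure constants of Schur functions.

  Every chain from \<open>D\<close> to the rectangle rectifies to a chain of the rotated complement of \<open>D\<close>, and this is
  a bijection.  Hence a carton is determined by its chain from \<open>(a, 0, 0)\<close> to \<open>(a, b, 0)\<close>, which is a
  chain counted by \<open>lr\<close>.  Conversely such a chain determines five faces.  The sixth one closes up because
  switching commutes with rectification for chains ending in the rectangle: there rectification followed
  by evacuation is rotation, and both evacuation and rotation commute with switching.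
\<close>

section \<open>Switching of content words\<close>

text \<open>Coding chains by contents makes \<open>switch\<close> a function on arbitrary integer
  lists: its formal laws need no diagrams, which enter only through \<open>path\<close>. The
  obstacle is that growth squares violate the braid relation. For the hook with contents 0, 1, -1,
  switching the last two letters before or after rectifying them past the first gives [0, 1] and
  [0, -1] respectively. So switching and rectification do not commute in general, and closing the
  carton has to use the rectangle. That chains from \<open>D\<close> to the rectangle correspond to
  chains of the rotated complement is obtained by counting: rectification expands the generating
  function of the words from \<open>D\<close> to the rectangle in Schur functions, rotation and
  symmetry show that it is a single Schur function, and linear independence forces the
  multiplicities to be 0 or 1. Pieri's rule for Schur functions comes from the same expansion,
  applied to a skew shape made of two disconnected pieces, whose generating function is a
  product.\<close>

text \<open>
  The content of the box \<open>(i, j)\<close> is \<open>j - i\<close>.  In a growth square, \<open>s\<close> and \<open>c\<close> are the contents of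
  the boxes added along one of the two ways around it, and \<open>cross s c\<close> are those added along
  the other: two boxes can be added in either order iff their contents differ by at least 2.
\<close>

definition far :: "int \<Rightarrow> int \<Rightarrow> bool" where
  "far s c \<longleftrightarrow> 2 \<le> \<bar>s - c\<bar>"

definition cross :: "int \<Rightarrow> int \<Rightarrow> int \<times> int" where
  "cross s c = (if far s c then (c, s) else (s, c))"

text \<open>
  \<open>slide\<close> and \<open>switch\<close> compute the two remaining sides of a growth strip and of a growth rectangle.
\<close>

fun slide :: "int \<Rightarrow> int list \<Rightarrow> int list \<times> int" where
  "slide s [] = ([], s)"
| "slide s (c # w) =
     (let (c', s') = cross s c; (w', t) = slide s' w in (c' # w', t))"

fun switch :: "int list \<Rightarrow> int list \<Rightarrow> int list \<times> int list" where
  "switch [] B = (B, [])"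
| "switch (s # A) B =
     (let (B', A') = switch A B; (B'', t) = slide s B' in (B'', t # A'))"

section \<open>Formal laws of switching, valid for arbitrary words\<close>

lemma far_sym: "far s c \<longleftrightarrow> far c s"
  by (auto simp: far_def)

lemma cross_cross: "cross s c = (c', s') \<Longrightarrow> cross c' s' = (s, c)"
  by (auto simp: cross_def far_sym split: if_splits)

lemma cross_rev: "cross s c = (c', s') \<Longrightarrow> cross c s = (s', c')"
  by (auto simp: cross_def far_sym split: if_splits)

lemma length_slide: "slide s w = (w', t) \<Longrightarrow> length w' = length w"
  by (induction w arbitrary: s w' t) (auto split: prod.splits simp: Let_def)

lemma switch_length: "switch A B = (B', A') \<Longrightarrow> length B' = length B \<and> length A' = length A"
  by (induction A arbitrary: B' A') (auto split: prod.splits simp: Let_def dest: length_slide)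

lemma switch_Nil2 [simp]: "switch A [] = ([], A)"
  by (induction A) auto

lemma slide_append:
  "slide s u = (u', t) \<Longrightarrow> slide t v = (v', q) \<Longrightarrow> slide s (u @ v) = (u' @ v', q)"
  by (induction u arbitrary: s u' t) (auto split: prod.splits simp: Let_def)

lemma switch_append1:
  "switch A2 B = (B1, A2') \<Longrightarrow> switch A1 B1 = (B2, A1') \<Longrightarrow> switch (A1 @ A2) B = (B2, A1' @ A2')"
  by (induction A1 arbitrary: B2 A1') (auto split: prod.splits simp: Let_def)

lemma switch_append2:
  "switch A B1 = (B1', A1) \<Longrightarrow> switch A1 B2 = (B2', A2) \<Longrightarrow> switch A (B1 @ B2) = (B1' @ B2', A2)"
proof (induction A arbitrary: B1' A1 B2' A2)
  case (Cons s A)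
  obtain X A' where 1: "switch A B1 = (X, A')" by fastforce
  obtain X' t where 2: "slide s X = (X', t)" by fastforce
  have 3: "B1' = X'" "A1 = t # A'" using Cons.prems(1) 1 2 by auto
  obtain Y A'' where 4: "switch A' B2 = (Y, A'')" by fastforce
  obtain Y' u where 5: "slide t Y = (Y', u)" by fastforce
  have 6: "B2' = Y'" "A2 = u # A''" using Cons.prems(2) 3 4 5 by auto
  show ?case using Cons.IH[OF 1 4] slide_append[OF 2 5] 3 6 by simp
qed auto

lemma switch_singleton_ex: "slide s w = (w', t) \<Longrightarrow> switch [s] w = (w', [t])"
  by auto

lemma slide_inverse: "slide s w = (w', t) \<Longrightarrow> switch w' [t] = ([s], w)"
proof (induction w arbitrary: s w')
  case (Cons c w)
  obtain c' s' where 1: "cross s c = (c', s')" by fastforce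
  obtain w2 t' where 2: "slide s' w = (w2, t')" by fastforce
  have 3: "w' = c' # w2" "t' = t" using Cons.prems 1 2 by auto
  have "switch w2 [t] = ([s'], w)" using Cons.IH 2 3 by auto
  then show ?case using 3 cross_cross[OF 1] by simp
qed auto

text \<open>Each growth square can be read back from its two new sides by
  \<open>cross_cross\<close>, so the whole rectangle can be recovered from the two sides that
  \<open>switch\<close> computes.\<close>

lemma switch_switch: "switch A B = (B', A') \<Longrightarrow> switch B' A' = (A, B)"
proof (induction A arbitrary: B' A')
  case (Cons s A)
  obtain B1 A1 where 1: "switch A B = (B1, A1)" by fastforce
  obtain B2 t where 2: "slide s B1 = (B2, t)" by fastforce
  have 3: "B' = B2" "A' = [t] @ A1" using Cons.prems 1 2 by auto
  show ?case
    using switch_append2[OF slide_inverse[OF 2] Cons.IH[OF 1]] 3 by simp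
qed auto

lemma switch_append2_ex:
  assumes "switch A (B1 @ B2) = (B', A')"
  obtains B1' A1 B2' where "switch A B1 = (B1', A1)" "switch A1 B2 = (B2', A')" "B' = B1' @ B2'"
proof -
  obtain B1' A1 where 1: "switch A B1 = (B1', A1)" by fastforce
  obtain B2' A2 where 2: "switch A1 B2 = (B2', A2)" by fastforce
  show ?thesis using that 1 2 switch_append2[OF 1 2] assms by auto
qed

lemma switch_append1_ex:
  assumes "switch (A1 @ A2) B = (B', A')"
  obtains A1' A2' B1 where "switch A2 B = (B1, A2')" "switch A1 B1 = (B', A1')" "A' = A1' @ A2'"
proof -
  obtain B1 A2' where 1: "switch A2 B = (B1, A2')" by fastforce
  obtain B2 A1' where 2: "switch A1 B1 = (B2, A1')" by fastforce
  show ?thesis using that 1 2 switch_append1[OF 1 2] assms by auto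
qed

lemma slide_rev: "slide s w = (w', t) \<Longrightarrow> switch (rev w) [s] = ([t], rev w')"
proof (induction w arbitrary: s w')
  case (Cons c w)
  obtain c' s' where 1: "cross s c = (c', s')" by fastforce
  obtain w2 t' where 2: "slide s' w = (w2, t')" by fastforce
  have 3: "w' = c' # w2" "t' = t" using Cons.prems 1 2 by auto
  have "switch (rev w) [s'] = ([t], rev w2)" using Cons.IH 2 3 by auto
  moreover have "switch [c] [s] = ([s'], [c'])" using cross_rev[OF 1] by simp
  ultimately show ?case using 3 switch_append1 by fastforce
qed auto

text \<open>A growth rectangle turned by 180 degrees is again a growth rectangle: a square looks the
  same from its other end, by \<open>cross_rev\<close>.\<close>

lemma switch_rev: "switch A B = (B', A') \<Longrightarrow> switch (rev B) (rev A) = (rev A', rev B')"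
proof (induction A arbitrary: B' A')
  case (Cons s A)
  obtain B1 A1 where 1: "switch A B = (B1, A1)" by fastforce
  obtain B2 t where 2: "slide s B1 = (B2, t)" by fastforce
  have 3: "B' = B2" "A' = t # A1" using Cons.prems 1 2 by auto
  show ?case
    using switch_append2[OF Cons.IH[OF 1] slide_rev[OF 2]] 3 by simp
qed auto

lemma slide_map:
  assumes "\<And>x y. far (f x) (f y) = far x y"
  shows "slide (f s) (map f w) = map_prod (map f) f (slide s w)"
  by (induction w arbitrary: s) (auto split: prod.splits if_splits simp: Let_def assms cross_def)

lemma switch_map:
  assumes "\<And>x y. far (f x) (f y) = far x y"
  shows "switch (map f A) (map f B) = map_prod (map f) (map f) (switch A B)"
  by (induction A) (auto split: prod.splits simp: Let_def slide_map[OF assms])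

text \<open>Turning an l by k rectangle by 180 degrees replaces the content c of a box by k - l - c
  and reverses the order in which boxes are added. Hence \<open>n\<close> will be k - l.\<close>

definition rotate_word :: "int \<Rightarrow> int list \<Rightarrow> int list" where
  "rotate_word n w = rev (map (\<lambda>c. n - c) w)"

lemma rotate_word_append: "rotate_word n (u @ v) = rotate_word n v @ rotate_word n u"
  by (simp add: rotate_word_def)

lemma length_rotate_word [simp]: "length (rotate_word n w) = length w"
  by (simp add: rotate_word_def)

lemma rotate_word_rotate_word [simp]: "rotate_word n (rotate_word n w) = w"
  by (simp add: rotate_word_def rev_map o_def)

lemma switch_rotate_word:
  assumes "switch A B = (B', A')"
  shows "switch (rotate_word n B) (rotate_word n A) = (rotate_word n A', rotate_word n B')"
proof -
  have "switch (map ((-) n) A) (map ((-) n) B) = (map ((-) n) B', map ((-) n) A')"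
    by (subst switch_map) (auto simp: far_def assms)
  from switch_rev[OF this] show ?thesis by (simp add: rotate_word_def)
qed

section \<open>Evacuation\<close>

text \<open>Schuetzenberger's evacuation: the first letter is slid out to the end, and what it
  leaves behind is evacuated in turn. The underlying growth diagram is triangular.\<close>

function evac :: "int list \<Rightarrow> int list" where
  "evac [] = []"
| "evac (s # w) = evac (fst (slide s w)) @ [snd (slide s w)]"
  by pat_completeness auto
termination by (relation "measure length") (auto, metis length_slide less_Suc_eq prod.collapse)

lemma evac_Cons: "slide s w = (w', t) \<Longrightarrow> evac (s # w) = evac w' @ [t]"
  by simp

declare evac.simps(2) [simp del]

lemma length_evac [simp]: "length (evac w) = length w"
  by (induction w rule: evac.induct) (simp, metis evac.simps(2) length_Cons length_append_singleton length_slide prod.collapse)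

text \<open>The letters of \<open>A\<close> are slid out one after another and then pass through
  \<open>B\<close>. The first one to leave is the last letter of \<open>evac A\<close>, and
  \<open>switch\<close> also moves the last letter of its first argument first, so the total effect
  on \<open>B\<close> is a single switch with \<open>evac A\<close>.\<close>

lemma evac_append:
  "switch (evac A) B = (B', A') \<Longrightarrow> evac (A @ B) = evac B' @ A'"
proof (induction A arbitrary: B B' A' rule: evac.induct)
  case (2 s w)
  obtain w' t where 1: "slide s w = (w', t)" by fastforce
  obtain B1 u where 2: "slide t B = (B1, u)" by fastforce
  obtain B2 A2 where 3: "switch (evac w') B1 = (B2, A2)" by fastforce
  have "switch (evac w' @ [t]) B = (B2, A2 @ [u])"
    using switch_append1[OF switch_singleton_ex[OF 2] 3] .
  then have 4: "B' = B2" "A' = A2 @ [u]" using "2.prems" evac_Cons[OF 1] by auto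
  have "evac (s # w @ B) = evac (w' @ B1) @ [u]"
    using slide_append[OF 1 2] by (rule evac_Cons)
  also have "evac (w' @ B1) = evac B2 @ A2" using "2.IH" 1 3 by auto
  finally show ?case using 4 by simp
qed auto

lemma evac_inj:
  "length v = length w \<Longrightarrow> evac v = evac w \<Longrightarrow> v = w"
proof (induction v arbitrary: w rule: evac.induct)
  case (2 s v)
  then obtain s2 w2 where w: "w = s2 # w2" by (cases w) auto
  obtain v' t where 1: "slide s v = (v', t)" by fastforce
  obtain w' u where 2: "slide s2 w2 = (w', u)" by fastforce
  have l: "length v' = length w'" using 1 2 "2.prems" w length_slide by (metis length_Cons nat.inject)
  have "evac v' = evac w'" "t = u" using "2.prems" w evac_Cons[OF 1] evac_Cons[OF 2] by auto
  then have "v' = w'" using "2.IH" 1 l by auto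
  then show ?case using slide_inverse[OF 1] slide_inverse[OF 2] \<open>t = u\<close> w by auto
qed auto

text \<open>For the content word of a standard tableau this records the complement of the descent
  set, because the next box lies in a strictly lower row iff its content is smaller.\<close>

fun ascents :: "int list \<Rightarrow> bool list" where
  "ascents (a # b # w) = (a < b) # ascents (b # w)"
| "ascents w = []"

section \<open>Content words of chains of diagrams\<close>

text \<open>A diagram has at most one addable and at most one removable box on each diagonal. Hence
  contents lose no information about a chain once one of its ends is known, see
  \<open>add_box_det\<close> and \<open>add_box_det_rev\<close>.\<close>

definition add_box :: "diagram \<Rightarrow> int \<Rightarrow> diagram \<Rightarrow> bool" where
  "add_box D c E \<longleftrightarrow> young_diagram D \<and> young_diagram E \<and>
     (\<exists>i j. (i, j) \<notin> D \<and> E = insert (i, j) D \<and> int j - int i = c)"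

fun path :: "diagram \<Rightarrow> int list \<Rightarrow> diagram \<Rightarrow> bool" where
  "path D [] E \<longleftrightarrow> D = E \<and> young_diagram D"
| "path D (c # w) E \<longleftrightarrow> (\<exists>M. add_box D c M \<and> path M w E)"

lemma young_empty [simp]: "young_diagram {}"
  by (simp add: young_diagram_def)

lemma young_finite: "young_diagram D \<Longrightarrow> finite D"
  by (simp add: young_diagram_def)

lemma young_down: "young_diagram D \<Longrightarrow> (i, j) \<in> D \<Longrightarrow> i' \<le> i \<Longrightarrow> j' \<le> j \<Longrightarrow> (i', j') \<in> D"
  unfolding young_diagram_def by blast

lemma addable_same_content:
  assumes "young_diagram (insert (i, j) D)" "young_diagram (insert (i', j') D)"
    "(i, j) \<notin> D" "(i', j') \<notin> D" "int j - int i = int j' - int i'"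
  shows "i = i' \<and> j = j'"
proof (cases i i' rule: linorder_cases)
  case less
  then have "(i, j) \<in> insert (i', j') D" using young_down[OF assms(2), of i' j' i j] assms(5) by auto
  then show ?thesis using assms less by auto
next
  case greater
  then have "(i', j') \<in> insert (i, j) D" using young_down[OF assms(1), of i j i' j'] assms(5) by auto
  then show ?thesis using assms greater by auto
qed (use assms(5) in auto)

lemma removable_same_content:
  assumes "young_diagram E" "young_diagram (E - {(i, j)})" "young_diagram (E - {(i', j')})"
    "(i, j) \<in> E" "(i', j') \<in> E" "int j - int i = int j' - int i'"
  shows "i = i' \<and> j = j'"
proof (cases i i' rule: linorder_cases)
  case less
  then have "(i, j) \<in> E - {(i, j)}" using young_down[OF assms(2), of i' j' i j] assms by auto
  then show ?thesis by auto
next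
  case greater
  then have "(i', j') \<in> E - {(i', j')}" using young_down[OF assms(3), of i j i' j'] assms by auto
  then show ?thesis by auto
qed (use assms(6) in auto)

lemma add_box_det: "add_box D c E \<Longrightarrow> add_box D c E' \<Longrightarrow> E = E'"
  unfolding add_box_def using addable_same_content by metis

lemma add_box_det_rev: "add_box D c E \<Longrightarrow> add_box D' c E \<Longrightarrow> D = D'"
  unfolding add_box_def
proof (elim conjE exE)
  fix i j i' j'
  assume *: "young_diagram D" "young_diagram E" "(i, j) \<notin> D" "E = insert (i, j) D" "int j - int i = c"
    "young_diagram D'" "(i', j') \<notin> D'" "E = insert (i', j') D'" "int j' - int i' = c"
  have D: "D = E - {(i, j)}" "D' = E - {(i', j')}" using *(3,4,7,8) by blast+
  have "i = i' \<and> j = j'"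
  proof (rule removable_same_content)
    show "young_diagram E" "young_diagram (E - {(i, j)})" "young_diagram (E - {(i', j')})"
      using *(1,2,6) D by simp_all
    show "(i, j) \<in> E" using *(4) by simp
    show "(i', j') \<in> E" using *(8) by simp
    show "int j - int i = int j' - int i'" using *(5,9) by simp
  qed
  then show "D = D'" using D by simp
qed

lemma add_box_content:
  assumes "add_box D c E" "add_box D c' E"
  shows "c = c'"
proof -
  obtain i j i' j' where "(i, j) \<notin> D" "E = insert (i, j) D" "int j - int i = c"
    "(i', j') \<notin> D" "E = insert (i', j') D" "int j' - int i' = c'"
    using assms unfolding add_box_def by blast
  moreover from this have "(i, j) = (i', j')" by blast
  ultimately show ?thesis by simp
qed

lemma add_box_young: "add_box D c E \<Longrightarrow> young_diagram D \<and> young_diagram E"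
  by (auto simp: add_box_def)

lemma add_box_subset: "add_box D c E \<Longrightarrow> D \<subseteq> E"
  by (auto simp: add_box_def)

lemma add_box_card: "add_box D c E \<Longrightarrow> card E = Suc (card D)"
  by (auto simp: add_box_def young_finite)

lemma add_box_adds_one_box:
  "young_diagram D \<Longrightarrow> young_diagram E \<Longrightarrow> adds_one_box D E \<longleftrightarrow> (\<exists>c. add_box D c E)"
  by (auto simp: add_box_def adds_one_box_def)

lemma path_young: "path D w E \<Longrightarrow> young_diagram D \<and> young_diagram E"
  by (induction w arbitrary: D) (auto simp: add_box_def)

lemma path_append: "path D (u @ v) E \<longleftrightarrow> (\<exists>M. path D u M \<and> path M v E)"
  by (induction u arbitrary: D) (auto dest: path_young)

lemma path_single [simp]: "path D [c] E \<longleftrightarrow> add_box D c E"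
  by (auto dest: add_box_young)

lemma path_subset: "path D w E \<Longrightarrow> D \<subseteq> E"
  by (induction w arbitrary: D) (auto dest: add_box_subset)

lemma path_card: "path D w E \<Longrightarrow> card E = card D + length w"
  by (induction w arbitrary: D) (auto dest: add_box_card)

lemma path_det: "path D w E \<Longrightarrow> path D w E' \<Longrightarrow> E = E'"
  by (induction w arbitrary: D) (auto dest: add_box_det)

lemma path_content_mem: "path D w E \<Longrightarrow> (i, j) \<in> E \<Longrightarrow> (i, j) \<notin> D \<Longrightarrow> int j - int i \<in> set w"
  by (induction w arbitrary: D) (auto simp: add_box_def)

text \<open>The second box of content \<open>c\<close> lies further down the same diagonal, so the
  right and the lower neighbour of the first box have to be added in between.\<close>

lemma path_repeat:
  assumes "path D (c # w @ [c]) E"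
  shows "c + 1 \<in> set w \<and> c - 1 \<in> set w"
proof -
  obtain M N where 1: "add_box D c M" "path M w N" "add_box N c E"
    using assms by (auto simp: path_append)
  obtain i j where ij: "(i, j) \<notin> D" "M = insert (i, j) D" "int j - int i = c"
    using 1(1) by (auto simp: add_box_def)
  obtain i' j' where ij': "(i', j') \<notin> N" "E = insert (i', j') N" "int j' - int i' = c"
    using 1(3) by (auto simp: add_box_def)
  have y: "young_diagram D" "young_diagram M" "young_diagram E" using 1 add_box_young by auto
  have "(i, j) \<in> N" using path_subset[OF 1(2)] ij by auto
  have N: "young_diagram N" using 1(3) add_box_young by auto
  have "i < i'" using young_down[OF N \<open>(i, j) \<in> N\<close>, of i' j'] ij ij' by (cases "i' \<le> i") auto
  have "(i, Suc j) \<in> E" "(Suc i, j) \<in> E"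
    using \<open>i < i'\<close> ij ij' young_down[OF y(3), of i' j' i "Suc j"] young_down[OF y(3), of i' j' "Suc i" j] by auto
  then have "(i, Suc j) \<in> N" "(Suc i, j) \<in> N" using ij ij' by auto
  moreover have "(i, Suc j) \<notin> M" "(Suc i, j) \<notin> M"
    using ij young_down[OF y(1), of i "Suc j" i j] young_down[OF y(1), of "Suc i" j i j] by auto
  ultimately show ?thesis
    using path_content_mem[OF 1(2), of i "Suc j"] path_content_mem[OF 1(2), of "Suc i" j] ij(3)
    by (auto simp: algebra_simps)
qed

lemma path_adjacent: "path D [a, b] E \<Longrightarrow> a \<noteq> b"
  using path_repeat[of D a "[]" E] by auto

lemma path_three: "path D [a, b, a] E \<Longrightarrow> False"
  using path_repeat[of D a "[b]" E] by auto

lemma addable_far: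
  assumes "young_diagram (insert (i, j) D)" "young_diagram (insert (i', j') D)"
    "(i, j) \<notin> D" "(i', j') \<notin> D" "(i, j) \<noteq> (i', j')"
  shows "far (int j - int i) (int j' - int i')"
proof -
  have "\<not> (i \<le> i' \<and> j \<le> j')"
    using young_down[OF assms(2), of i' j' i j] assms by auto
  moreover have "\<not> (i' \<le> i \<and> j' \<le> j)"
    using young_down[OF assms(1), of i j i' j'] assms by auto
  ultimately show ?thesis by (auto simp: far_def)
qed

lemma path_swap_far:
  assumes "add_box D s M" "add_box M c E" "far s c"
  obtains M' where "add_box D c M'" "add_box M' s E"
proof -
  obtain i j where ij: "(i, j) \<notin> D" "M = insert (i, j) D" "int j - int i = s"
    using assms(1) by (auto simp: add_box_def)
  obtain i' j' where ij': "(i', j') \<notin> M" "E = insert (i', j') M" "int j' - int i' = c"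
    using assms(2) by (auto simp: add_box_def)
  have y: "young_diagram D" "young_diagram E" using assms add_box_young by auto
  \<comment> \<open>If the second box were weakly south-east of the first, a neighbour of
    \<open>(i, j)\<close> would belong to \<open>E\<close>, although it is neither in
    \<open>D\<close> nor, by \<open>far s c\<close>, the second box.\<close>
  have n: "\<not> (i \<le> i' \<and> j \<le> j')"
  proof
    assume a: "i \<le> i' \<and> j \<le> j'"
    have "Suc i \<le> i' \<and> j \<le> j' \<or> i \<le> i' \<and> Suc j \<le> j'" using a ij ij' by auto
    moreover have "(Suc i, j) \<noteq> (i', j')" "(i, Suc j) \<noteq> (i', j')" using assms(3) ij ij' by (auto simp: far_def)
    moreover have "(Suc i, j) \<notin> D" "(i, Suc j) \<notin> D" using ij young_down[OF y(1)]
      by (metis Suc_n_not_le_n nat_le_linear)+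
    ultimately show False using young_down[OF y(2), of i' j' "Suc i" j] young_down[OF y(2), of i' j' i "Suc j"]
      using ij ij' by auto
  qed
  have "young_diagram (insert (i', j') D)"
    unfolding young_diagram_def
  proof (intro conjI allI impI)
    show "finite (insert (i', j') D)" using y young_finite by auto
    fix a b a' b' assume h: "(a, b) \<in> insert (i', j') D" "a' \<le> a" "b' \<le> b"
    show "(a', b') \<in> insert (i', j') D"
    proof (cases "(a, b) = (i', j')")
      case True
      then have "(a', b') \<in> E" using h young_down[OF y(2), of i' j'] ij' by auto
      then show ?thesis using ij ij' n h True by auto
    qed (use h young_down[OF y(1)] in auto)
  qed
  moreover have "(i', j') \<notin> D" "E = insert (i, j) (insert (i', j') D)" "(i, j) \<notin> insert (i', j') D"
    using ij ij' by auto
  ultimately show ?thesis using that[of "insert (i', j') D"] y ij(3) ij'(3)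
    unfolding add_box_def by blast
qed

lemma intermediate_shapes_add_box:
  assumes "add_box D s M" "add_box M c E"
  shows "intermediate_shapes D E = {M'. \<exists>c' s'. add_box D c' M' \<and> add_box M' s' E}"
proof -
  have y: "young_diagram D" "young_diagram E" using assms add_box_young by auto
  have cE: "card E = Suc (Suc (card D))" using assms add_box_card by metis
  show ?thesis
  proof (intro set_eqI iffI)
    fix M' assume "M' \<in> intermediate_shapes D E"
    then have h: "young_diagram M'" "D \<subset> M'" "M' \<subset> E" "card M' = card D + 1"
      by (auto simp: intermediate_shapes_def)
    have f: "finite M'" "finite E" "finite D" using h y young_finite by auto
    have "card (M' - D) = 1" using h f by (simp add: card_Diff_subset psubset_imp_subset)
    then obtain p where "M' - D = {p}" by (auto simp: card_1_singleton_iff)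
    then have 1: "M' = insert p D" "p \<notin> D" using h by auto
    have "card (E - M') = 1" using h f cE by (simp add: card_Diff_subset psubset_imp_subset)
    then obtain q where "E - M' = {q}" by (auto simp: card_1_singleton_iff)
    then have 2: "E = insert q M'" "q \<notin> M'" using h by auto
    show "M' \<in> {M'. \<exists>c' s'. add_box D c' M' \<and> add_box M' s' E}"
      using 1 2 h y unfolding add_box_def by (cases p; cases q) blast
  next
    fix M' assume "M' \<in> {M'. \<exists>c' s'. add_box D c' M' \<and> add_box M' s' E}"
    then obtain c' s' where h: "add_box D c' M'" "add_box M' s' E" by auto
    have "D \<subset> M'" "M' \<subset> E" using h by (auto simp: add_box_def)
    then show "M' \<in> intermediate_shapes D E" using h add_box_card[OF h(1)] add_box_young[OF h(1)]
      by (auto simp: intermediate_shapes_def)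
  qed
qed

text \<open>\<open>E - D\<close> has two boxes, so only their order can vary. If either of them can
  come first, both are addable to \<open>D\<close>, and then \<open>addable_far\<close>
  applies.\<close>

lemma path_two_contents:
  assumes "add_box D s M" "add_box M c E" "add_box D c' M'" "add_box M' s' E"
  shows "(c' = s \<and> s' = c \<and> M' = M) \<or> (c' = c \<and> s' = s \<and> far s c \<and> M' \<noteq> M)"
proof -
  obtain i j where ij: "(i, j) \<notin> D" "M = insert (i, j) D" "int j - int i = s"
    using assms(1) by (auto simp: add_box_def)
  obtain i' j' where ij': "(i', j') \<notin> M" "E = insert (i', j') M" "int j' - int i' = c"
    using assms(2) by (auto simp: add_box_def)
  obtain u v where uv: "(u, v) \<notin> D" "M' = insert (u, v) D" "int v - int u = c'"
    using assms(3) by (auto simp: add_box_def)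
  obtain u' v' where uv': "(u', v') \<notin> M'" "E = insert (u', v') M'" "int v' - int u' = s'"
    using assms(4) by (auto simp: add_box_def)
  have y: "young_diagram M" "young_diagram M'" using assms add_box_young by auto
  have "{(i, j), (i', j')} = E - D" using ij(1,2) ij'(1,2) by blast
  moreover have "{(u, v), (u', v')} = E - D" using uv(1,2) uv'(1,2) by blast
  ultimately have "{(i, j), (i', j')} = {(u, v), (u', v')}" by simp
  then consider "(u, v) = (i, j)" "(u', v') = (i', j')" | "(u, v) = (i', j')" "(u', v') = (i, j)"
    by (metis doubleton_eq_iff)
  then show ?thesis
  proof cases
    case 1
    then show ?thesis using ij(2,3) ij'(3) uv(2,3) uv'(3) by simp
  next
    case 2
    have "(i', j') \<noteq> (i, j)" "(i', j') \<notin> D" using ij'(1) ij(2) by auto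
    moreover from this have "far s c" using addable_far[of i j D i' j'] y ij(1,2,3) ij'(3) uv(2) 2 by auto
    moreover have "M' \<noteq> M" using calculation(1,2) ij(2) uv(2) 2 by auto
    ultimately show ?thesis using 2 ij(3) ij'(3) uv(3) uv'(3) by simp
  qed
qed

text \<open>This is the bridge between growth conditions on shapes and computations with words: the
  interval from \<open>D\<close> to \<open>E\<close> has two intermediate shapes if the contents are
  far apart and one otherwise, which are the cases (F2) and (F1).\<close>

lemma fomin_growth_iff_cross:
  assumes "add_box D s M" "add_box M c E" "add_box D c' M'" "add_box M' s' E"
  shows "fomin_growth D M M' E \<longleftrightarrow> cross s c = (c', s')"
proof (cases "far s c")
  case False
  then have "M'' = M" if "add_box D a M''" "add_box M'' b E" for M'' a b
    using path_two_contents[OF assms(1,2) that] by auto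
  then have "intermediate_shapes D E = {M}"
    unfolding intermediate_shapes_add_box[OF assms(1,2)] using assms(1,2) by blast
  then show ?thesis using False path_two_contents[OF assms] by (auto simp: fomin_growth_def cross_def)
next
  case True
  obtain N where N: "add_box D c N" "add_box N s E" using path_swap_far[OF assms(1,2) True] .
  have sc: "s \<noteq> c" using True by (auto simp: far_def)
  have "N \<noteq> M" using N assms sc add_box_content by blast
  moreover have "M'' = M \<or> M'' = N" if "add_box D a M''" "add_box M'' b E" for M'' a b
    using path_two_contents[OF assms(1,2) that] N(1) that(1) add_box_det by metis
  then have "intermediate_shapes D E = {M, N}"
    unfolding intermediate_shapes_add_box[OF assms(1,2)] using assms(1,2) N by blast
  ultimately have 1: "fomin_growth D M M' E \<longleftrightarrow> M' = N"
    by (auto simp: fomin_growth_def doubleton_eq_iff insert_Diff_if)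
  have "M' = N \<longleftrightarrow> (c', s') = (c, s)"
    using N assms add_box_content add_box_det by blast
  then show ?thesis using 1 True by (auto simp: cross_def)
qed

lemma fomin_growth_add_box:
  assumes "add_box D s M" "add_box M c E" "cross s c = (c', s')"
  obtains M' where "add_box D c' M'" "add_box M' s' E"
  using path_swap_far[OF assms(1,2)] assms that by (auto simp: cross_def split: if_splits)

lemma fomin_growth_sym:
  assumes "add_box D s M" "add_box M c E" "add_box D c' M'" "add_box M' s' E"
  shows "fomin_growth D M M' E \<longleftrightarrow> fomin_growth D M' M E"
  using fomin_growth_iff_cross[OF assms] fomin_growth_iff_cross[OF assms(3,4,1,2)] cross_cross by metis

lemma path_slide: "slide s w = (w', t) \<Longrightarrow> path D (s # w) E \<Longrightarrow> path D (w' @ [t]) E"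
proof (induction w arbitrary: s w' D)
  case (Cons c w)
  obtain c' s' where 1: "cross s c = (c', s')" by fastforce
  obtain w2 t' where 2: "slide s' w = (w2, t')" by fastforce
  have 3: "w' = c' # w2" "t' = t" using Cons.prems 1 2 by auto
  obtain M N where "add_box D s M" "add_box M c N" "path N w E" using Cons.prems(2) by auto
  then obtain M' where "add_box D c' M'" "add_box M' s' N" using fomin_growth_add_box 1 by metis
  then have "path M' (w2 @ [t]) E" using Cons.IH[of s' w2 M'] 2 3 \<open>path N w E\<close> by auto
  then show ?case using 3 \<open>add_box D c' M'\<close> by auto
qed auto

lemma path_switch: "switch A B = (B', A') \<Longrightarrow> path D (A @ B) E \<Longrightarrow> path D (B' @ A') E"
proof (induction A arbitrary: B' A' D)
  case (Cons s A)
  obtain B1 A1 where 1: "switch A B = (B1, A1)" by fastforce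
  obtain B2 t where 2: "slide s B1 = (B2, t)" by fastforce
  have 3: "B' = B2" "A' = [t] @ A1" using Cons.prems 1 2 by auto
  obtain M where M: "add_box D s M" "path M (A @ B) E" using Cons.prems by auto
  have "path D ((s # B1) @ A1) E" using M Cons.IH[OF 1 M(2)] by auto
  then obtain N where "path D (s # B1) N" "path N A1 E" unfolding path_append by auto
  then have "path D (B2 @ [t]) N" using path_slide[OF 2] by auto
  then have "path D ((B2 @ [t]) @ A1) E" using \<open>path N A1 E\<close> path_append by blast
  then show ?case using 3 by simp
qed auto

lemma path_evac: "path D w E \<Longrightarrow> path D (evac w) E"
proof (induction w arbitrary: E rule: evac.induct)
  case (2 s w)
  obtain w' t where 1: "slide s w = (w', t)" by fastforce
  then obtain M where "path D w' M" "add_box M t E"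
    using path_slide[OF 1 "2.prems"] unfolding path_append path_single by blast
  then have "path D (evac w' @ [t]) E" using "2.IH" 1 unfolding path_append path_single by auto
  then show ?case using evac_Cons[OF 1] by simp
qed auto

section \<open>Switching preserves ascents\<close>

lemma ascents_slide:
  "path D (s # w) E \<Longrightarrow> slide s w = (w', t) \<Longrightarrow> ascents w' = ascents w"
proof (induction w arbitrary: s w' D)
  case (Cons p w)
  obtain p' s' where 1: "cross s p = (p', s')" by fastforce
  obtain w2 t' where 2: "slide s' w = (w2, t')" by fastforce
  have 3: "w' = p' # w2" "t' = t" using Cons.prems(2) 1 2 by auto
  obtain M N where M: "add_box D s M" "add_box M p N" "path N w E" using Cons.prems(1) by auto
  then obtain M' where "add_box D p' M'" "add_box M' s' N" using fomin_growth_add_box 1 by metis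
  then have IH: "ascents w2 = ascents w" using Cons.IH[of M' s' w2] 2 3 M(3) by auto
  show ?case
  proof (cases w)
    case (Cons q v)
    obtain q' s'' where 4: "cross s' q = (q', s'')" by fastforce
    then obtain v' where 5: "w2 = q' # v'" using 2 Cons by (auto split: prod.splits)
    obtain N' where "add_box N q N'" using M(3) Cons by auto
    then have sp: "path D [s, p, q] N'" "path D [s, p] N" "path M [p, q] N'"
      using M add_box_young by (auto intro: exI[of _ M] exI[of _ N])
    \<comment> \<open>A sliding step changes a letter by at most 1. The order of \<open>p\<close>
      and \<open>q\<close> could therefore only be lost near a repetition among \<open>s\<close>,
      \<open>p\<close>, \<open>q\<close>, and the geometry of diagonals excludes these.\<close>
    then have "s \<noteq> p" "p \<noteq> q" "s \<noteq> q" using path_adjacent path_three by blast+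
    then have "p < q \<longleftrightarrow> p' < q'" using 1 4 by (auto simp: cross_def far_def split: if_splits)
    then show ?thesis using 3 5 Cons IH by simp
  next
    case Nil
    then show ?thesis using 2 3 by auto
  qed
qed auto

lemma ascents_switch_fst:
  "path D (A @ B) E \<Longrightarrow> switch A B = (B', A') \<Longrightarrow> ascents B' = ascents B"
proof (induction A arbitrary: B' A' D)
  case (Cons s A)
  obtain B1 A1 where 1: "switch A B = (B1, A1)" by fastforce
  obtain B2 t where 2: "slide s B1 = (B2, t)" by fastforce
  obtain M where M: "add_box D s M" "path M (A @ B) E" using Cons.prems by auto
  have a: "ascents B1 = ascents B" using Cons.IH[OF M(2) 1] .
  have "path D ((s # B1) @ A1) E" using M path_switch[OF 1 M(2)] by auto
  then obtain N where "path D (s # B1) N" unfolding path_append by auto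
  from ascents_slide[OF this 2] show ?case using a Cons.prems 1 2 by auto
qed auto

lemma ascents_switch:
  assumes "path D (A @ B) E" "switch A B = (B', A')"
  shows "ascents B' = ascents B \<and> ascents A' = ascents A"
  using ascents_switch_fst[OF assms] ascents_switch_fst[OF path_switch[OF assms(2,1)] switch_switch[OF assms(2)]]
  by simp

section \<open>Dual equivalence\<close>

text \<open>Elementary dual equivalences of chains act as Knuth moves on content words.\<close>

definition knuth3 :: "int list \<Rightarrow> int list \<Rightarrow> bool" where
  "knuth3 x y \<longleftrightarrow> (\<exists>p q r. x = [p, q, r] \<and>
     ((p < r \<and> r < q \<or> q < r \<and> r < p) \<and> y = [q, p, r] \<or>
      (q < p \<and> p < r \<or> r < p \<and> p < q) \<and> y = [p, r, q]))"

definition knuth :: "int list \<Rightarrow> int list \<Rightarrow> bool" where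
  "knuth x y \<longleftrightarrow> (\<exists>u a b v. x = u @ a @ v \<and> y = u @ b @ v \<and> knuth3 a b)"

lemma knuth3_sym: "knuth3 a b \<Longrightarrow> knuth3 b a"
  unfolding knuth3_def by auto

lemma knuth_sym: "knuth x y \<Longrightarrow> knuth y x"
  unfolding knuth_def using knuth3_sym by blast

lemma knuth_append: "knuth x y \<Longrightarrow> knuth (x @ z) (y @ z)"
  unfolding knuth_def by (metis append_assoc)

lemma knuth_star_append: "knuth\<^sup>*\<^sup>* x y \<Longrightarrow> knuth\<^sup>*\<^sup>* (x @ z) (y @ z)"
  by (induction rule: rtranclp_induct) (auto intro: rtranclp.rtrancl_into_rtrancl knuth_append)

lemma knuth_star_sym: "knuth\<^sup>*\<^sup>* x y \<Longrightarrow> knuth\<^sup>*\<^sup>* y x"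
  by (induction rule: rtranclp_induct) (auto intro: converse_rtranclp_into_rtranclp knuth_sym)

text \<open>The two exchanged letters have the third one strictly between them, so they differ by at
  least 2 and \<open>path_swap_far\<close> applies.\<close>

lemma path_knuth3:
  assumes "knuth3 a b" "path D a E"
  shows "path D b E"
proof -
  have sw: "path D (y # x # w) E" if "path D (x # y # w) E" "far x y" for D x y w
  proof -
    obtain M N where "add_box D x M" "add_box M y N" "path N w E" using \<open>path D (x # y # w) E\<close> by auto
    then show ?thesis using path_swap_far[of D x M y N] that(2) by (metis path.simps(2))
  qed
  obtain p q r where pqr: "a = [p, q, r]"
     "(p < r \<and> r < q \<or> q < r \<and> r < p) \<and> b = [q, p, r] \<or>
      (q < p \<and> p < r \<or> r < p \<and> p < q) \<and> b = [p, r, q]"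
    using assms(1) unfolding knuth3_def by blast
  show ?thesis
  proof (cases "b = [q, p, r] \<and> far p q")
    case True
    then show ?thesis using sw[of D p q "[r]"] assms(2) pqr by auto
  next
    case False
    then have b: "b = [p, r, q]" "far q r" using pqr by (auto simp: far_def)
    obtain M where "add_box D p M" "path M [q, r] E" using assms(2) pqr(1) by auto
    then show ?thesis using sw[of M q r "[]"] b by auto
  qed
qed

lemma path_knuth:
  assumes "knuth x y" "path D x E"
  shows "path D y E"
proof -
  obtain u a b v where 1: "x = u @ a @ v" "y = u @ b @ v" "knuth3 a b"
    using assms(1) unfolding knuth_def by blast
  then obtain M N where "path D u M" "path M a N" "path N v E"
    using assms(2) unfolding 1(1) path_append by blast
  then show ?thesis using path_knuth3[OF 1(3)] unfolding 1(2) path_append by blast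
qed

text \<open>Haiman's theorem that slides respect dual equivalence, for four boxes.\<close>

lemma switch_single_knuth3:
  assumes "knuth3 a b" "path D (a @ [c]) E" "switch a [c] = (c', a')"
  shows "\<exists>b'. switch b [c] = (c', b') \<and> knuth3 a' b'"
proof -
  obtain p q r where pqr: "a = [p, q, r]"
     "(p < r \<and> r < q \<or> q < r \<and> r < p) \<and> b = [q, p, r] \<or>
      (q < p \<and> p < r \<or> r < p \<and> p < q) \<and> b = [p, r, q]"
    using assms(1) unfolding knuth3_def by blast
  have P: "path D ([p, q, r] @ [c]) E" using assms(2) pqr by simp
  have 1: "p \<noteq> q" "q \<noteq> r" "r \<noteq> c" "p \<noteq> r" "q \<noteq> c"
  proof -
    obtain M N L where s: "add_box D p M" "add_box M q N" "add_box N r L" "add_box L c E"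
      using P by auto
    then have "path D [p, q] N" "path M [q, r] L" "path N [r, c] E" "path D [p, q, r] L" "path M [q, r, c] E"
      by (metis path.simps path_single)+
    then show "p \<noteq> q" "q \<noteq> r" "r \<noteq> c" "p \<noteq> r" "q \<noteq> c"
      using path_adjacent path_three by blast+
  qed
  \<comment> \<open>The new letter may repeat the first one, but then both neighbouring contents
    occur in between, which leaves only two words. With this and the inequalities in
    \<open>1\<close> the lemma becomes a finite case analysis on the squares.\<close>
  have 2: "p = c \<Longrightarrow> q = p + 1 \<and> r = p - 1 \<or> q = p - 1 \<and> r = p + 1"
    using path_repeat[of D p "[q, r]" E] P by auto
  show ?thesis
    using pqr(2)
  proof (elim disjE conjE)
    assume "p < r" "r < q" "b = [q, p, r]"
    then show ?thesis using pqr(1) assms(3) 1 2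
      by (auto simp: cross_def far_def knuth3_def split: if_splits)
  next
    assume "q < r" "r < p" "b = [q, p, r]"
    then show ?thesis using pqr(1) assms(3) 1 2
      by (auto simp: cross_def far_def knuth3_def split: if_splits)
  next
    assume "q < p" "p < r" "b = [p, r, q]"
    then show ?thesis using pqr(1) assms(3) 1 2
      by (auto simp: cross_def far_def knuth3_def split: if_splits)
  next
    assume "r < p" "p < q" "b = [p, r, q]"
    then show ?thesis using pqr(1) assms(3) 1 2
      by (auto simp: cross_def far_def knuth3_def split: if_splits)
  qed
qed

lemma switch_single_knuth:
  assumes "knuth A A2" "path D (A @ [c]) E" "switch A [c] = (C, A')"
  shows "\<exists>A2'. switch A2 [c] = (C, A2') \<and> knuth A' A2'"
proof -
  obtain u a b v where 1: "A = u @ a @ v" "A2 = u @ b @ v" "knuth3 a b"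
    using assms(1) unfolding knuth_def by blast
  obtain C1 v' ua' where 2: "switch v [c] = (C1, v')" "switch (u @ a) C1 = (C, ua')" "A' = ua' @ v'"
    using switch_append1_ex[of "u @ a" v] assms(3) 1(1) by (metis append_assoc)
  obtain C2 a' u' where 3: "switch a C1 = (C2, a')" "switch u C2 = (C, u')" "ua' = u' @ a'"
    using switch_append1_ex[OF 2(2)] by metis
  obtain c1 where c1: "C1 = [c1]"
    using switch_length[OF 2(1)] by (auto simp: length_Suc_conv)
  obtain M where M: "path D (u @ a) M" "path M (v @ [c]) E"
    using assms(2) path_append[of D "u @ a" "v @ [c]" E] 1(1) by auto
  obtain N where "path M [c1] N" using path_switch[OF 2(1) M(2)] c1 unfolding path_append by blast
  moreover obtain L where "path D u L" "path L a M" using M(1) unfolding path_append by blast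
  ultimately have "path L (a @ [c1]) N" unfolding path_append by blast
  then obtain b' where 4: "switch b [c1] = (C2, b')" "knuth3 a' b'"
    using switch_single_knuth3[OF 1(3)] 3(1) c1 by blast
  have "switch A2 [c] = (C, (u' @ b') @ v')"
    using switch_append1[OF 2(1), of "u @ b" C "u' @ b'"] switch_append1[OF 4(1) 3(2)] c1 1(2) by simp
  then show ?thesis using 2(3) 3(3) 4(2) unfolding knuth_def by (metis append_assoc)
qed

lemma switch_knuth:
  "knuth A A2 \<Longrightarrow> path D (A @ B) E \<Longrightarrow> switch A B = (B', A') \<Longrightarrow>
    \<exists>A2'. switch A2 B = (B', A2') \<and> knuth A' A2'"
proof (induction B arbitrary: D A A2 B')
  case (Cons c B)
  obtain C A1 B1 where 1: "switch A [c] = (C, A1)" "switch A1 B = (B1, A')" "B' = C @ B1"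
    using switch_append2_ex[of A "[c]" B B' A'] Cons.prems(3) by (metis append_Cons append_Nil)
  obtain M where M: "path D (A @ [c]) M" "path M B E"
    using Cons.prems(2) path_append[of D "A @ [c]" B E] by auto
  obtain A3 where 2: "switch A2 [c] = (C, A3)" "knuth A1 A3"
    using switch_single_knuth[OF Cons.prems(1) M(1) 1(1)] by blast
  obtain N where "path D C N" "path N A1 M" using path_switch[OF 1(1) M(1)] unfolding path_append by blast
  then have "path N (A1 @ B) E" using M(2) unfolding path_append by blast
  then obtain A4 where "switch A3 B = (B1, A4)" "knuth A' A4" using Cons.IH[OF 2(2) _ 1(2)] by blast
  then show ?case using switch_append2[OF 2(1)] 1(3) by fastforce
qed auto

lemma switch_knuth_star:
  assumes "knuth\<^sup>*\<^sup>* A A2" "path D (A @ B) E" "switch A B = (B', A')"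
  shows "\<exists>A2'. switch A2 B = (B', A2') \<and> knuth\<^sup>*\<^sup>* A' A2' \<and> path D (A2 @ B) E"
  using assms(1)
proof (induction rule: rtranclp_induct)
  case base
  then show ?case using assms by blast
next
  case (step y z)
  then obtain y' where y: "switch y B = (B', y')" "knuth\<^sup>*\<^sup>* A' y'" "path D (y @ B) E" by blast
  from switch_knuth[OF step(2) y(3,1)] obtain z' where "switch z B = (B', z')" "knuth y' z'" by blast
  moreover have "path D (z @ B) E" using path_knuth[OF knuth_append[OF step(2)] y(3)] .
  ultimately show ?case using y(2) by (meson rtranclp.rtrancl_into_rtrancl)
qed

section \<open>Removable corners, and connectedness of straight chains under Knuth moves\<close>

lemma removable_box_above:
  assumes "young_diagram E" "(i, j) \<in> E"
  obtains u v where "(u, v) \<in> E" "i \<le> u" "j \<le> v" "young_diagram (E - {(u, v)})"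
proof -
  let ?S = "{p \<in> E. i \<le> fst p \<and> j \<le> snd p}"
  have f: "finite ?S" "?S \<noteq> {}" using assms young_finite by auto
  \<comment> \<open>A box of \<open>?S\<close> with the largest coordinate sum has no further box of
    \<open>E\<close> to its south-east.\<close>
  define m where "m = Max ((\<lambda>p. fst p + snd p) ` ?S)"
  have "m \<in> (\<lambda>p. fst p + snd p) ` ?S" unfolding m_def using f by (intro Max_in) auto
  then obtain u v where uv: "(u, v) \<in> ?S" "m = u + v" by auto
  have le: "a + b \<le> u + v" if "(a, b) \<in> ?S" for a b
    unfolding uv(2)[symmetric] m_def using f(1) that by (intro Max_ge) force+
  have "young_diagram (E - {(u, v)})"
    unfolding young_diagram_def
  proof (intro conjI allI impI)
    show "finite (E - {(u, v)})" using assms young_finite by auto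
    fix a b a' b' assume h: "(a, b) \<in> E - {(u, v)}" "a' \<le> a" "b' \<le> b"
    have "(a', b') \<in> E" using h young_down[OF assms(1), of a b a' b'] by auto
    moreover have "(a', b') \<noteq> (u, v)" using h le[of a b] uv(1) by auto
    ultimately show "(a', b') \<in> E - {(u, v)}" by simp
  qed
  then show ?thesis using that uv(1) by auto
qed

text \<open>Two removable corners enclose the box \<open>(i, j')\<close>. Once both are removed, a
  corner south-east of that box stays above the lower and to the left of the upper one, so its
  content lies strictly between theirs. It supplies the middle letter of a Knuth move.\<close>

lemma removable_box_between:
  assumes "young_diagram K" "young_diagram (K - {(i, j)})" "young_diagram (K - {(i', j')})"
    "(i, j) \<in> K" "(i', j') \<in> K" "i < i'"
  obtains u v where "(u, v) \<in> K - {(i, j), (i', j')}" "young_diagram (K - {(i, j), (i', j')} - {(u, v)})"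
    "int j' - int i' < int v - int u" "int v - int u < int j - int i"
proof -
  have j: "j' < j" using young_down[OF assms(2), of i' j' i j] assms(5,6) by (cases "j \<le> j'") auto
  have "K - {(i, j), (i', j')} = (K - {(i, j)}) \<inter> (K - {(i', j')})" by blast
  then have y: "young_diagram (K - {(i, j), (i', j')})"
    using assms(2,3) unfolding young_diagram_def by (metis IntE IntI finite_Int)
  have "(i, j') \<in> K - {(i, j), (i', j')}" using young_down[OF assms(1,4), of i j'] j assms(6) by auto
  from removable_box_above[OF y this] obtain u v where
    uv: "(u, v) \<in> K - {(i, j), (i', j')}" "i \<le> u" "j' \<le> v" "young_diagram (K - {(i, j), (i', j')} - {(u, v)})" .
  have "v < j" using young_down[OF assms(2), of u v i j] uv(1,2) by (cases "j \<le> v") auto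
  moreover have "u < i'" using young_down[OF assms(3), of u v i' j'] uv(1,3) by (cases "i' \<le> u") auto
  ultimately show ?thesis using that[of u v] uv by auto
qed

lemma add_box_remove:
  assumes "young_diagram E" "young_diagram (E - {(i, j)})" "(i, j) \<in> E"
  shows "add_box (E - {(i, j)}) (int j - int i) E"
  using assms unfolding add_box_def by (intro conjI exI[of _ i] exI[of _ j]) auto

lemma path_exists:
  assumes "young_diagram D" "young_diagram E" "D \<subseteq> E"
  shows "\<exists>w. path D w E"
  using assms(2,3)
proof (induction "card (E - D)" arbitrary: E)
  case 0
  then have "E = D" using young_finite by auto
  then show ?case using assms(1) by (intro exI[of _ "[]"]) simp
next
  case (Suc n)
  have "E - D \<noteq> {}" using Suc(2) by (metis card.empty nat.distinct(1))
  then obtain i j where ij: "(i, j) \<in> E" "(i, j) \<notin> D" by auto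
  obtain u v where uv: "(u, v) \<in> E" "i \<le> u" "j \<le> v" "young_diagram (E - {(u, v)})"
    using removable_box_above[OF Suc(3) ij(1)] .
  have nD: "(u, v) \<notin> D" using young_down[OF assms(1), of u v i j] ij(2) uv by auto
  have "card (E - D) = Suc (card (E - {(u, v)} - D))"
    using nD uv(1) young_finite[OF Suc(3)]
    by (metis Diff_iff Diff_insert Diff_insert2 card.remove finite_Diff)
  then obtain w where "path D w (E - {(u, v)})" using Suc(1)[of "E - {(u, v)}"] Suc(2,4) uv(4) nD by auto
  moreover have "path (E - {(u, v)}) [int v - int u] E"
    using add_box_remove[OF Suc(3) uv(4,1)] by (simp only: path_single)
  ultimately show ?case unfolding path_append[symmetric] by (metis path_append)
qed

text \<open>Induction on the length. If the last contents \<open>p\<close> and \<open>q\<close>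
  differ, the chains end with two different corners of \<open>K\<close>. Removing both leaves a
  corner of intermediate content \<open>?x\<close>, and a chain ending in \<open>?x, q, p\<close> is
  one Knuth move away from one ending in \<open>?x, p, q\<close>. The induction hypothesis connects
  these two chains with \<open>v\<close> and \<open>w\<close>.\<close>

theorem straight_paths_knuth_equivalent:
  "path {} v K \<Longrightarrow> path {} w K \<Longrightarrow> knuth\<^sup>*\<^sup>* v w"
proof (induction "length v" arbitrary: v w K)
  case 0
  then have "length w = 0" using path_card by (metis add_0_right add_left_cancel)
  then show ?case using 0 by simp
next
  case (Suc n)
  have "length w = Suc n" using path_card[OF Suc(3)] path_card[OF Suc(4)] Suc(2) by simp
  then obtain w0 q where w: "w = w0 @ [q]" by (cases w rule: rev_cases) auto
  obtain v0 p where v: "v = v0 @ [p]" using Suc(2) by (cases v rule: rev_cases) auto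
  have l: "length v0 = n" "length w0 = n" using v w Suc(2) \<open>length w = Suc n\<close> by auto
  obtain V where V: "path {} v0 V" "add_box V p K"
    using Suc(3)[unfolded v path_append path_single] by blast
  obtain W where W: "path {} w0 W" "add_box W q K"
    using Suc(4)[unfolded w path_append path_single] by blast
  show ?case
  proof (cases "p = q")
    case True
    then have "V = W" using V W add_box_det_rev by blast
    then show ?thesis using True Suc(1) l V(1) W(1) v w knuth_star_append by blast
  next
    case False
    obtain i j where ij: "(i, j) \<notin> V" "K = insert (i, j) V" "int j - int i = p"
      using V(2) by (auto simp: add_box_def)
    obtain i' j' where ij': "(i', j') \<notin> W" "K = insert (i', j') W" "int j' - int i' = q"
      using W(2) by (auto simp: add_box_def)
    have VW: "V = K - {(i, j)}" "W = K - {(i', j')}" using ij(1,2) ij'(1,2) by blast+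
    have y: "young_diagram K" "young_diagram (K - {(i, j)})" "young_diagram (K - {(i', j')})"
      using V(2) W(2) VW add_box_young by metis+
    have m: "(i, j) \<in> K" "(i', j') \<in> K" using ij(2) ij'(2) by blast+
    have ne: "(i, j) \<noteq> (i', j')" using False ij(3) ij'(3) by auto
    let ?L = "K - {(i, j), (i', j')}"
    have L: "?L = V \<inter> W" "?L = V - {(i', j')}" "?L = W - {(i, j)}" using VW by blast+
    then have yL: "young_diagram ?L" using y VW unfolding young_diagram_def by (metis IntE IntI finite_Int)
    have "\<exists>u x. (u, x) \<in> ?L \<and> young_diagram (?L - {(u, x)}) \<and>
      (q < int x - int u \<and> int x - int u < p \<or> p < int x - int u \<and> int x - int u < q)"
    proof (cases i i' rule: linorder_cases)
      case less
      from removable_box_between[OF y m less] show ?thesis using ij(3) ij'(3) by metis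
    next
      case greater
      have "K - {(i', j'), (i, j)} = ?L" by blast
      with removable_box_between[OF y(1,3,2) m(2,1) greater] show ?thesis
        using ij(3) ij'(3) by metis
    next
      case equal
      then have "j \<noteq> j'" using ne by auto
      then show ?thesis using young_down[OF y(2), of i' j' i j] young_down[OF y(3), of i j i' j'] m equal
        by (cases "j < j'") auto
    qed
    then obtain u x where ux: "(u, x) \<in> ?L" "young_diagram (?L - {(u, x)})"
      "q < int x - int u \<and> int x - int u < p \<or> p < int x - int u \<and> int x - int u < q" by blast
    let ?x = "int x - int u"
    obtain z where z: "path {} z (?L - {(u, x)})" using path_exists[OF young_empty ux(2)] by auto
    have zx: "path {} (z @ [?x]) ?L"
      using z add_box_remove[OF yL ux(2,1)] unfolding path_append path_single by blast
    have "add_box ?L q V" 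
      using add_box_remove[of V i' j'] yL[unfolded L(2)] V(2) add_box_young VW(1) m(2) ne
      unfolding L(2) ij'(3) by blast
    then have 1: "path {} ((z @ [?x]) @ [q]) V" using zx unfolding path_append path_single by blast
    have "add_box ?L p W" 
      using add_box_remove[of W i j] yL[unfolded L(3)] W(2) add_box_young VW(2) m(1) ne
      unfolding L(3) ij(3) by blast
    then have 2: "path {} ((z @ [?x]) @ [p]) W" using zx unfolding path_append path_single by blast
    have "knuth3 [?x, q, p] [?x, p, q]" using ux(3) unfolding knuth3_def by auto
    then have "knuth (z @ [?x, q, p] @ []) (z @ [?x, p, q] @ [])" unfolding knuth_def by blast
    moreover have "knuth\<^sup>*\<^sup>* v (((z @ [?x]) @ [q]) @ [p])"
      unfolding v by (rule knuth_star_append, rule Suc(1)[OF _ V(1) 1]) (simp add: l)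
    moreover have "knuth\<^sup>*\<^sup>* (((z @ [?x]) @ [p]) @ [q]) w"
      unfolding w by (rule knuth_star_append, rule knuth_star_sym, rule Suc(1)[OF _ W(1) 2]) (simp add: l)
    ultimately show ?thesis by simp
  qed
qed

theorem switch_straight_indep:
  assumes "path {} A S" "path {} A2 S" "path S B E" "switch A B = (B', A')"
  obtains A2' where "switch A2 B = (B', A2')" "knuth\<^sup>*\<^sup>* A' A2'"
  using switch_knuth_star[OF straight_paths_knuth_equivalent[OF assms(1,2)] _ assms(4)] assms(1,3)
  unfolding path_append by blast

section \<open>Rectification\<close>

definition subdiagrams :: "diagram \<Rightarrow> diagram set" where
  "subdiagrams E = {M. young_diagram M \<and> M \<subseteq> E}"

lemma finite_subdiagrams: "finite E \<Longrightarrow> finite (subdiagrams E)"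
  unfolding subdiagrams_def by (rule finite_subset[of _ "Pow E"]) auto

definition paths :: "diagram \<Rightarrow> diagram \<Rightarrow> int list set" where
  "paths D E = {w. path D w E}"

lemma path_set: "path D w E \<Longrightarrow> set w = (\<lambda>(i, j). int j - int i) ` (E - D)"
proof (induction w arbitrary: D)
  case (Cons c w)
  then obtain M where M: "add_box D c M" "path M w E" by auto
  then obtain i j where ij: "(i, j) \<notin> D" "M = insert (i, j) D" "int j - int i = c"
    by (auto simp: add_box_def)
  have "E - D = insert (i, j) (E - M)" using ij path_subset[OF M(2)] by auto
  then show ?case using Cons.IH[OF M(2)] ij(3) by auto
qed auto

lemma finite_paths: "finite (paths D E)"
proof (cases "young_diagram E")
  case True
  have "paths D E \<subseteq> {w. set w \<subseteq> (\<lambda>(i, j). int j - int i) ` E \<and> length w = card E - card D}"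
    unfolding paths_def using path_set path_card by (fastforce)
  then show ?thesis using finite_lists_length_eq[of "(\<lambda>(i, j). int j - int i) ` E"] young_finite[OF True]
    by (meson finite_imageI finite_subset)
next
  case False
  then have "paths D E = {}" unfolding paths_def using path_young by auto
  then show ?thesis by simp
qed

lemma paths_mid_subdiagrams: "path D u M \<Longrightarrow> path M v E \<Longrightarrow> M \<in> subdiagrams E"
  unfolding subdiagrams_def using path_subset path_young by auto

definition std_word :: "diagram \<Rightarrow> int list" where
  "std_word D = (SOME w. path {} w D)"

lemma path_std_word: "young_diagram D \<Longrightarrow> path {} (std_word D) D"
  unfolding std_word_def using path_exists[OF young_empty] by (metis empty_subsetI someI_ex)

definition rect :: "diagram \<Rightarrow> int list \<Rightarrow> int list" where
  "rect D S = fst (switch (std_word D) S)"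

lemma rect_eq:
  assumes "path {} A D" "path D S E"
  shows "fst (switch A S) = rect D S"
proof -
  have "path {} (std_word D) D" using assms(1) path_young path_std_word by blast
  moreover obtain B' A' where "switch A S = (B', A')" by fastforce
  ultimately show ?thesis using switch_straight_indep[OF assms(1) _ assms(2)]
    unfolding rect_def by (metis fst_conv)
qed

text \<open>
  \<open>std_word\<close> is an arbitrary choice; by \<open>rect_eq\<close> and \<open>lr_eq_card\<close> below, \<open>rect\<close> and \<open>lr\<close> do not depend on it.
\<close>

definition lr :: "diagram \<Rightarrow> diagram \<Rightarrow> diagram \<Rightarrow> nat" where
  "lr la mu nu = card {S \<in> paths la nu. rect la S = std_word mu}"

lemma lr_switch_symmetric:
  assumes "path {} A la" "path {} T mu"
  shows "card {S \<in> paths la nu. fst (switch A S) = T} = card {V \<in> paths mu nu. fst (switch T V) = A}"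
proof -
  have *: "snd (switch A S) \<in> {V \<in> paths mu nu. fst (switch T V) = A} \<and> snd (switch T (snd (switch A S))) = S"
    if h: "path {} A la" "path {} T mu" "S \<in> {S \<in> paths la nu. fst (switch A S) = T}" for A T la mu S
  proof -
    obtain V where V: "switch A S = (T, V)" using h(3) by (cases "switch A S") auto
    have "path {} (A @ S) nu" using h unfolding paths_def path_append by auto
    then have "path {} (T @ V) nu" using path_switch[OF V] by blast
    then have "path mu V nu" unfolding path_append using h(2) path_det by blast
    then show ?thesis using V switch_switch[OF V] unfolding paths_def by auto
  qed
  have "bij_betw (\<lambda>S. snd (switch A S)) {S \<in> paths la nu. fst (switch A S) = T}
      {V \<in> paths mu nu. fst (switch T V) = A}"
    by (rule bij_betw_byWitness[where f' = "\<lambda>V. snd (switch T V)"])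
      (use *[OF assms] *[OF assms(2,1)] in blast)+
  then show ?thesis by (rule bij_betw_same_card)
qed

text \<open>\<open>rect_eq\<close> gives independence of \<open>A\<close> only. Independence of
  \<open>T\<close> follows because \<open>lr_switch_symmetric\<close> moves \<open>T\<close> into
  the role of \<open>A\<close> and back.\<close>

lemma lr_eq_card:
  assumes "path {} A la" "path {} T mu"
  shows "card {S \<in> paths la nu. fst (switch A S) = T} = lr la mu nu"
proof -
  have T': "path {} (std_word mu) mu" using assms(2) path_young path_std_word by blast
  have 1: "{S \<in> paths la nu. fst (switch A S) = X} = {S \<in> paths la nu. rect la S = X}"
    if "path {} A la" for la X A
    unfolding paths_def using rect_eq[OF that] by auto
  have "card {S \<in> paths la nu. fst (switch A S) = T} = card {V \<in> paths mu nu. fst (switch T V) = A}"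
    using lr_switch_symmetric[OF assms] .
  also have "\<dots> = card {V \<in> paths mu nu. fst (switch (std_word mu) V) = A}"
    unfolding 1[OF assms(2)] 1[OF T'] ..
  also have "\<dots> = card {S \<in> paths la nu. fst (switch A S) = std_word mu}"
    using lr_switch_symmetric[OF assms(1) T'] by simp
  also have "\<dots> = lr la mu nu" unfolding 1[OF assms(1)] lr_def ..
  finally show ?thesis .
qed

lemma lr_eq_card_rect:
  assumes "young_diagram la" "path {} T mu"
  shows "card {S \<in> paths la nu. rect la S = T} = lr la mu nu"
  using lr_eq_card[OF path_std_word[OF assms(1)] assms(2)] unfolding rect_def .

lemma lr_commute:
  assumes "young_diagram la" "young_diagram mu"
  shows "lr la mu nu = lr mu la nu"
  using lr_switch_symmetric[OF path_std_word[OF assms(1)] path_std_word[OF assms(2)]]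
    lr_eq_card[OF path_std_word[OF assms(1)] path_std_word[OF assms(2)]]
    lr_eq_card[OF path_std_word[OF assms(2)] path_std_word[OF assms(1)]] by simp

lemma switch_straight:
  assumes "path {} A D" "path D S E" "switch A S = (T, V)"
  obtains mu where "path {} T mu" "path mu V E" "mu \<in> subdiagrams E" "T = rect D S"
proof -
  have "path {} (A @ S) E" using assms unfolding path_append by blast
  from path_switch[OF assms(3) this] obtain mu where "path {} T mu" "path mu V E"
    unfolding path_append by blast
  then show ?thesis using that paths_mid_subdiagrams rect_eq[OF assms(1,2)] assms(3) by auto
qed

lemma path_rect:
  assumes "path D S E"
  obtains mu where "path {} (rect D S) mu" "mu \<in> subdiagrams E" "card E = card D + card mu"
    "ascents (rect D S) = ascents S" "length (rect D S) = length S"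
proof -
  have std: "path {} (std_word D) D" using assms path_young path_std_word by blast
  obtain T V where TV: "switch (std_word D) S = (T, V)" by fastforce
  from switch_straight[OF std assms TV] obtain mu where mu: "path {} T mu" "mu \<in> subdiagrams E" by blast
  have T: "T = rect D S" using TV unfolding rect_def by simp
  have "path {} (std_word D @ S) E" using std assms unfolding path_append by blast
  then have "ascents T = ascents S" using ascents_switch TV by blast
  moreover have "length T = length S" using switch_length[OF TV] by simp
  ultimately show ?thesis using that[of mu] mu path_card[OF mu(1)] path_card[OF assms] T by simp
qed

lemma lr_eq_0_card: "lr la mu nu \<noteq> 0 \<Longrightarrow> young_diagram mu \<Longrightarrow> card nu = card la + card mu \<and> young_diagram la \<and> young_diagram nu"
proof -
  assume "lr la mu nu \<noteq> 0" "young_diagram mu"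
  then obtain S where S: "path la S nu" "rect la S = std_word mu"
    unfolding lr_def paths_def by (metis (mono_tags, lifting) card.empty empty_Collect_eq mem_Collect_eq)
  from path_rect[OF S(1)] obtain mu' where "path {} (std_word mu) mu'" "card nu = card la + card mu'" using S(2) by metis
  then show ?thesis using path_det path_std_word[OF \<open>young_diagram mu\<close>] path_young[OF S(1)] by blast
qed


section \<open>Words with prescribed ascents\<close>

text \<open>Standardising a semistandard tableau of weight \<open>al\<close> adds boxes with equal
  entries from left to right, so its content word increases on blocks of these lengths. Empty blocks
  stand for entries that do not occur.\<close>

fun increasing_blocks :: "nat list \<Rightarrow> int list \<Rightarrow> bool" where
  "increasing_blocks [] w \<longleftrightarrow> w = []"
| "increasing_blocks (n # al) w \<longleftrightarrow>
     (\<exists>u v. w = u @ v \<and> length u = n \<and> sorted_wrt (<) u \<and> increasing_blocks al v)"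

lemma length_increasing_blocks: "increasing_blocks al w \<Longrightarrow> length w = sum_list al"
  by (induction al arbitrary: w) auto

lemma increasing_blocks_append:
  "increasing_blocks (al @ be) w \<longleftrightarrow>
    (\<exists>u v. w = u @ v \<and> increasing_blocks al u \<and> increasing_blocks be v)"
proof (induction al arbitrary: w)
  case (Cons n al)
  show ?case
  proof
    assume "increasing_blocks ((n # al) @ be) w"
    then obtain u x y where "w = u @ x @ y" "length u = n" "sorted_wrt (<) u" "increasing_blocks al x" "increasing_blocks be y"
      using Cons by auto
    then show "\<exists>u v. w = u @ v \<and> increasing_blocks (n # al) u \<and> increasing_blocks be v"
      by (intro exI[of _ "u @ x"] exI[of _ y]) auto
  next
    assume "\<exists>u v. w = u @ v \<and> increasing_blocks (n # al) u \<and> increasing_blocks be v"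
    then show "increasing_blocks ((n # al) @ be) w" using Cons by fastforce
  qed
qed auto

lemma length_ascents [simp]: "length (ascents w) = length w - 1"
  by (induction w rule: ascents.induct) auto

lemma ascents_append:
  "ascents u = take (length u - 1) (ascents (u @ v)) \<and> ascents v = drop (length u) (ascents (u @ v))"
proof (induction u rule: ascents.induct)
  case ("2_2" a)
  then show ?case by (cases v) auto
qed auto

lemma sorted_wrt_ascents: "sorted_wrt (<) w \<longleftrightarrow> False \<notin> set (ascents w)"
  by (induction w rule: ascents.induct) (auto dest: order.strict_trans)

lemma increasing_blocks_ascents:
  "increasing_blocks al w \<Longrightarrow> ascents w = ascents w' \<Longrightarrow> length w = length w' \<Longrightarrow> increasing_blocks al w'"
proof (induction al arbitrary: w w')
  case (Cons n al)
  then obtain u v where uv: "w = u @ v" "length u = n" "sorted_wrt (<) u" "increasing_blocks al v" by auto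
  define u' v' where "u' = take n w'" "v' = drop n w'"
  then have w': "w' = u' @ v'" "length u' = n" "length v' = length v" using uv Cons.prems(3) by auto
  then have "ascents u' = ascents u" "ascents v' = ascents v"
    using ascents_append[of u v] ascents_append[of u' v'] uv(1,2) Cons.prems(2) by auto
  then have "sorted_wrt (<) u'" "increasing_blocks al v'"
    using uv(3) Cons.IH[OF uv(4)] w'(3) by (simp_all add: sorted_wrt_ascents)
  then show ?case using w' by auto
qed auto

abbreviation block_words :: "diagram \<Rightarrow> diagram \<Rightarrow> nat list \<Rightarrow> int list set" where
  "block_words D E al \<equiv> {w \<in> paths D E. increasing_blocks al w}"

text \<open>The Kostka number of the skew shape \<open>E - D\<close> for the weight
  \<open>al\<close>.\<close>

definition block_count :: "diagram \<Rightarrow> diagram \<Rightarrow> nat list \<Rightarrow> nat" where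
  "block_count D E al = card (block_words D E al)"

lemma block_count_append:
  "block_count D E (al @ be) = (\<Sum>M \<in> subdiagrams E. block_count D M al * block_count M E be)"
proof (cases "young_diagram E")
  case True
  let ?X = "SIGMA M : subdiagrams E. block_words D M al \<times> block_words M E be"
  have "block_words D E (al @ be) = (\<lambda>(M, u, v). u @ v) ` ?X" (is "?L = ?R")
  proof
    show "?L \<subseteq> ?R"
    proof
      fix w assume "w \<in> ?L"
      then obtain u v M where "w = u @ v" "increasing_blocks al u" "increasing_blocks be v" "path D u M" "path M v E"
        unfolding paths_def increasing_blocks_append by (auto simp: path_append)
      moreover from this have "M \<in> subdiagrams E" using paths_mid_subdiagrams by blast
      ultimately show "w \<in> ?R" by (intro image_eqI[of _ _ "(M, u, v)"]) (auto simp: paths_def)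
    qed
    show "?R \<subseteq> ?L" unfolding paths_def increasing_blocks_append by (auto simp: path_append)
  qed
  moreover have "inj_on (\<lambda>(M, u, v). u @ v) ?X"
  proof (rule inj_onI)
    fix x y assume h: "x \<in> ?X" "y \<in> ?X" "(\<lambda>(M, u, v). u @ v) x = (\<lambda>(M, u, v). u @ v) y"
    obtain M u v M' u' v' where xy: "x = (M, u, v)" "y = (M', u', v')" by (cases x; cases y)
    then have *: "u @ v = u' @ v'" "increasing_blocks al u" "increasing_blocks al u'" "u \<in> paths D M" "u' \<in> paths D M'"
      using h by auto
    then have "u = u' \<and> v = v'" using length_increasing_blocks by (metis append_eq_append_conv)
    then show "x = y" using *(4,5) path_det xy unfolding paths_def by blast
  qed
  ultimately have "block_count D E (al @ be) = card ?X" unfolding block_count_def by (simp add: card_image)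
  also have "\<dots> = (\<Sum>M \<in> subdiagrams E. block_count D M al * block_count M E be)"
    using finite_subdiagrams[OF young_finite[OF True]] finite_paths
    by (subst card_SigmaI) (auto simp: card_cartesian_product block_count_def)
  finally show ?thesis .
next
  case False
  then have "paths M E = {}" for M unfolding paths_def using path_young by auto
  then show ?thesis unfolding block_count_def by simp
qed

text \<open>A form of the symmetry of skew Schur functions: switching the two parts of a word keeps
  the ascents of each part and hence its blocks. What is needed later is
  \<open>block_count_rev\<close>, since rotation reverses the weight.\<close>

lemma block_count_commute: "block_count D E (al @ be) = block_count D E (be @ al)"
proof -
  define f where "f al w = (let (B, A) = switch (take (sum_list al) w) (drop (sum_list al) w) in B @ A)" for al :: "nat list" and w
  have *: "f al w \<in> block_words D E (be @ al) \<and> f be (f al w) = w"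
    if w: "w \<in> block_words D E (al @ be)" for w al be
  proof -
    obtain u v where uv: "w = u @ v" "increasing_blocks al u" "increasing_blocks be v" "path D (u @ v) E"
      using w unfolding paths_def increasing_blocks_append by auto
    obtain v' u' where s: "switch u v = (v', u')" by fastforce
    have l: "length u = sum_list al" "length v' = sum_list be" "length u' = length u" "length v' = length v"
      using uv length_increasing_blocks switch_length[OF s] by auto
    have "f al w = v' @ u'" unfolding f_def using uv(1) l s by simp
    moreover have "f be (v' @ u') = u @ v" unfolding f_def using l switch_switch[OF s] by simp
    moreover have "path D (v' @ u') E" using path_switch[OF s uv(4)] .
    moreover have "increasing_blocks be v'" "increasing_blocks al u'"
      using increasing_blocks_ascents uv(2,3) l ascents_switch[OF uv(4) s] by metis+
    ultimately show ?thesis using uv(1) unfolding paths_def increasing_blocks_append by auto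
  qed
  have "bij_betw (f al) (block_words D E (al @ be)) (block_words D E (be @ al))"
    by (rule bij_betw_byWitness[where f' = "f be"]) (use *[of _ al be] *[of _ be al] in blast)+
  then show ?thesis unfolding block_count_def by (rule bij_betw_same_card)
qed

lemma block_count_rev: "block_count D E (rev al) = block_count D E al"
proof (induction al arbitrary: D)
  case (Cons n al)
  have "block_count D E (rev (n # al)) = block_count D E ([n] @ rev al)"
    by (simp add: block_count_commute[of D E "rev al"])
  also have "\<dots> = block_count D E ([n] @ al)"
    unfolding block_count_append[of D E "[n]"] Cons ..
  finally show ?case by simp
qed simp

text \<open>The expansion of a skew Schur function in Schur functions. Words are grouped by their
  rectification, which keeps the blocks, and each fibre over a chain of \<open>mu\<close> has
  \<open>lr D mu E\<close> elements.\<close>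

lemma block_count_rect:
  assumes "young_diagram D"
  shows "block_count D E al = (\<Sum>mu \<in> subdiagrams E. lr D mu E * block_count {} mu al)"
proof (cases "young_diagram E")
  case True
  let ?I = "SIGMA mu : subdiagrams E. block_words {} mu al"
  let ?F = "\<lambda>(mu, T). {S \<in> paths D E. rect D S = T}"
  have fin: "finite ?I" using finite_subdiagrams[OF young_finite[OF True]] finite_paths by auto
  have "block_words D E al = (\<Union>x \<in> ?I. ?F x)" (is "?L = ?R")
  proof
    show "?L \<subseteq> ?R"
    proof
      fix S assume S: "S \<in> ?L"
      then obtain mu where "path {} (rect D S) mu" "mu \<in> subdiagrams E"
        "ascents (rect D S) = ascents S" "length (rect D S) = length S"
        using path_rect[of D S E] unfolding paths_def by blast
      then have "(mu, rect D S) \<in> ?I" using S increasing_blocks_ascents[of al S "rect D S"] unfolding paths_def by auto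
      then show "S \<in> ?R" using S by blast
    qed
    show "?R \<subseteq> ?L"
    proof
      fix S assume "S \<in> ?R"
      then obtain mu where "path D S E" "increasing_blocks al (rect D S)" unfolding paths_def by auto
      then show "S \<in> ?L" using path_rect[of D S E] increasing_blocks_ascents[of al "rect D S" S] unfolding paths_def
        by (metis (mono_tags, lifting) mem_Collect_eq)
    qed
  qed
  then have "block_count D E al = card (\<Union>x \<in> ?I. ?F x)" unfolding block_count_def by simp
  also have "\<dots> = (\<Sum>x \<in> ?I. card (?F x))"
  proof (rule card_UN_disjoint[OF fin])
    show "\<forall>x\<in>?I. finite (?F x)" using finite_paths by auto
    show "\<forall>x\<in>?I. \<forall>y\<in>?I. x \<noteq> y \<longrightarrow> ?F x \<inter> ?F y = {}"
    proof (intro ballI impI)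
      fix x y assume h: "x \<in> ?I" "y \<in> ?I" "x \<noteq> y"
      obtain m T m' T' where xy: "x = (m, T)" "y = (m', T')" by (cases x; cases y)
      then have "path {} T m" "path {} T' m'" using h unfolding paths_def by auto
      then have "T \<noteq> T'" using h(3) xy path_det by blast
      then show "?F x \<inter> ?F y = {}" unfolding xy by auto
    qed
  qed
  also have "\<dots> = (\<Sum>x \<in> ?I. lr D (fst x) E)"
  proof (rule sum.cong)
    fix x assume "x \<in> ?I"
    then have "path {} (snd x) (fst x)" unfolding paths_def by auto
    then show "card (?F x) = lr D (fst x) E"
      using lr_eq_card_rect[OF assms] by (simp add: case_prod_beta)
  qed simp
  also have "\<dots> = (\<Sum>mu \<in> subdiagrams E. \<Sum>T \<in> block_words {} mu al. lr D mu E)"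
    using finite_subdiagrams[OF young_finite[OF True]] finite_paths by (subst sum.Sigma) (auto intro!: sum.cong)
  also have "\<dots> = (\<Sum>mu \<in> subdiagrams E. lr D mu E * block_count {} mu al)"
    unfolding block_count_def by (simp add: mult.commute)
  finally show ?thesis .
next
  case False
  then have "paths M E = {}" for M unfolding paths_def using path_young by auto
  then show ?thesis unfolding block_count_def lr_def by simp
qed

section \<open>Horizontal strips and Schur functions\<close>

definition hstrip :: "diagram \<Rightarrow> diagram \<Rightarrow> nat \<Rightarrow> bool" where
  "hstrip D E n \<longleftrightarrow> young_diagram D \<and> young_diagram E \<and> D \<subseteq> E \<and> card E = card D + n \<and>
     (\<forall>i j. (Suc i, j) \<in> E \<longrightarrow> (i, j) \<in> D)"

text \<open>If \<open>(i, j)\<close> were itself a new box, the box below it would be added later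
  with a content smaller by 1.\<close>

lemma increasing_path_column:
  "path D w E \<Longrightarrow> sorted_wrt (<) w \<Longrightarrow> (Suc i, j) \<in> E \<Longrightarrow> (i, j) \<in> D"
proof (induction w arbitrary: D)
  case Nil
  then show ?case using young_down[of D "Suc i" j i j] by auto
next
  case (Cons c w)
  then obtain M where M: "add_box D c M" "path M w E" by auto
  then obtain a b where ab: "(a, b) \<notin> D" "M = insert (a, b) D" "int b - int a = c"
    by (auto simp: add_box_def)
  have "(i, j) \<in> M" using Cons M by auto
  moreover have "(i, j) \<noteq> (a, b)"
  proof
    assume e: "(i, j) = (a, b)"
    then have "(Suc i, j) \<notin> M" using ab M(1) young_down[of D "Suc i" j i j] by (auto simp: add_box_def)
    then have "int j - int (Suc i) \<in> set w" using path_content_mem[OF M(2) Cons.prems(3)] by blast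
    then show False using Cons.prems(2) e ab(3) by auto
  qed
  ultimately show ?case using ab(2) by auto
qed

text \<open>The box of largest content in \<open>E - D\<close> is removable and can be added last.
  No other new box shares its diagonal, because the upper of two boxes of \<open>E\<close> on one
  diagonal has a box of \<open>E\<close> below it and so lies in \<open>D\<close>.\<close>

lemma hstrip_increasing_path:
  "hstrip D E n \<Longrightarrow> \<exists>w. path D w E \<and> length w = n \<and> sorted_wrt (<) w"
proof (induction n arbitrary: E)
  case 0
  then have "D = E" using young_finite card_subset_eq unfolding hstrip_def by (metis add_0_right)
  then show ?case using 0 unfolding hstrip_def by (intro exI[of _ "[]"]) auto
next
  case (Suc n)
  let ?c = "\<lambda>(i, j). int j - int i"
  have y: "young_diagram D" "young_diagram E" "D \<subseteq> E" "card E = card D + Suc n"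
    and col: "\<And>i j. (Suc i, j) \<in> E \<Longrightarrow> (i, j) \<in> D"
    using Suc(2) unfolding hstrip_def by auto
  have fin: "finite E" using y young_finite by auto
  have ne: "E - D \<noteq> {}" using y by (metis Diff_eq_empty_iff add_cancel_left_right nat.distinct(1) subset_antisym)
  define m where "m = Max (?c ` (E - D))"
  have "m \<in> ?c ` (E - D)" unfolding m_def using fin ne by (intro Max_in) auto
  then obtain i j where ij: "(i, j) \<in> E" "(i, j) \<notin> D" "m = int j - int i" by auto
  have max: "int b - int a \<le> int j - int i" if "(a, b) \<in> E - D" for a b
    unfolding ij(3)[symmetric] m_def using fin that by (intro Max_ge) force+
  have no1: "(Suc i, j) \<notin> E" using col ij(2) by auto
  have no2: "(i, Suc j) \<notin> E"
  proof
    assume "(i, Suc j) \<in> E"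
    moreover have "(i, Suc j) \<notin> D" using ij(2) young_down[OF y(1), of i "Suc j" i j] by auto
    ultimately show False using max[of i "Suc j"] by auto
  qed
  have yE: "young_diagram (E - {(i, j)})"
    unfolding young_diagram_def
  proof (intro conjI allI impI)
    show "finite (E - {(i, j)})" using fin by simp
    fix a b a' b' assume h: "(a, b) \<in> E - {(i, j)}" "a' \<le> a" "b' \<le> b"
    have "(a', b') \<noteq> (i, j)"
    proof
      assume e: "(a', b') = (i, j)"
      then have "Suc i \<le> a \<and> j \<le> b \<or> i \<le> a \<and> Suc j \<le> b" using h by auto
      then show False using no1 no2 h(1) young_down[OF y(2), of a b] by blast
    qed
    then show "(a', b') \<in> E - {(i, j)}" using h young_down[OF y(2), of a b a' b'] by auto
  qed
  have "card (E - {(i, j)}) = card D + n" using y(4) ij(1) fin by simp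
  then have "hstrip D (E - {(i, j)}) n" using y yE col ij(2) unfolding hstrip_def by auto
  then obtain w where w: "path D w (E - {(i, j)})" "length w = n" "sorted_wrt (<) w" using Suc.IH by blast
  have "x < int j - int i" if x: "x \<in> set w" for x
  proof -
    obtain a b where ab: "(a, b) \<in> E - {(i, j)} - D" "x = int b - int a"
      using x path_set[OF w(1)] by auto
    have "(a, b) = (i, j)" if e: "int b - int a = int j - int i"
    proof (cases a i rule: linorder_cases)
      case less
      then have "b < j" using e by auto
      then have "(Suc a, b) \<in> E" using less young_down[OF y(2) ij(1), of "Suc a" b] by auto
      then show ?thesis using col ab by auto
    next
      case greater
      then have "j < b" using e by auto
      then have "(Suc i, j) \<in> E" using greater young_down[OF y(2), of a b "Suc i" j] ab by auto
      then show ?thesis using no1 by auto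
    qed (use e in auto)
    then show ?thesis using ab max[of a b] by fastforce
  qed
  then have "sorted_wrt (<) (w @ [int j - int i])" using w(3) by (auto simp: sorted_wrt_append)
  moreover have "path D (w @ [int j - int i]) E"
    using w(1) add_box_remove[OF y(2) yE ij(1)] unfolding path_append path_single by blast
  ultimately show ?case using w(2) by (intro exI[of _ "w @ [int j - int i]"]) auto
qed

lemma hstrip_iff: "hstrip D E n \<longleftrightarrow> (\<exists>w. path D w E \<and> length w = n \<and> sorted_wrt (<) w)"
proof
  assume "\<exists>w. path D w E \<and> length w = n \<and> sorted_wrt (<) w"
  then obtain w where "path D w E" "length w = n" "sorted_wrt (<) w" by blast
  then show "hstrip D E n"
    using increasing_path_column[of D w E] path_young[of D w E] path_subset[of D w E] path_card[of D w E]
    unfolding hstrip_def by blast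
qed (rule hstrip_increasing_path)

lemma increasing_path_unique:
  "path D w E \<Longrightarrow> path D w' E \<Longrightarrow> sorted_wrt (<) w \<Longrightarrow> sorted_wrt (<) w' \<Longrightarrow> w = w'"
  using path_set by (metis strict_sorted_equal)

lemma block_count_single: "block_count D E [n] = (if hstrip D E n then 1 else 0)"
proof -
  have *: "block_words D E [n] = {w. path D w E \<and> length w = n \<and> sorted_wrt (<) w}"
    unfolding paths_def by auto
  show ?thesis
  proof (cases "hstrip D E n")
    case True
    then obtain w where "path D w E \<and> length w = n \<and> sorted_wrt (<) w" unfolding hstrip_iff by blast
    then have "{w. path D w E \<and> length w = n \<and> sorted_wrt (<) w} = {w}" using increasing_path_unique by blast
    then show ?thesis using True unfolding block_count_def * by simp
  next
    case False
    then have "{w. path D w E \<and> length w = n \<and> sorted_wrt (<) w} = {}" unfolding hstrip_iff by blast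
    then show ?thesis using False unfolding block_count_def * by (metis card.empty)
  qed
qed

abbreviation inner_strips :: "diagram \<Rightarrow> nat \<Rightarrow> diagram set" where
  "inner_strips E n \<equiv> {K \<in> subdiagrams E. hstrip K E n}"

lemma block_count_snoc:
  "block_count D E (al @ [n]) = (\<Sum>M \<in> inner_strips E n. block_count D M al)"
proof (cases "young_diagram E")
  case True
  then show ?thesis
    using finite_subdiagrams[OF young_finite[OF True]]
    unfolding block_count_append block_count_single by (simp add: sum.If_cases if_distrib Int_def cong: if_cong)
next
  case False
  then have "inner_strips E n = {}" "paths D E = {}"
    unfolding hstrip_def paths_def using path_young by auto
  then show ?thesis unfolding block_count_def by (simp only: sum.empty) simp
qed

section \<open>Semistandard tableaux counted by weight\<close>

abbreviation tableaux_of_weight :: "diagram \<Rightarrow> nat multiset \<Rightarrow> (nat \<times> nat \<Rightarrow> nat) set" where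
  "tableaux_of_weight D M \<equiv> {T \<in> semistandard_tableaux D. image_mset T (mset_set D) = M}"

lemma semistandard_mono:
  assumes "T \<in> semistandard_tableaux D" "young_diagram D" "(i, j) \<in> D" "i' \<le> i" "j' \<le> j"
  shows "T (i', j') \<le> T (i, j)"
proof -
  have "(i', j) \<in> D" "(i', j') \<in> D" using young_down[OF assms(2,3)] assms(4,5) by auto
  then have "T (i', j') \<le> T (i', j)" "T (i', j) \<le> T (i, j)"
    using assms unfolding semistandard_tableaux_def by (auto simp: le_less)
  then show ?thesis by simp
qed

lemma count_image_mset_set: "finite A \<Longrightarrow> count (image_mset f (mset_set A)) b = card {a \<in> A. f a = b}"
proof -
  assume f: "finite A"
  have "count (image_mset f (mset_set A)) b = (\<Sum>x | x \<in> A \<and> b = f x. 1)"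
    unfolding count_image_mset' using f by (intro sum.cong) auto
  also have "{x. x \<in> A \<and> b = f x} = {a \<in> A. f a = b}" by auto
  finally show ?thesis by simp
qed

lemma tableaux_weight_le:
  "T \<in> tableaux_of_weight D M \<Longrightarrow> finite D \<Longrightarrow> p \<in> D \<Longrightarrow> T p \<in># M"
  by auto

lemma finite_tableaux_of_weight: "finite D \<Longrightarrow> finite (tableaux_of_weight D M)"
proof -
  assume "finite D"
  then have "tableaux_of_weight D M \<subseteq> D \<rightarrow>\<^sub>E set_mset M"
    by (auto simp: semistandard_tableaux_def PiE_def Pi_def)
  then show ?thesis by (rule finite_subset) (simp add: finite_PiE \<open>finite D\<close>)
qed

text \<open>Remove the boxes with the largest possible entry \<open>m\<close>; they form a horizontal strip.\<close>

lemma schur_step: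
  assumes "young_diagram D" "set_mset M \<subseteq> {..m}"
  shows "schur D M = (\<Sum>K \<in> inner_strips D (count M m). schur K (filter_mset (\<lambda>x. x < m) M))"
proof -
  let ?M = "filter_mset (\<lambda>x. x < m) M"
  let ?I = "inner_strips D (count M m)"
  let ?B = "SIGMA K : ?I. tableaux_of_weight K ?M"
  let ?f = "\<lambda>T. ({p \<in> D. T p < m}, restrict T {p \<in> D. T p < m})"
  \<comment> \<open>The inverse refills the removed strip with \<open>m\<close>; the value
    \<open>undefined\<close> outside \<open>D\<close> keeps the tableau extensional.\<close>
  let ?g = "\<lambda>(K, T) p. if p \<in> K then T p else if p \<in> D then m else undefined"
  have fD: "finite D" using assms young_finite by auto
  have M: "M = ?M + replicate_mset (count M m) m"
  proof (rule multiset_eqI)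
    fix x show "count M x = count (?M + replicate_mset (count M m) m) x"
      using assms(2) by (cases x m rule: linorder_cases) (auto simp: count_eq_zero_iff not_in_iff[symmetric])
  qed
  have 1: "?g (?f T) = T" if "T \<in> tableaux_of_weight D M" for T
  proof
    fix p show "?g (?f T) p = T p"
    proof (cases "p \<in> D")
      case True
      then have "T p \<le> m" using tableaux_weight_le[OF that fD] assms(2) by blast
      then show ?thesis using True by auto
    next
      case False
      then show ?thesis using that by (auto simp: semistandard_tableaux_def)
    qed
  qed
  have 2: "?f (?g x) = x" if x: "x \<in> ?B" for x
  proof -
    obtain K T where KT: "x = (K, T)" "K \<in> ?I" "T \<in> tableaux_of_weight K ?M" using x by (cases x) auto
    have K: "K \<subseteq> D" "finite K" using KT(2) fD unfolding subdiagrams_def by (auto intro: finite_subset)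
    have "T p < m" if "p \<in> K" for p using tableaux_weight_le[OF KT(3) K(2) that] by simp
    then have *: "{p \<in> D. ?g (K, T) p < m} = K" using K by auto
    have "restrict (?g (K, T)) K = T"
      using KT(3) by (auto simp: semistandard_tableaux_def fun_eq_iff restrict_def extensional_def PiE_def)
    then show ?thesis using * KT(1) by simp
  qed
  have 3: "?f T \<in> ?B" if T: "T \<in> tableaux_of_weight D M" for T
  proof -
    define K where "K = {p \<in> D. T p < m}"
    have ss: "T \<in> semistandard_tableaux D" "image_mset T (mset_set D) = M" using T by auto
    have KD: "K \<subseteq> D" "finite K" unfolding K_def using fD by auto
    have yK: "young_diagram K"
      unfolding young_diagram_def
    proof (intro conjI allI impI)
      fix i j i' j' assume "(i, j) \<in> K" "i' \<le> i" "j' \<le> j"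
      then show "(i', j') \<in> K"
        using semistandard_mono[OF ss(1) assms(1), of i j i' j'] young_down[OF assms(1), of i j i' j']
        unfolding K_def by auto
    qed (rule KD)
    have le: "T p \<le> m" if "p \<in> D" for p using tableaux_weight_le[OF T fD that] assms(2) by auto
    have "D - K = {p \<in> D. T p = m}" unfolding K_def using le by (force simp: order.strict_iff_order)
    then have "card (D - K) = count M m" using count_image_mset_set[OF fD, of T m] ss(2) by simp
    then have "card D = card K + count M m" 
      using KD card_mono[OF fD KD(1)] by (simp add: card_Diff_subset)
    moreover have "(i, j) \<in> K" if "(Suc i, j) \<in> D" for i j
    proof -
      have "(i, j) \<in> D" using young_down[OF assms(1) that, of i j] by auto
      then have "T (i, j) < T (Suc i, j)" using ss(1) that unfolding semistandard_tableaux_def by blast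
      then show ?thesis using le[OF that] \<open>(i, j) \<in> D\<close> unfolding K_def by auto
    qed
    ultimately have "K \<in> ?I" unfolding subdiagrams_def hstrip_def using yK KD assms(1) by auto
    moreover have "restrict T K \<in> semistandard_tableaux K"
      using ss(1) subsetD[OF KD(1)] unfolding semistandard_tableaux_def by auto
    moreover have "image_mset (restrict T K) (mset_set K) = ?M"
    proof -
      have "image_mset (restrict T K) (mset_set K) = image_mset T (mset_set K)"
        using KD by (intro image_mset_cong) auto
      also have "\<dots> = filter_mset (\<lambda>x. x < m) (image_mset T (mset_set D))"
        unfolding filter_mset_image_mset K_def using fD by (simp add: filter_mset_mset_set o_def)
      finally show ?thesis using ss(2) by simp
    qed
    ultimately show ?thesis unfolding K_def by simp
  qed
  have 4: "?g x \<in> tableaux_of_weight D M" if x: "x \<in> ?B" for x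
  proof -
    obtain K T where KT: "x = (K, T)" "K \<in> ?I" "T \<in> semistandard_tableaux K" "image_mset T (mset_set K) = ?M"
      "T \<in> tableaux_of_weight K ?M"
      using x by (cases x) auto
    have K: "K \<subseteq> D" "finite K" "young_diagram K" "card D = card K + count M m"
      "\<And>i j. (Suc i, j) \<in> D \<Longrightarrow> (i, j) \<in> K"
      using KT(2) fD unfolding subdiagrams_def hstrip_def by (auto intro: finite_subset)
    have lt: "T p < m" if "p \<in> K" for p using tableaux_weight_le[OF KT(5) K(2) that] by simp
    let ?T = "?g (K, T)"
    have "?T (i, j) \<le> ?T (i, j')" if "(i, j) \<in> D" "(i, j') \<in> D" "j < j'" for i j j'
      using that KT(3) lt[of "(i, j)"] young_down[OF K(3), of i j' i j]
      unfolding semistandard_tableaux_def by (auto simp: less_imp_le)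
    moreover have "?T (i, j) < ?T (i', j)" if h: "(i, j) \<in> D" "(i', j) \<in> D" "i < i'" for i i' j
    proof -
      obtain i'' where "i' = Suc i''" "i \<le> i''" using h(3) by (cases i') auto
      then have "(i, j) \<in> K" using K(5)[of i'' j] h(2) young_down[OF K(3), of i'' j i j] by auto
      then show ?thesis using h KT(3) lt unfolding semistandard_tableaux_def by auto
    qed
    moreover have "?T \<in> D \<rightarrow>\<^sub>E UNIV" using K(1) by auto
    ultimately have ss: "?T \<in> semistandard_tableaux D" unfolding semistandard_tableaux_def by blast
    have D: "D = K \<union> (D - K)" using K by auto
    have "mset_set D = mset_set K + mset_set (D - K)"
      by (subst D, subst mset_set_Union) (use K fD in auto)
    moreover have "image_mset ?T (mset_set K) = image_mset T (mset_set K)"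
      using K(2) by (intro image_mset_cong) auto
    moreover have "image_mset ?T (mset_set (D - K)) = image_mset (\<lambda>_. m) (mset_set (D - K))"
      using fD by (intro image_mset_cong) auto
    moreover have "card (D - K) = count M m" using K fD by (simp add: card_Diff_subset)
    ultimately have "image_mset ?T (mset_set D) = ?M + replicate_mset (count M m) m"
      using KT(4) fD by (simp add: image_mset_const_eq)
    then show ?thesis using ss M KT(1) by simp
  qed
  have "bij_betw ?f (tableaux_of_weight D M) ?B"
    by (rule bij_betw_byWitness[where f' = ?g]) (use 1 2 3 4 in blast)+
  then have c: "card (tableaux_of_weight D M) = card ?B" by (rule bij_betw_same_card)
  have "\<forall>K \<in> ?I. finite (tableaux_of_weight K ?M)"
  proof
    fix K assume "K \<in> ?I"
    then have "finite K" unfolding subdiagrams_def using young_finite by auto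
    then show "finite (tableaux_of_weight K ?M)" by (rule finite_tableaux_of_weight)
  qed
  then show ?thesis unfolding schur_def c using finite_subdiagrams[OF fD] by (subst card_SigmaI) auto
qed

theorem schur_eq_block_count:
  "young_diagram D \<Longrightarrow> set_mset M \<subseteq> {..<m} \<Longrightarrow> schur D M = int (block_count {} D (map (count M) [0..<m]))"
proof (induction m arbitrary: D M)
  case 0
  then have M: "M = {#}" by auto
  show ?case
  proof (cases "D = {}")
    case True
    have "tableaux_of_weight {} {#} = {\<lambda>_. undefined}" by (auto simp: semistandard_tableaux_def)
    moreover have "{w \<in> paths {} {}. increasing_blocks [] w} = {[]}" by (auto simp: paths_def)
    ultimately show ?thesis unfolding True M schur_def block_count_def by simp
  next
    case False
    have "image_mset T (mset_set D) \<noteq> {#}" for T :: "nat \<times> nat \<Rightarrow> nat"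
      using False young_finite[OF 0(1)] by (simp add: mset_set_empty_iff)
    moreover have "{w \<in> paths {} D. increasing_blocks [] w} = {}" using False by (auto simp: paths_def)
    ultimately show ?thesis unfolding M schur_def block_count_def by simp
  qed
next
  case (Suc m)
  let ?M = "filter_mset (\<lambda>x. x < m) M"
  have "set_mset M \<subseteq> {..m}" using Suc.prems(2) by auto
  then have "schur D M = (\<Sum>K \<in> inner_strips D (count M m). schur K ?M)"
    by (rule schur_step[OF Suc.prems(1)])
  also have "\<dots> = (\<Sum>K \<in> inner_strips D (count M m). int (block_count {} K (map (count M) [0..<m])))"
  proof (rule sum.cong)
    fix K assume "K \<in> inner_strips D (count M m)"
    then have "young_diagram K" by (auto simp: subdiagrams_def)
    moreover have "set_mset ?M \<subseteq> {..<m}" by auto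
    moreover have "map (count ?M) [0..<m] = map (count M) [0..<m]" by (rule map_cong) auto
    ultimately show "schur K ?M = int (block_count {} K (map (count M) [0..<m]))"
      using Suc.IH[of K ?M] by metis
  qed simp
  also have "\<dots> = int (block_count {} D (map (count M) [0..<m] @ [count M m]))"
    unfolding block_count_snoc by simp
  finally show ?case by simp
qed

section \<open>Linear independence of Schur functions\<close>

lemma tableau_ge_row:
  assumes "T \<in> semistandard_tableaux D" "young_diagram D"
  shows "(i, j) \<in> D \<Longrightarrow> i \<le> T (i, j)"
proof (induction i)
  case (Suc i)
  have "(i, j) \<in> D" using young_down[OF assms(2) Suc(2), of i j] by simp
  moreover from this have "T (i, j) < T (Suc i, j)"
    using Suc(2) assms(1) unfolding semistandard_tableaux_def by blast
  ultimately show ?case using Suc.IH by simp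
qed simp

lemma young_row: "young_diagram D \<Longrightarrow> {p \<in> D. fst p = i} = {i} \<times> {..<card {p \<in> D. fst p = i}}"
proof -
  assume y: "young_diagram D"
  define J where "J = {j. (i, j) \<in> D}"
  have row: "{p \<in> D. fst p = i} = {i} \<times> J" unfolding J_def by auto
  have "finite J" using young_finite[OF y] finite_imageI[of D snd] unfolding J_def
    by (rule_tac finite_subset[of _ "snd ` D"]) force+
  have "J = {..<card J}"
  proof -
    have down: "a \<in> J" if "b \<in> J" "a \<le> b" for a b using that young_down[OF y] unfolding J_def by auto
    have "J \<subseteq> {..<card J}"
    proof
      fix b assume "b \<in> J"
      then have "{..b} \<subseteq> J" using down by auto
      then have "card {..b} \<le> card J" using \<open>finite J\<close> card_mono by blast
      then show "b \<in> {..<card J}" by simp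
    qed
    then show ?thesis by (simp add: card_subset_eq)
  qed
  then show ?thesis unfolding row by (simp add: card_cartesian_product)
qed

lemma young_eqI_rows:
  assumes "young_diagram D" "young_diagram E"
    "image_mset fst (mset_set D) = image_mset fst (mset_set E)"
  shows "D = E"
proof -
  have "card {p \<in> D. fst p = i} = card {p \<in> E. fst p = i}" for i
    using arg_cong[OF assms(3), of "\<lambda>M. count M i"]
      count_image_mset_set[OF young_finite[OF assms(1)], of fst i]
      count_image_mset_set[OF young_finite[OF assms(2)], of fst i] by simp
  then have "{p \<in> D. fst p = i} = {p \<in> E. fst p = i}" for i
    using young_row[OF assms(1), of i] young_row[OF assms(2), of i] by simp
  then show ?thesis by blast
qed

text \<open>Entries in row \<open>i\<close> are at least \<open>i\<close>. A tableau of shape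
  \<open>D\<close> that uses each \<open>i\<close> as often as row \<open>i\<close> of
  \<open>E\<close> has boxes therefore bounds the sum of row indices of \<open>D\<close> by that of
  \<open>E\<close>, and equality forces every entry to be its row index. This makes Schur functions
  triangular with respect to a numerical statistic, which serves instead of the dominance
  order.\<close>

lemma schur_row_weight:
  assumes "young_diagram D" "young_diagram E" "schur D (image_mset fst (mset_set E)) \<noteq> 0"
  shows "(\<Sum>p\<in>D. fst p) \<le> (\<Sum>p\<in>E. fst p) \<and> ((\<Sum>p\<in>D. fst p) = (\<Sum>p\<in>E. fst p) \<longrightarrow> D = E)"
proof -
  obtain T where T: "T \<in> semistandard_tableaux D" "image_mset T (mset_set D) = image_mset fst (mset_set E)"
    using assms(3) unfolding schur_def by (auto simp: card_gt_0_iff)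
  have f: "finite D" using assms(1) young_finite by auto
  have le: "\<And>p. p \<in> D \<Longrightarrow> fst p \<le> T p" using tableau_ge_row[OF T(1) assms(1)] by auto
  have s: "(\<Sum>p\<in>D. T p) = (\<Sum>p\<in>E. fst p)" using T(2) unfolding sum_unfold_sum_mset by simp
  have "D = E" if "(\<Sum>p\<in>D. fst p) = (\<Sum>p\<in>E. fst p)"
  proof -
    have "\<forall>p\<in>D. fst p = T p"
    proof (rule ccontr)
      assume "\<not> ?thesis"
      then obtain p where "p \<in> D" "fst p < T p" using le by (metis order.strict_iff_order)
      then have "(\<Sum>p\<in>D. fst p) < (\<Sum>p\<in>D. T p)" using f le by (intro sum_strict_mono_ex1) auto
      then show False using s that by simp
    qed
    then have "image_mset fst (mset_set D) = image_mset T (mset_set D)" using f by (intro image_mset_cong) auto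
    then show ?thesis using young_eqI_rows assms(1,2) T(2) by simp
  qed
  moreover have "(\<Sum>p\<in>D. fst p) \<le> (\<Sum>p\<in>D. T p)" by (rule sum_mono) (rule le)
  ultimately show ?thesis using s by simp
qed

lemma schur_row_weight_self:
  assumes "young_diagram D"
  shows "schur D (image_mset fst (mset_set D)) \<noteq> 0"
proof -
  have f: "finite D" using assms young_finite by auto
  have "restrict fst D \<in> tableaux_of_weight D (image_mset fst (mset_set D))"
    using f by (auto simp: semistandard_tableaux_def intro!: image_mset_cong)
  then have "card (tableaux_of_weight D (image_mset fst (mset_set D))) \<noteq> 0"
    using finite_tableaux_of_weight[OF f] unfolding card_eq_0_iff by blast
  then show ?thesis unfolding schur_def by simp
qed

text \<open>Take a shape \<open>K\<close> with non-zero coefficient and least sum of row indices. At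
  the monomial given by the row lengths of \<open>K\<close>, no other shape of the combination
  contributes.\<close>

theorem schur_independent:
  assumes "finite U" "\<And>D. D \<in> U \<Longrightarrow> young_diagram D" "\<And>M. (\<Sum>D\<in>U. d D * schur D M) = 0" "D \<in> U"
  shows "d D = 0"
proof (rule ccontr)
  assume "d D \<noteq> 0"
  let ?w = "\<lambda>D :: diagram. \<Sum>p\<in>D. fst p"
  have "D \<in> {D \<in> U. d D \<noteq> 0}" using assms(4) \<open>d D \<noteq> 0\<close> by simp
  then obtain K where K: "K \<in> U" "d K \<noteq> 0" "\<And>E. E \<in> U \<Longrightarrow> d E \<noteq> 0 \<Longrightarrow> ?w K \<le> ?w E"
    using ex_has_least_nat[of "\<lambda>D. D \<in> U \<and> d D \<noteq> 0" D ?w] by auto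
  let ?M = "image_mset fst (mset_set K)"
  have z: "d E * schur E ?M = 0" if "E \<in> U - {K}" for E
  proof (rule ccontr)
    assume "d E * schur E ?M \<noteq> 0"
    then have "schur E ?M \<noteq> 0" "?w K \<le> ?w E" using K(3) that by auto
    then show False using schur_row_weight[of E K] assms(2) K(1) that by auto
  qed
  have "(\<Sum>D\<in>U. d D * schur D ?M) = d K * schur K ?M + (\<Sum>D\<in>U - {K}. d D * schur D ?M)"
    using assms(1) K(1) by (rule sum.remove)
  also have "(\<Sum>D\<in>U - {K}. d D * schur D ?M) = 0" using z by (intro sum.neutral) blast
  finally show False using assms(2,3) K(1,2) schur_row_weight_self by auto
qed

lemma schur_expansion_unique:
  assumes "schur_expansion f c" "schur_expansion f c'"
  shows "c = c'"
proof
  fix D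
  let ?U = "{D. c D \<noteq> 0} \<union> {D. c' D \<noteq> 0}"
  have fin: "finite ?U" using assms unfolding schur_expansion_def by auto
  have y: "\<And>D. D \<in> ?U \<Longrightarrow> young_diagram D" using assms unfolding schur_expansion_def by auto
  have "(\<Sum>D\<in>?U. (c D - c' D) * schur D M) = 0" for M
  proof -
    have "(\<Sum>D\<in>?U. c D * schur D M) = (\<Sum>D | c D \<noteq> 0. c D * schur D M)"
      "(\<Sum>D\<in>?U. c' D * schur D M) = (\<Sum>D | c' D \<noteq> 0. c' D * schur D M)"
      using fin by (intro sum.mono_neutral_right; auto)+
    moreover have "f M = (\<Sum>D | c D \<noteq> 0. c D * schur D M)" "f M = (\<Sum>D | c' D \<noteq> 0. c' D * schur D M)"
      using assms unfolding schur_expansion_def by blast+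
    ultimately have "(\<Sum>D\<in>?U. c D * schur D M) = (\<Sum>D\<in>?U. c' D * schur D M)" by metis
    then show ?thesis by (simp add: left_diff_distrib sum_subtractf)
  qed
  from schur_independent[OF fin y this] show "c D = c' D" by (cases "D \<in> ?U") auto
qed

lemma schur_coeff_eqI: "schur_expansion f c \<Longrightarrow> schur_coeff f D = c D"
  unfolding schur_coeff_def using schur_expansion_unique by (metis the_equality)

section \<open>Pieri's rule\<close>

definition row :: "nat \<Rightarrow> diagram" where
  "row m = {0} \<times> {..<m}"

lemma young_row_diagram [simp]: "young_diagram (row m)"
  unfolding young_diagram_def row_def by auto

lemma card_row [simp]: "card (row m) = m"
  unfolding row_def by (simp add: card_cartesian_product)

lemma hstrip_empty_iff: "hstrip {} D n \<longleftrightarrow> D = row n"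
proof
  assume h: "hstrip {} D n"
  then have y: "young_diagram D" "card D = n" unfolding hstrip_def by auto
  have "fst p = 0" if "p \<in> D" for p
    using that h unfolding hstrip_def by (cases p; cases "fst p") auto
  then have "D = {p \<in> D. fst p = 0}" by auto
  then show "D = row n" using young_row[OF y(1), of 0] y(2) unfolding row_def by simp
next
  assume "D = row n"
  then show "hstrip {} D n" using young_row_diagram[of n] card_row[of n] unfolding hstrip_def row_def by auto
qed

text \<open>Rectification preserves ascents, so a word rectifies to the increasing word of
  \<open>row n\<close> iff it is itself an increasing word of length \<open>n\<close>, and such
  words are exactly the horizontal strips.\<close>

lemma lr_row:
  assumes "young_diagram D"
  shows "lr D (row n) E = (if hstrip D E n then 1 else 0)"
proof -
  have std: "path {} (std_word (row n)) (row n)" by (rule path_std_word) simp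
  obtain u where u: "path {} u (row n)" "length u = n" "sorted_wrt (<) u"
    using hstrip_increasing_path hstrip_empty_iff by blast
  have "{S \<in> paths D E. rect D S = u} = {S. path D S E \<and> length S = n \<and> sorted_wrt (<) S}"
  proof (intro set_eqI iffI)
    fix S assume "S \<in> {S \<in> paths D E. rect D S = u}"
    then have S: "path D S E" "rect D S = u" unfolding paths_def by auto
    from path_rect[OF S(1)] have "ascents u = ascents S" "length u = length S" using S(2) by auto
    then show "S \<in> {S. path D S E \<and> length S = n \<and> sorted_wrt (<) S}"
      using S(1) u(2,3) by (simp add: sorted_wrt_ascents)
  next
    fix S assume "S \<in> {S. path D S E \<and> length S = n \<and> sorted_wrt (<) S}"
    then have S: "path D S E" "length S = n" "sorted_wrt (<) S" by auto
    from path_rect[OF S(1)] obtain mu where mu: "path {} (rect D S) mu" "ascents (rect D S) = ascents S"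
      "length (rect D S) = length S" by blast
    then have s: "sorted_wrt (<) (rect D S)" using S(3) by (simp add: sorted_wrt_ascents)
    then have "mu = row n" using mu S(2) hstrip_empty_iff unfolding hstrip_iff by blast
    then have "rect D S = u" using increasing_path_unique mu(1) u s by blast
    then show "S \<in> {S \<in> paths D E. rect D S = u}" using S unfolding paths_def by auto
  qed
  also have "\<dots> = block_words D E [n]" unfolding paths_def by auto
  finally show ?thesis
    using lr_eq_card_rect[OF assms u(1), of E] block_count_single[of D E n] unfolding block_count_def by metis
qed

text \<open>The outer shape of \<open>la\<close> placed below and to the left of a row of \<open>n\<close> boxes; the inner shape is \<open>row m\<close>.\<close>

definition below_row :: "nat \<Rightarrow> nat \<Rightarrow> diagram \<Rightarrow> diagram" where
  "below_row m n la = row (m + n) \<union> (\<lambda>(i, j). (Suc i, j)) ` la"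

lemma below_row_0: "(0, j) \<in> below_row m n la \<longleftrightarrow> j < m + n"
  unfolding below_row_def row_def by auto

lemma below_row_Suc: "(Suc i, j) \<in> below_row m n la \<longleftrightarrow> (i, j) \<in> la"
  unfolding below_row_def row_def by auto

lemma card_below_row: "finite la \<Longrightarrow> card (below_row m n la) = m + n + card la"
  unfolding below_row_def
proof (subst card_Un_disjoint)
  have "inj_on (\<lambda>(i, j). (Suc i, j)) la" by (auto simp: inj_on_def)
  then show "card (row (m + n)) + card ((\<lambda>(i, j). (Suc i, j)) ` la) = m + n + card la"
    by (simp add: card_image)
qed (auto simp: row_def)

lemma young_below_row:
  assumes "young_diagram la" "\<And>i j. (i, j) \<in> la \<Longrightarrow> j < m"
  shows "young_diagram (below_row m n la)"
  unfolding young_diagram_def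
proof (intro conjI allI impI)
  show "finite (below_row m n la)" unfolding below_row_def using young_finite[OF assms(1)] by (simp add: row_def)
  fix i j i' j' assume h: "(i, j) \<in> below_row m n la" "i' \<le> i" "j' \<le> j"
  show "(i', j') \<in> below_row m n la"
  proof (cases i')
    case 0
    have "j < m + n" using h(1) assms(2) by (cases i) (fastforce simp: below_row_0 below_row_Suc)+
    then show ?thesis using 0 h(3) by (simp add: below_row_0)
  next
    case (Suc k)
    then show ?thesis using h young_down[OF assms(1)] by (cases i) (auto simp: below_row_Suc)
  qed
qed

text \<open>Because \<open>la\<close> is shifted down by one row, the two conditions of a horizontal
  strip change places: the column condition on one side is the inclusion of diagrams on the other.
  Only the length of the first row has to be compared by counting boxes.\<close>

lemma hstrip_below_row_iff:
  assumes la: "young_diagram la" and m: "\<And>i j. (i, j) \<in> la \<Longrightarrow> j < m" and nu: "young_diagram nu"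
  shows "hstrip nu (below_row m n la) m \<longleftrightarrow> hstrip la nu n"
proof
  have y: "young_diagram (below_row m n la)" by (rule young_below_row[OF la m])
  assume h: "hstrip nu (below_row m n la) m"
  have "(i, j) \<in> nu" if "(i, j) \<in> la" for i j
    using h that below_row_Suc unfolding hstrip_def by blast
  moreover have "(i, j) \<in> la" if "(Suc i, j) \<in> nu" for i j
    using h that below_row_Suc unfolding hstrip_def by blast
  moreover have "card nu = card la + n"
    using h card_below_row[OF young_finite[OF la]] unfolding hstrip_def by auto
  ultimately show "hstrip la nu n" using la nu unfolding hstrip_def by auto
next
  have y: "young_diagram (below_row m n la)" by (rule young_below_row[OF la m])
  assume h: "hstrip la nu n"
  have sub: "nu \<subseteq> below_row m n la"
  proof (clarify)
    fix i j assume ij: "(i, j) \<in> nu"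
    show "(i, j) \<in> below_row m n la"
    proof (cases i)
      case 0
      \<comment> \<open>Boxes of row 0 of \<open>nu\<close> from column \<open>m\<close> on are
        outside \<open>la\<close>, and \<open>nu - la\<close> has only \<open>n\<close>
        boxes.\<close>
      have "card ({0 :: nat} \<times> {m..j}) \<le> card (nu - la)"
      proof (rule card_mono)
        show "finite (nu - la)" using young_finite[OF nu] by simp
        show "{0} \<times> {m..j} \<subseteq> nu - la"
        proof clarify
          fix b assume "b \<in> {m..j}"
          then show "(0, b) \<in> nu - la" using young_down[OF nu ij, of 0 b] m[of 0 b] by auto
        qed
      qed
      moreover have "card (nu - la) = n"
        using h young_finite[OF la] unfolding hstrip_def by (simp add: card_Diff_subset)
      ultimately show ?thesis using 0 by (auto simp: below_row_0 card_cartesian_product)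
    next
      case (Suc k)
      then show ?thesis using h ij below_row_Suc unfolding hstrip_def by blast
    qed
  qed
  have "(i, j) \<in> nu" if "(Suc i, j) \<in> below_row m n la" for i j
    using that h unfolding below_row_Suc hstrip_def by blast
  then show "hstrip nu (below_row m n la) m"
    using sub y nu h card_below_row[OF young_finite[OF la], of m n] unfolding hstrip_def by auto
qed

text \<open>The strip takes \<open>i\<close> boxes from the end of the long row and
  \<open>c - i\<close> boxes from the copy of \<open>la\<close>. These parts do not interact, since
  every column of \<open>la\<close> lies under the inner row \<open>row m\<close>.\<close>

lemma hstrip_below_row_below_row:
  assumes "young_diagram la" "\<And>i j. (i, j) \<in> la \<Longrightarrow> j < m" "young_diagram ka" "ka \<subseteq> la" "i \<le> n" "i \<le> c"
  shows "hstrip (below_row m (n - i) ka) (below_row m n la) c \<longleftrightarrow> hstrip ka la (c - i)"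
proof -
  have m: "\<And>i j. (i, j) \<in> ka \<Longrightarrow> j < m" using assms(2,4) by blast
  have y: "young_diagram (below_row m n la)" "young_diagram (below_row m (n - i) ka)"
    using young_below_row assms m by blast+
  have "below_row m (n - i) ka \<subseteq> below_row m n la"
    unfolding below_row_def row_def using assms(4) by auto
  moreover have "card (below_row m n la) = card (below_row m (n - i) ka) + c \<longleftrightarrow> card la = card ka + (c - i)"
    using card_below_row young_finite assms(1,3,5,6) by auto
  moreover have "(\<forall>a b. (Suc a, b) \<in> below_row m n la \<longrightarrow> (a, b) \<in> below_row m (n - i) ka) \<longleftrightarrow>
    (\<forall>a b. (Suc a, b) \<in> la \<longrightarrow> (a, b) \<in> ka)" (is "?L = ?R")
  proof
    assume ?L
    then show ?R using below_row_Suc by blast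
  next
    assume R: ?R
    show ?L
    proof (intro allI impI)
      fix a b assume "(Suc a, b) \<in> below_row m n la"
      then have "(a, b) \<in> la" unfolding below_row_Suc .
      then show "(a, b) \<in> below_row m (n - i) ka"
        using R assms(2) by (cases a) (fastforce simp: below_row_0 below_row_Suc)+
    qed
  qed
  ultimately show ?thesis using y assms(1,3,4) unfolding hstrip_def by blast
qed

lemma below_row_inj:
  "below_row m n la = below_row m n' la' \<Longrightarrow> n = n' \<and> la = la'"
proof
  assume e: "below_row m n la = below_row m n' la'"
  have "\<And>j. j < m + n \<longleftrightarrow> j < m + n'" using e below_row_0 by metis
  then have "m + n = m + n'" by (metis linorder_neqE_nat less_irrefl)
  then show "n = n'" by simp
  show "la = la'" using e below_row_Suc by (metis pred_equals_eq2 subrelI subset_antisym)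
qed

lemma block_count_below_row_snoc:
  assumes la: "young_diagram la" and m: "\<And>i j. (i, j) \<in> la \<Longrightarrow> j < m"
  shows "block_count (row m) (below_row m n la) (al @ [c]) =
    (\<Sum>i \<le> min n c. \<Sum>ka \<in> inner_strips la (c - i). block_count (row m) (below_row m (n - i) ka) al)"
proof -
  let ?th = "below_row m n la"
  let ?J = "SIGMA i : {..min n c}. inner_strips la (c - i)"
  let ?K = "inner_strips ?th c"
  let ?g = "\<lambda>(i, ka). below_row m (n - i) ka"
  have y: "young_diagram ?th" by (rule young_below_row[OF la m])
  have fin: "finite ?K" using finite_subdiagrams[OF young_finite[OF y]] by auto
  have finJ: "finite (subdiagrams la)" using finite_subdiagrams[OF young_finite[OF la]] .
  have sub: "?g ` ?J \<subseteq> ?K"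
  proof (rule image_subsetI)
    fix x assume "x \<in> ?J"
    then obtain i ka where h: "x = (i, ka)" "i \<le> n" "i \<le> c" "ka \<in> subdiagrams la" "hstrip ka la (c - i)" by auto
    then have ka: "young_diagram ka" "ka \<subseteq> la" unfolding subdiagrams_def by auto
    have "hstrip (below_row m (n - i) ka) ?th c"
      using hstrip_below_row_below_row[OF la m ka h(2,3)] h(5) by auto
    then show "?g x \<in> ?K" unfolding h(1) hstrip_def subdiagrams_def by auto
  qed
  \<comment> \<open>The remaining strips cut into \<open>row m\<close>; there is no chain from
    \<open>row m\<close> to what they leave, so they contribute nothing.\<close>
  have zero: "block_count (row m) K al = 0" if K: "K \<in> ?K - ?g ` ?J" for K
  proof (rule ccontr)
    assume "block_count (row m) K al \<noteq> 0"
    then obtain w where w: "path (row m) w K" unfolding block_count_def paths_def by (auto simp: card_gt_0_iff)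
    have rK: "row m \<subseteq> K" "young_diagram K" using path_subset[OF w] path_young[OF w] by auto
    have hK: "hstrip K ?th c" "K \<subseteq> ?th" using K unfolding subdiagrams_def by auto
    define ka where "ka = {(i, j). (Suc i, j) \<in> K}"
    define r where "r = card {p \<in> K. fst p = 0}"
    have K0: "(0, j) \<in> K \<longleftrightarrow> j < r" for j
      using young_row[OF rK(2), of 0] unfolding r_def[symmetric] by (auto simp: set_eq_iff)
    have "m \<le> r"
    proof (rule ccontr)
      assume "\<not> m \<le> r"
      then have "(0, r) \<in> row m" by (auto simp: row_def)
      then show False using K0 rK(1) by blast
    qed
    moreover have "r \<le> m + n"
    proof (rule ccontr)
      assume "\<not> r \<le> m + n"
      then have "(0, m + n) \<in> K" using K0 by auto
      then show False using hK(2) below_row_0 by blast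
    qed
    ultimately have i: "m + n - r \<le> n" "r = m + (n - (m + n - r))" by auto
    define i where "i = m + n - r"
    note i = i[folded i_def]
    have kala: "ka \<subseteq> la" using hK(2) below_row_Suc unfolding ka_def by blast
    have "finite ka" using kala young_finite[OF la] finite_subset by blast
    then have yka: "young_diagram ka"
      unfolding young_diagram_def ka_def using young_down[OF rK(2)] by fastforce
    have Keq: "K = below_row m (n - i) ka"
    proof (rule set_eqI)
      fix p :: "nat \<times> nat"
      obtain a b where p: "p = (a, b)" by (cases p)
      show "p \<in> K \<longleftrightarrow> p \<in> below_row m (n - i) ka"
        unfolding p using K0 i(2) by (cases a) (auto simp: below_row_0 below_row_Suc ka_def)
    qed
    have "card ?th = card K + c" using hK(1) unfolding hstrip_def by auto
    moreover have "card ka \<le> card la" using kala young_finite[OF la] card_mono by blast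
    ultimately have "i \<le> c"
      using card_below_row[OF young_finite[OF la], of m n] card_below_row[OF \<open>finite ka\<close>, of m "n - i"] i(1) Keq by simp
    then have "hstrip ka la (c - i)" using hstrip_below_row_below_row[OF la m yka kala i(1)] hK(1) Keq by auto
    then have "(i, ka) \<in> ?J" using i(1) \<open>i \<le> c\<close> kala yka unfolding subdiagrams_def by auto
    then show False using K Keq by (metis (no_types, lifting) DiffD2 case_prod_conv imageI)
  qed
  have inj: "inj_on ?g ?J"
  proof (rule inj_onI)
    fix x y assume h: "x \<in> ?J" "y \<in> ?J" "?g x = ?g y"
    obtain i ka i' ka' where xy: "x = (i, ka)" "y = (i', ka')" by (cases x; cases y)
    then have "n - i = n - i' \<and> ka = ka'" using h(3) below_row_inj by auto
    then show "x = y" using h(1,2) xy by auto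
  qed
  have "block_count (row m) ?th (al @ [c]) = (\<Sum>K \<in> ?K. block_count (row m) K al)"
    by (rule block_count_snoc)
  also have "\<dots> = (\<Sum>K \<in> ?g ` ?J. block_count (row m) K al)"
    by (rule sum.mono_neutral_right[OF fin sub]) (use zero in blast)
  also have "\<dots> = (\<Sum>(i, ka) \<in> ?J. block_count (row m) (below_row m (n - i) ka) al)"
    by (subst sum.reindex[OF inj]) (simp add: case_prod_beta o_def)
  also have "\<dots> = (\<Sum>i \<le> min n c. \<Sum>ka \<in> inner_strips la (c - i).
      block_count (row m) (below_row m (n - i) ka) al)"
    using finJ by (subst sum.Sigma) auto
  finally show ?thesis .
qed

section \<open>Multiplying a Schur function by a complete homogeneous one\<close>

lemma finite_submultisets: "finite {B. B \<subseteq># M}"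
proof (induction M)
  case (add x M)
  have "{B. B \<subseteq># add_mset x M} \<subseteq> {B. B \<subseteq># M} \<union> add_mset x ` {B. B \<subseteq># M}"
  proof
    fix B assume "B \<in> {B. B \<subseteq># add_mset x M}"
    then have B: "B \<subseteq># add_mset x M" by simp
    show "B \<in> {B. B \<subseteq># M} \<union> add_mset x ` {B. B \<subseteq># M}"
    proof (cases "x \<in># B")
      case True
      then obtain C where "B = add_mset x C" by (rule mset_add)
      then show ?thesis using B by auto
    next
      case False
      have "count B y \<le> count M y" for y
        using mset_subset_eq_count[OF B, of y] False by (cases "y = x") (auto simp: not_in_iff)
      then show ?thesis by (simp add: mset_subset_eqI)
    qed
  qed
  then show ?case using add by (meson finite_UnI finite_imageI finite_subset)
qed simp

lemma sum_submultisets_split: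
  fixes F :: "nat multiset \<Rightarrow> int"
  assumes "set_mset M \<subseteq> {..m}"
  shows "(\<Sum>B \<in> {B. B \<subseteq># M \<and> size B = n}. F B) =
    (\<Sum>i \<le> min n (count M m). \<Sum>B \<in> {B. B \<subseteq># filter_mset (\<lambda>x. x < m) M \<and> size B = n - i}. F (B + replicate_mset i m))"
proof -
  let ?M = "filter_mset (\<lambda>x. x < m) M"
  let ?J = "SIGMA i : {..min n (count M m)}. {B. B \<subseteq># ?M \<and> size B = n - i}"
  have fin: "finite {B. B \<subseteq># ?M \<and> size B = k}" for k
    by (rule finite_subset[OF _ finite_submultisets[of ?M]]) auto
  have "(\<Sum>B \<in> {B. B \<subseteq># M \<and> size B = n}. F B) = (\<Sum>(i, B) \<in> ?J. F (B + replicate_mset i m))"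
  proof (rule sum.reindex_bij_witness[where i = "\<lambda>(i, B). B + replicate_mset i m"
        and j = "\<lambda>B. (count B m, filter_mset (\<lambda>x. x < m) B)"])
    fix B assume "B \<in> {B. B \<subseteq># M \<and> size B = n}"
    then have B: "B \<subseteq># M" "size B = n" by auto
    have "set_mset B \<subseteq> {..m}" using B(1) assms set_mset_mono by blast
    then have e: "filter_mset (\<lambda>x. x < m) B + replicate_mset (count B m) m = B"
      by (intro multiset_eqI) (auto simp: not_in_iff[symmetric] count_eq_zero_iff subset_eq not_less le_less)
    then show "(case (count B m, filter_mset (\<lambda>x. x < m) B) of (i, B) \<Rightarrow> B + replicate_mset i m) = B" by simp
    have "size (filter_mset (\<lambda>x. x < m) B) + count B m = n"
      using arg_cong[OF e, of size] B(2) by simp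
    moreover have "filter_mset (\<lambda>x. x < m) B \<subseteq># ?M" using B(1) by (rule multiset_filter_mono)
    moreover have "count B m \<le> count M m" using B(1) by (rule mset_subset_eq_count)
    ultimately show "(count B m, filter_mset (\<lambda>x. x < m) B) \<in> ?J" by auto
    show "(case (count B m, filter_mset (\<lambda>x. x < m) B) of (i, B) \<Rightarrow> F (B + replicate_mset i m)) = F B"
      using e by simp
  next
    fix x assume "x \<in> ?J"
    then obtain i B where x: "x = (i, B)" "i \<le> n" "i \<le> count M m" "B \<subseteq># ?M" "size B = n - i" by auto
    have Bm: "\<And>y. y \<in># B \<Longrightarrow> y < m" using mset_subset_eqD[OF x(4)] by auto
    then have "count B m = 0" by (meson less_irrefl not_in_iff)
    moreover have "filter_mset (\<lambda>x. x < m) B = B" using Bm by (simp add: filter_mset_eq_conv)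
    ultimately show "(count (case x of (i, B) \<Rightarrow> B + replicate_mset i m) m,
        filter_mset (\<lambda>x. x < m) (case x of (i, B) \<Rightarrow> B + replicate_mset i m)) = x"
      using x(1) by (simp add: multiset_eq_iff)
    have "B + replicate_mset i m \<subseteq># M"
    proof (rule mset_subset_eqI)
      fix y
      show "count (B + replicate_mset i m) y \<le> count M y"
        using x(3) mset_subset_eq_count[OF x(4), of y] \<open>count B m = 0\<close> by (auto split: if_splits)
    qed
    then show "(case x of (i, B) \<Rightarrow> B + replicate_mset i m) \<in> {B. B \<subseteq># M \<and> size B = n}"
      using x by simp
  qed
  also have "\<dots> = (\<Sum>i \<le> min n (count M m). \<Sum>B \<in> {B. B \<subseteq># ?M \<and> size B = n - i}. F (B + replicate_mset i m))"
    using fin by (subst sum.Sigma) auto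
  finally show ?thesis .
qed

text \<open>The skew shape \<open>below_row m n la\<close> over \<open>row m\<close> falls into
  \<open>la\<close> and a row of \<open>n\<close> boxes, so its generating function is the product
  of \<open>schur la\<close> with the sum of all monomials of degree \<open>n\<close>. The left side
  is the coefficient of \<open>M\<close> in that product, and both sides obey the same recursion
  when the largest variable is split off.\<close>

lemma sum_schur_eq_block_count_below_row:
  assumes "young_diagram la" "\<And>i j. (i, j) \<in> la \<Longrightarrow> j < m" "set_mset M \<subseteq> {..<N}"
  shows "(\<Sum>B \<in> {B. B \<subseteq># M \<and> size B = n}. schur la (M - B)) =
    int (block_count (row m) (below_row m n la) (map (count M) [0..<N]))"
  using assms
proof (induction N arbitrary: la n M)
  case 0
  then have M: "M = {#}" by auto
  have B: "{B. B \<subseteq># {#} \<and> size B = n} = (if n = 0 then {{#}} else {})" by auto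
  have "below_row m n la = row m \<longleftrightarrow> n = 0 \<and> la = {}"
    using below_row_inj[of m n la 0 "{}"] by (auto simp: below_row_def)
  then have "{w \<in> paths (row m) (below_row m n la). increasing_blocks [] w} =
      (if n = 0 \<and> la = {} then {[]} else {})"
    by (auto simp: paths_def)
  moreover have "schur la {#} = (if la = {} then 1 else 0)"
    using schur_eq_block_count[OF 0(1), of "{#}" 0] by (auto simp: block_count_def paths_def Collect_conv_if conj_commute)
  ultimately show ?case unfolding M B block_count_def by auto
next
  case (Suc N)
  let ?M = "filter_mset (\<lambda>x. x < N) M"
  let ?c = "count M N"
  have MN: "set_mset M \<subseteq> {..N}" using Suc.prems(3) by auto
  have cnt: "map (count ?M) [0..<N] = map (count M) [0..<N]" by (rule map_cong) auto
  have "(\<Sum>B \<in> {B. B \<subseteq># M \<and> size B = n}. schur la (M - B)) =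
    (\<Sum>i \<le> min n ?c. \<Sum>B \<in> {B. B \<subseteq># ?M \<and> size B = n - i}. schur la (M - (B + replicate_mset i N)))"
    by (rule sum_submultisets_split[OF MN])
  also have "\<dots> = (\<Sum>i \<le> min n ?c. \<Sum>B \<in> {B. B \<subseteq># ?M \<and> size B = n - i}.
      \<Sum>ka \<in> inner_strips la (?c - i). schur ka (?M - B))"
  proof (intro sum.cong refl)
    fix i B assume h: "i \<in> {..min n ?c}" "B \<in> {B. B \<subseteq># ?M \<and> size B = n - i}"
    have BM: "count B y \<le> count ?M y" for y by (rule mset_subset_eq_count) (use h(2) in blast)
    then have BN: "count B N = 0" by (metis count_filter_mset le_zero_eq less_irrefl)
    have "filter_mset (\<lambda>x. x < N) (M - (B + replicate_mset i N)) = ?M - B"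
    proof (rule multiset_eqI)
      fix y
      show "count (filter_mset (\<lambda>x. x < N) (M - (B + replicate_mset i N))) y = count (?M - B) y"
        using BM[of y] by auto
    qed
    moreover have "count (M - (B + replicate_mset i N)) N = ?c - i" using BN by simp
    moreover have "set_mset (M - (B + replicate_mset i N)) \<subseteq> {..N}" using MN by (meson in_diffD subset_iff)
    ultimately show "schur la (M - (B + replicate_mset i N)) =
        (\<Sum>ka \<in> inner_strips la (?c - i). schur ka (?M - B))"
      using schur_step[OF Suc.prems(1)] by metis
  qed
  also have "\<dots> = (\<Sum>i \<le> min n ?c. \<Sum>ka \<in> inner_strips la (?c - i).
      \<Sum>B \<in> {B. B \<subseteq># ?M \<and> size B = n - i}. schur ka (?M - B))"
    by (intro sum.cong refl sum.swap)
  also have "\<dots> = (\<Sum>i \<le> min n ?c. \<Sum>ka \<in> inner_strips la (?c - i).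
      int (block_count (row m) (below_row m (n - i) ka) (map (count M) [0..<N])))"
  proof (intro sum.cong refl)
    fix i ka assume "ka \<in> inner_strips la (?c - i)"
    then have "young_diagram ka" "\<And>i j. (i, j) \<in> ka \<Longrightarrow> j < m" "set_mset ?M \<subseteq> {..<N}"
      using Suc.prems(2) unfolding subdiagrams_def by auto
    from Suc.IH[OF this]
    show "(\<Sum>B \<in> {B. B \<subseteq># ?M \<and> size B = n - i}. schur ka (?M - B)) =
      int (block_count (row m) (below_row m (n - i) ka) (map (count M) [0..<N]))"
      unfolding cnt .
  qed
  also have "\<dots> = int (block_count (row m) (below_row m n la) (map (count M) [0..<Suc N]))"
    using block_count_below_row_snoc[OF Suc.prems(1,2), where n = n and al = "map (count M) [0..<N]" and c = ?c] by simp
  finally show ?case .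
qed

lemma column_bound_exists:
  assumes "finite (la :: diagram)"
  obtains m where "\<And>i j. (i, j) \<in> la \<Longrightarrow> j < m"
proof -
  have "finite (snd ` la)" using assms by simp
  then obtain m where "\<forall>j \<in> snd ` la. j < m" using finite_nat_set_iff_bounded by blast
  then show ?thesis using that by force
qed

lemma finite_hstrips: "young_diagram la \<Longrightarrow> finite {nu. hstrip la nu n}"
proof -
  assume la: "young_diagram la"
  from column_bound_exists[OF young_finite[OF la]] obtain m where m: "\<And>i j. (i, j) \<in> la \<Longrightarrow> j < m" by blast
  have "{nu. hstrip la nu n} \<subseteq> subdiagrams (below_row m n la)"
  proof
    fix nu assume "nu \<in> {nu. hstrip la nu n}"
    then have nu: "young_diagram nu" "hstrip la nu n" unfolding hstrip_def by auto
    have "hstrip nu (below_row m n la) m \<longleftrightarrow> hstrip la nu n" by (rule hstrip_below_row_iff[OF la m nu(1)])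
    then show "nu \<in> subdiagrams (below_row m n la)" using nu(2) unfolding hstrip_def subdiagrams_def by auto
  qed
  moreover have "finite (subdiagrams (below_row m n la))"
    by (rule finite_subdiagrams, rule young_finite, rule young_below_row[OF la m])
  ultimately show ?thesis by (rule finite_subset)
qed

text \<open>Rectification expands the disconnected skew shape of the previous lemma in Schur
  functions. The coefficient of \<open>schur nu\<close> is \<open>lr (row m) nu\<close>, which
  \<open>lr_commute\<close> turns into the case of \<open>lr_row\<close>;
  \<open>hstrip_below_row_iff\<close> translates the resulting strip over \<open>nu\<close> into one
  over \<open>la\<close>.\<close>

lemma pieri_sum:
  assumes la: "young_diagram la"
  shows "(\<Sum>B \<in> {B. B \<subseteq># M \<and> size B = n}. schur la (M - B)) = (\<Sum>nu \<in> {nu. hstrip la nu n}. schur nu M)"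
proof -
  from column_bound_exists[OF young_finite[OF la]] obtain m where m: "\<And>i j. (i, j) \<in> la \<Longrightarrow> j < m" by blast
  obtain N where N: "set_mset M \<subseteq> {..<N}" using finite_nat_set_iff_bounded[of "set_mset M"] by auto
  let ?th = "below_row m n la"
  let ?al = "map (count M) [0..<N]"
  have y: "young_diagram ?th" by (rule young_below_row[OF la m])
  have fin: "finite (subdiagrams ?th)" by (rule finite_subdiagrams[OF young_finite[OF y]])
  have "hstrip nu ?th m \<longleftrightarrow> hstrip la nu n" if "young_diagram nu" for nu
    by (rule hstrip_below_row_iff[OF la m that])
  then have set: "{nu. hstrip la nu n} = inner_strips ?th m"
    unfolding hstrip_def subdiagrams_def by blast
  have "(\<Sum>B \<in> {B. B \<subseteq># M \<and> size B = n}. schur la (M - B)) = int (block_count (row m) ?th ?al)"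
    by (rule sum_schur_eq_block_count_below_row[OF la m N])
  also have "\<dots> = (\<Sum>nu \<in> subdiagrams ?th. int (lr (row m) nu ?th * block_count {} nu ?al))"
    unfolding block_count_rect[OF young_row_diagram] by simp
  also have "\<dots> = (\<Sum>nu \<in> subdiagrams ?th. if hstrip nu ?th m then schur nu M else 0)"
  proof (rule sum.cong)
    fix nu assume "nu \<in> subdiagrams ?th"
    then have nu: "young_diagram nu" unfolding subdiagrams_def by auto
    show "int (lr (row m) nu ?th * block_count {} nu ?al) = (if hstrip nu ?th m then schur nu M else 0)"
      unfolding lr_commute[OF young_row_diagram nu] lr_row[OF nu] schur_eq_block_count[OF nu N] by simp
  qed simp
  also have "\<dots> = (\<Sum>nu \<in> {nu. hstrip la nu n}. schur nu M)"
    unfolding set using fin by (simp add: sum.inter_filter)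
  finally show ?thesis .
qed

section \<open>Products of Schur functions\<close>

lemma sum_pairs_eq_submultisets:
  fixes F :: "nat multiset \<Rightarrow> nat multiset \<Rightarrow> int"
  shows "(\<Sum>(A, B) \<in> {(A, B). A + B = M}. F A B) = (\<Sum>B \<in> {B. B \<subseteq># M}. F (M - B) B)"
  by (rule sum.reindex_bij_witness[where i = "\<lambda>B. (M - B, B)" and j = snd]) auto

lemma finite_multiset_pairs: "finite {(A, B). A + B = (M :: nat multiset)}"
proof -
  have "{(A, B). A + B = M} \<subseteq> (\<lambda>B. (M - B, B)) ` {B. B \<subseteq># M}" by force
  then show ?thesis using finite_submultisets finite_subset by blast
qed

lemma series_mult_assoc: "series_mult (series_mult f g) h = series_mult f (series_mult g h)"
proof
  fix M
  let ?P = "\<lambda>M :: nat multiset. {(A, B). A + B = M}"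
  have "series_mult (series_mult f g) h M =
      (\<Sum>(X, C) \<in> ?P M. \<Sum>(A, B) \<in> ?P X. f A * g B * h C)"
    unfolding series_mult_def by (simp add: sum_distrib_right case_prod_beta)
  also have "\<dots> = (\<Sum>(p, q) \<in> Sigma (?P M) (\<lambda>p. ?P (fst p)). f (fst q) * g (snd q) * h (snd p))"
    using finite_multiset_pairs by (subst sum.Sigma[symmetric]) (auto simp: case_prod_beta)
  also have "\<dots> = (\<Sum>(p, q) \<in> Sigma (?P M) (\<lambda>p. ?P (snd p)). f (fst p) * (g (fst q) * h (snd q)))"
    by (rule sum.reindex_bij_witness[where
          i = "\<lambda>(p, q). ((fst p + fst q, snd q), (fst p, fst q))" and
          j = "\<lambda>(p, q). ((fst q, snd q + snd p), (snd q, snd p))"])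
      (auto simp: add.assoc mult.assoc)
  also have "\<dots> = (\<Sum>(A, X) \<in> ?P M. \<Sum>(B, C) \<in> ?P X. f A * (g B * h C))"
    using finite_multiset_pairs by (subst sum.Sigma[symmetric]) (auto simp: case_prod_beta)
  also have "\<dots> = series_mult f (series_mult g h) M"
    unfolding series_mult_def by (simp add: sum_distrib_left case_prod_beta)
  finally show "series_mult (series_mult f g) h M = series_mult f (series_mult g h) M" .
qed

lemma series_mult_sum_right:
  "series_mult f (\<lambda>M. \<Sum>x\<in>S. g x M) M = (\<Sum>x\<in>S. series_mult f (g x) M)"
  unfolding series_mult_def sum_distrib_left case_prod_beta by (rule sum.swap)

lemma series_mult_sum_left:
  "series_mult (\<lambda>M. \<Sum>x\<in>S. c x * g x M) f M = (\<Sum>x\<in>S. c x * series_mult (g x) f M)"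
  unfolding series_mult_def sum_distrib_left sum_distrib_right case_prod_beta
  by (subst sum.swap) (simp add: mult.assoc)

lemma schur_empty: "schur {} M = (if M = {#} then 1 else 0)"
proof -
  have "semistandard_tableaux {} = {\<lambda>_. undefined}" by (auto simp: semistandard_tableaux_def)
  then have "tableaux_of_weight {} M = (if M = {#} then {\<lambda>_. undefined} else {})" by auto
  then show ?thesis unfolding schur_def by simp
qed

text \<open>\<open>pieri_sum\<close> for the empty shape, whose only horizontal strip of size
  \<open>n\<close> is \<open>row n\<close>.\<close>

lemma schur_row: "schur (row n) M = (if size M = n then 1 else 0)"
proof -
  have "schur (row n) M = (\<Sum>nu \<in> {nu. hstrip {} nu n}. schur nu M)" by (simp add: hstrip_empty_iff)
  also have "\<dots> = (\<Sum>B \<in> {B. B \<subseteq># M \<and> size B = n}. schur {} (M - B))"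
    by (rule pieri_sum[symmetric]) simp
  also have "\<dots> = (\<Sum>B \<in> {B. B \<subseteq># M \<and> size B = n}. if B = M then 1 else 0)"
    by (rule sum.cong) (auto simp: schur_empty Diff_eq_empty_iff_mset subset_mset.antisym_conv)
  also have "\<dots> = (if size M = n then 1 else 0)"
    using finite_subset[OF _ finite_submultisets[of M], of "{B. B \<subseteq># M \<and> size B = n}"] by (subst sum.delta) auto
  finally show ?thesis .
qed

theorem pieri:
  assumes "young_diagram la"
  shows "series_mult (schur la) (schur (row n)) = (\<lambda>M. \<Sum>nu \<in> {nu. hstrip la nu n}. schur nu M)"
proof
  fix M
  have "series_mult (schur la) (schur (row n)) M = (\<Sum>B \<in> {B. B \<subseteq># M}. schur la (M - B) * schur (row n) B)"
    unfolding series_mult_def by (rule sum_pairs_eq_submultisets)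
  also have "\<dots> = (\<Sum>B \<in> {B. B \<subseteq># M}. if size B = n then schur la (M - B) else 0)"
    by (rule sum.cong) (auto simp: schur_row)
  also have "\<dots> = (\<Sum>B \<in> {B. B \<subseteq># M \<and> size B = n}. schur la (M - B))"
    using sum.inter_filter[OF finite_submultisets[of M], of "\<lambda>B. schur la (M - B)" "\<lambda>B. size B = n"] by simp
  also have "\<dots> = (\<Sum>nu \<in> {nu. hstrip la nu n}. schur nu M)" by (rule pieri_sum[OF assms])
  finally show "series_mult (schur la) (schur (row n)) M = (\<Sum>nu \<in> {nu. hstrip la nu n}. schur nu M)" .
qed

definition strip_word :: "diagram \<Rightarrow> diagram \<Rightarrow> int list" where
  "strip_word D E = (SOME w. path D w E \<and> sorted_wrt (<) w)"

lemma strip_word: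
  assumes "hstrip D E n"
  shows "path D (strip_word D E) E" "sorted_wrt (<) (strip_word D E)" "length (strip_word D E) = n"
proof -
  have "path D (strip_word D E) E \<and> sorted_wrt (<) (strip_word D E)"
    unfolding strip_word_def using hstrip_increasing_path[OF assms] by (intro someI_ex[where P = "\<lambda>w. path D w E \<and> sorted_wrt (<) w"]) blast
  then show "path D (strip_word D E) E" "sorted_wrt (<) (strip_word D E)" "length (strip_word D E) = n"
    using path_card[of D "strip_word D E" E] assms unfolding hstrip_def by auto
qed

lemma strip_word_eq: "path D w E \<Longrightarrow> sorted_wrt (<) w \<Longrightarrow> strip_word D E = w"
  using strip_word hstrip_iff increasing_path_unique by metis

text \<open>What \<open>std_word la\<close> has become after passing \<open>u\<close> is a chain
  that starts at \<open>mu\<close>. Switching \<open>v\<close> past this chain yields the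
  continuation \<open>w\<close>.\<close>

lemma rect_append:
  assumes "path la (u @ v) nu" "path {} (rect la u) mu"
  obtains w where "rect la (u @ v) = rect la u @ w" "ascents w = ascents v" "length w = length v"
    "\<exists>E. path mu w E"
proof -
  obtain ka where ka: "path la u ka" "path ka v nu" using assms(1) unfolding path_append by blast
  have std: "path {} (std_word la) la" using ka path_young path_std_word by blast
  obtain A where A: "switch (std_word la) u = (rect la u, A)" unfolding rect_def by (metis prod.collapse)
  obtain w A' where w: "switch A v = (w, A')" by fastforce
  have e: "rect la (u @ v) = rect la u @ w" using switch_append2[OF A w] unfolding rect_def by simp
  have "path {} (std_word la @ u) ka" using std ka(1) unfolding path_append by blast
  then have "path mu A ka" using path_switch[OF A] assms(2) path_det unfolding path_append by metis
  then have p: "path mu (A @ v) nu" using ka(2) unfolding path_append by blast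
  have "\<exists>E. path mu w E" using path_switch[OF w p] unfolding path_append by blast
  then show ?thesis using that e ascents_switch[OF p w] switch_length[OF w] by blast
qed

text \<open>Both sides count the words from \<open>la\<close> to \<open>nu\<close> whose
  rectification consists of \<open>std_word mu\<close> and \<open>n\<close> increasing letters.
  Since ascents are preserved, this increasing part can be cut off after rectification, giving
  \<open>mu'\<close>, or before it, giving \<open>ka\<close>.\<close>

lemma lr_pieri:
  assumes la: "young_diagram la" and mu: "young_diagram mu"
  shows "(\<Sum>mu' \<in> {mu'. hstrip mu mu' n}. lr la mu' nu) =
    (\<Sum>ka \<in> inner_strips nu n. lr la mu ka)"
proof (cases "young_diagram nu")
  case nu: True
  let ?T = "\<lambda>mu'. std_word mu @ strip_word mu mu'"
  let ?H = "{mu'. hstrip mu mu' n}"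
  let ?K = "inner_strips nu n"
  have std: "path {} (std_word mu) mu" using path_std_word mu by blast
  have T: "path {} (?T mu') mu'" if "mu' \<in> ?H" for mu'
    using that std strip_word(1) unfolding path_append by blast
  have "(\<Sum>mu' \<in> ?H. lr la mu' nu) = (\<Sum>mu' \<in> ?H. card {S \<in> paths la nu. rect la S = ?T mu'})"
    using lr_eq_card_rect[OF la T] by (intro sum.cong) auto
  also have "\<dots> = card (\<Union>mu' \<in> ?H. {S \<in> paths la nu. rect la S = ?T mu'})"
  proof (rule card_UN_disjoint[symmetric, OF finite_hstrips[OF mu]])
    show "\<forall>mu'\<in>?H. finite {S \<in> paths la nu. rect la S = ?T mu'}" using finite_paths by auto
    show "\<forall>x\<in>?H. \<forall>y\<in>?H. x \<noteq> y \<longrightarrow> {S \<in> paths la nu. rect la S = ?T x} \<inter> {S \<in> paths la nu. rect la S = ?T y} = {}"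
    proof (intro ballI impI)
      fix x y assume "x \<in> ?H" "y \<in> ?H" "x \<noteq> y"
      then have "?T x \<noteq> ?T y" using T path_det by metis
      then show "{S \<in> paths la nu. rect la S = ?T x} \<inter> {S \<in> paths la nu. rect la S = ?T y} = {}" by auto
    qed
  qed
  also have "(\<Union>mu' \<in> ?H. {S \<in> paths la nu. rect la S = ?T mu'}) =
      (\<lambda>(ka, u). u @ strip_word ka nu) ` (SIGMA ka : ?K. {u \<in> paths la ka. rect la u = std_word mu})" (is "?L = ?f ` ?X")
  proof
    show "?L \<subseteq> ?f ` ?X"
    proof
      fix S assume "S \<in> ?L"
      then obtain mu' where S: "hstrip mu mu' n" "path la S nu" "rect la S = ?T mu'" unfolding paths_def by auto
      define u v where "u = take (length (std_word mu)) S" "v = drop (length (std_word mu)) S"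
      have Suv: "S = u @ v" unfolding u_v_def by simp
      have "length S = length (?T mu')"
        using path_rect[OF S(2)] S(3) by metis
      then have lu: "length u = length (std_word mu)" unfolding u_v_def by simp
      obtain ka where ka: "path la u ka" "path ka v nu" using S(2)[unfolded Suv path_append] by blast
      from path_rect[OF ka(1)] obtain mu1 where mu1: "path {} (rect la u) mu1" "length (rect la u) = length u" by metis
      from rect_append[OF S(2)[unfolded Suv] mu1(1)] obtain w
        where w: "rect la (u @ v) = rect la u @ w" "ascents w = ascents v" "length w = length v" by metis
      have "rect la u @ w = std_word mu @ strip_word mu mu'" using w(1) S(3) Suv by simp
      then have 1: "rect la u = std_word mu" "w = strip_word mu mu'" using mu1(2) lu by auto
      then have "sorted_wrt (<) v" "length v = n" using w(2,3) strip_word(2,3)[OF S(1)] by (simp_all add: sorted_wrt_ascents)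
      then have "hstrip ka nu n" "v = strip_word ka nu" using ka(2) hstrip_iff strip_word_eq by metis+
      moreover have "ka \<in> subdiagrams nu" using paths_mid_subdiagrams ka by blast
      ultimately show "S \<in> ?f ` ?X" using Suv ka(1) 1(1) by (intro image_eqI[of _ _ "(ka, u)"]) (auto simp: paths_def)
    qed
    show "?f ` ?X \<subseteq> ?L"
    proof (rule image_subsetI)
      fix x assume "x \<in> ?X"
      then obtain ka u where x: "x = (ka, u)" "hstrip ka nu n" "path la u ka" "rect la u = std_word mu"
        unfolding paths_def by auto
      have p: "path la (u @ strip_word ka nu) nu" using x(3) strip_word(1)[OF x(2)] unfolding path_append by blast
      from rect_append[OF p, of mu] x(4) std obtain w E
        where w: "rect la (u @ strip_word ka nu) = std_word mu @ w" "ascents w = ascents (strip_word ka nu)"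
          "length w = length (strip_word ka nu)" "path mu w E" by metis
      then have "sorted_wrt (<) w" "length w = n" using strip_word(2,3)[OF x(2)] by (simp_all add: sorted_wrt_ascents)
      then have "hstrip mu E n" "w = strip_word mu E" using w(4) hstrip_iff strip_word_eq by metis+
      then show "?f x \<in> ?L" using p w(1) x(1) unfolding paths_def by auto
    qed
  qed
  also have "card (?f ` ?X) = card ?X"
  proof (rule card_image, rule inj_onI)
    fix x y assume h: "x \<in> ?X" "y \<in> ?X" "?f x = ?f y"
    obtain ka u ka' u' where xy: "x = (ka, u)" "y = (ka', u')" by (cases x; cases y)
    have 1: "path la u ka" "path la u' ka'" "rect la u = rect la u'" using h(1,2) xy unfolding paths_def by auto
    then have "length u = length u'" using path_rect[OF 1(1)] path_rect[OF 1(2)] by metis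
    then have "u = u'" using h(3) xy by auto
    then show "x = y" using 1(1,2) path_det xy by blast
  qed
  also have "card ?X = (\<Sum>ka \<in> ?K. lr la mu ka)"
    unfolding lr_def using finite_subdiagrams[OF young_finite[OF nu]] finite_paths by (subst card_SigmaI) auto
  finally show ?thesis .
next
  case False
  then have "paths la nu = {}" unfolding paths_def using path_young by auto
  then have "lr la mu' nu = 0" for mu' unfolding lr_def by simp
  moreover have "inner_strips nu n = {}" using False unfolding hstrip_def by auto
  ultimately show ?thesis by (simp only: sum.empty) simp
qed

section \<open>Expansion of a product of Schur functions by induction on the second factor\<close>

definition diagrams_of_size :: "nat \<Rightarrow> diagram set" where
  "diagrams_of_size n = {D. young_diagram D \<and> card D = n}"

lemma finite_diagrams_of_size: "finite (diagrams_of_size n)"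
proof -
  have "D \<subseteq> {..<n} \<times> {..<n}" if D: "D \<in> diagrams_of_size n" for D
  proof (clarify)
    fix i j assume ij: "(i, j) \<in> D"
    have y: "young_diagram D" "card D = n" using D unfolding diagrams_of_size_def by auto
    have "{0..i} \<times> {j} \<subseteq> D" "{i} \<times> {0..j} \<subseteq> D" using young_down[OF y(1) ij] by auto
    then have "card ({0..i} \<times> {j}) \<le> n" "card ({i} \<times> {0..j}) \<le> n"
      using card_mono[OF young_finite[OF y(1)]] y(2) by blast+
    then show "i \<in> {..<n} \<and> j \<in> {..<n}" by (simp add: card_cartesian_product)
  qed
  then have "diagrams_of_size n \<subseteq> Pow ({..<n} \<times> {..<n})" by blast
  then show ?thesis by (rule finite_subset) simp
qed

lemma last_row_exists:
  assumes "young_diagram mu" "mu \<noteq> {}"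
  obtains r where "\<And>i j. (i, j) \<in> mu \<Longrightarrow> i \<le> r" "\<exists>j. (r, j) \<in> mu"
proof -
  have f: "finite (fst ` mu)" "fst ` mu \<noteq> {}" using assms young_finite by auto
  have "(i, j) \<in> mu \<Longrightarrow> i \<le> Max (fst ` mu)" for i j using f(1) by (intro Max_ge) force+
  moreover have "\<exists>j. (Max (fst ` mu), j) \<in> mu" using Max_in[OF f] by force
  ultimately show ?thesis using that by blast
qed

text \<open>
  If \<open>mu0\<close> is \<open>mu\<close> without its last row, of length \<open>n\<close>, then by Pieri's rule \<open>schur mu\<close> is
  \<open>schur mu0 * schur (row n)\<close> minus Schur functions of shapes whose boxes lie higher up.
\<close>

theorem schur_product:
  assumes "young_diagram la" "young_diagram mu"
  shows "series_mult (schur la) (schur mu) M =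
    (\<Sum>nu \<in> diagrams_of_size (card la + card mu). int (lr la mu nu) * schur nu M)"
  using assms(2)
proof (induction mu arbitrary: M rule: wf_induct_rule[OF wf_measures[of "[card, \<lambda>D. \<Sum>p\<in>D. fst p]"]])
  case (1 mu)
  note y = \<open>young_diagram mu\<close>
  show ?case
  proof (cases "mu = {}")
    case True
    have r: "mu = row 0" unfolding True row_def by simp
    have "series_mult (schur la) (schur mu) M = (\<Sum>nu \<in> {nu. hstrip la nu 0}. schur nu M)"
      unfolding r pieri[OF assms(1)] ..
    also have "\<dots> = (\<Sum>nu \<in> {nu \<in> diagrams_of_size (card la). hstrip la nu 0}. schur nu M)"
      by (rule sum.cong) (auto simp: diagrams_of_size_def hstrip_def)
    also have "\<dots> = (\<Sum>nu \<in> diagrams_of_size (card la). if hstrip la nu 0 then schur nu M else 0)"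
      using finite_diagrams_of_size by (simp add: sum.inter_filter)
    also have "\<dots> = (\<Sum>nu \<in> diagrams_of_size (card la). int (lr la mu nu) * schur nu M)"
      unfolding r lr_row[OF assms(1)] by (rule sum.cong) auto
    finally show ?thesis unfolding True by simp
  next
    case False
    from last_row_exists[OF y False] obtain r where
      r: "\<And>i j. (i, j) \<in> mu \<Longrightarrow> i \<le> r" "\<exists>j. (r, j) \<in> mu" by blast
    define mu0 where "mu0 = {p \<in> mu. fst p < r}"
    define n where "n = card (mu - mu0)"
    let ?H = "{mu'. hstrip mu0 mu' n}"
    let ?Y = "diagrams_of_size (card la + card mu)"
    have sub: "mu0 \<subseteq> mu" "finite mu" unfolding mu0_def using young_finite[OF y] by auto
    have y0: "young_diagram mu0"
      unfolding young_diagram_def mu0_def using young_down[OF y] sub(2) by fastforce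
    have cmu: "card mu = card mu0 + n"
      unfolding n_def using sub card_mono[OF sub(2,1)] by (simp add: card_Diff_subset finite_subset)
    have "n \<noteq> 0" using r(2) sub unfolding n_def mu0_def by auto
    have "(i, j) \<in> mu0" if "(Suc i, j) \<in> mu" for i j
      using r(1)[OF that] young_down[OF y that, of i j] unfolding mu0_def by auto
    then have mu: "mu \<in> ?H" using y y0 sub cmu unfolding hstrip_def by auto
    \<comment> \<open>All shapes in \<open>?H\<close> have as many boxes as \<open>mu\<close>, so
      the second measure has to decrease. No new box lies below row \<open>r\<close>, and if all of
      them lay in row \<open>r\<close>, the shape would be \<open>mu\<close> itself; hence some new
      box lies higher up.\<close>
    have smaller: "(mu', mu) \<in> measures [card, \<lambda>D. \<Sum>p\<in>D. fst p]" if h: "mu' \<in> ?H - {mu}" for mu'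
    proof -
      have mu': "young_diagram mu'" "mu0 \<subseteq> mu'" "card mu' = card mu"
        "\<And>i j. (Suc i, j) \<in> mu' \<Longrightarrow> (i, j) \<in> mu0" "mu' \<noteq> mu"
        using h cmu unfolding hstrip_def by auto
      have f: "finite mu'" "finite mu0" using mu' y0 young_finite by auto
      have le: "fst p \<le> r" if "p \<in> mu'" for p
        using mu'(4) that by (cases p; cases "fst p") (fastforce simp: mu0_def)+
      have c: "card (mu' - mu0) = n" using mu'(2,3) cmu f by (simp add: card_Diff_subset)
      have "\<exists>p\<in>mu' - mu0. fst p < r"
      proof (rule ccontr)
        assume "\<not> ?thesis"
        then have a: "\<And>p. p \<in> mu' - mu0 \<Longrightarrow> fst p = r" using le by (metis DiffD1 linorder_neqE_nat not_less)
        have b: "\<And>p. p \<in> mu - mu0 \<Longrightarrow> fst p = r" using r(1) unfolding mu0_def by force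
        have nr: "\<And>p. p \<in> mu0 \<Longrightarrow> fst p \<noteq> r" unfolding mu0_def by auto
        have 1: "{p \<in> mu'. fst p = r} = mu' - mu0" using a nr by auto
        have 2: "{p \<in> mu. fst p = r} = mu - mu0" using b nr by auto
        have "mu' - mu0 = mu - mu0"
          using young_row[OF mu'(1), of r] young_row[OF y, of r] unfolding 1 2 c n_def[symmetric] by simp
        then show False using mu'(2,5) sub(1) by blast
      qed
      then have "(\<Sum>p\<in>mu' - mu0. fst p) < (\<Sum>p\<in>mu' - mu0. r)"
        using f le by (intro sum_strict_mono_ex1) auto
      also have "\<dots> = (\<Sum>p\<in>mu - mu0. r)" using c n_def by simp
      also have "\<dots> = (\<Sum>p\<in>mu - mu0. fst p)"
        using r(1) by (intro sum.cong) (force simp: mu0_def)+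
      finally have "(\<Sum>p\<in>mu'. fst p) < (\<Sum>p\<in>mu. fst p)"
        using sum.subset_diff[OF mu'(2) f(1), of fst] sum.subset_diff[OF sub, of fst] by simp
      then show ?thesis using mu'(3) by simp
    qed
    have smaller0: "(mu0, mu) \<in> measures [card, \<lambda>D. \<Sum>p\<in>D. fst p]" using cmu \<open>n \<noteq> 0\<close> by simp
    have fH: "finite ?H" by (rule finite_hstrips[OF y0])
    have fY: "finite ?Y" by (rule finite_diagrams_of_size)
    let ?s = "\<lambda>mu'. \<Sum>nu \<in> ?Y. int (lr la mu' nu) * schur nu M"
    have IH: "series_mult (schur la) (schur mu') M = ?s mu'" if "mu' \<in> ?H - {mu}" for mu'
      using 1(1)[OF smaller[OF that]] that cmu unfolding hstrip_def by auto
    have IH0: "series_mult (schur la) (schur mu0) =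
        (\<lambda>M. \<Sum>ka \<in> diagrams_of_size (card la + card mu0). int (lr la mu0 ka) * schur ka M)"
      using 1(1)[OF smaller0 y0] by auto
    \<comment> \<open>Associativity with the row as third factor proves the claim for the sum over
      all of \<open>?H\<close>. The shapes other than \<open>mu\<close> are covered by the induction
      hypothesis and cancel at the end.\<close>
    have "(\<Sum>mu' \<in> ?H. series_mult (schur la) (schur mu') M) =
        series_mult (schur la) (\<lambda>M. \<Sum>mu' \<in> ?H. schur mu' M) M"
      by (rule series_mult_sum_right[symmetric])
    also have "\<dots> = series_mult (series_mult (schur la) (schur mu0)) (schur (row n)) M"
      unfolding series_mult_assoc pieri[OF y0] ..
    also have "\<dots> = (\<Sum>ka \<in> diagrams_of_size (card la + card mu0). int (lr la mu0 ka) *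
        series_mult (schur ka) (schur (row n)) M)"
      unfolding IH0 by (rule series_mult_sum_left)
    also have "\<dots> = (\<Sum>ka \<in> diagrams_of_size (card la + card mu0). int (lr la mu0 ka) *
        (\<Sum>nu \<in> ?Y. if hstrip ka nu n then schur nu M else 0))"
    proof (rule sum.cong[OF refl])
      fix ka assume "ka \<in> diagrams_of_size (card la + card mu0)"
      then have ka: "young_diagram ka" "card ka + n = card la + card mu" unfolding diagrams_of_size_def using cmu by auto
      have "{nu. hstrip ka nu n} = {nu \<in> ?Y. hstrip ka nu n}"
        using ka(2) unfolding hstrip_def diagrams_of_size_def by auto
      then show "int (lr la mu0 ka) * series_mult (schur ka) (schur (row n)) M =
          int (lr la mu0 ka) * (\<Sum>nu \<in> ?Y. if hstrip ka nu n then schur nu M else 0)"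
        unfolding pieri[OF ka(1)] using sum.inter_filter[OF fY, of "\<lambda>nu. schur nu M"] by simp
    qed
    also have "\<dots> = (\<Sum>nu \<in> ?Y. \<Sum>ka \<in> diagrams_of_size (card la + card mu0).
        if hstrip ka nu n then int (lr la mu0 ka) * schur nu M else 0)"
      unfolding sum_distrib_left by (subst sum.swap) (simp add: if_distrib cong: if_cong)
    also have "\<dots> = (\<Sum>nu \<in> ?Y. \<Sum>ka \<in> inner_strips nu n. int (lr la mu0 ka) * schur nu M)"
    proof (rule sum.cong[OF refl])
      fix nu assume "nu \<in> ?Y"
      then have eq: "{ka \<in> diagrams_of_size (card la + card mu0). hstrip ka nu n} = inner_strips nu n"
        using cmu unfolding hstrip_def diagrams_of_size_def subdiagrams_def by auto
      show "(\<Sum>ka \<in> diagrams_of_size (card la + card mu0).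
          if hstrip ka nu n then int (lr la mu0 ka) * schur nu M else 0) =
          (\<Sum>ka \<in> inner_strips nu n. int (lr la mu0 ka) * schur nu M)"
        unfolding eq[symmetric] by (rule sum.inter_filter[symmetric, OF finite_diagrams_of_size])
    qed
    also have "\<dots> = (\<Sum>nu \<in> ?Y. int (\<Sum>mu' \<in> ?H. lr la mu' nu) * schur nu M)"
      unfolding lr_pieri[OF assms(1) y0] by (simp add: sum_distrib_right)
    also have "\<dots> = (\<Sum>mu' \<in> ?H. ?s mu')"
      unfolding of_nat_sum sum_distrib_right by (rule sum.swap)
    finally have "(\<Sum>mu' \<in> ?H. series_mult (schur la) (schur mu') M) = (\<Sum>mu' \<in> ?H. ?s mu')" .
    moreover have "(\<Sum>mu' \<in> ?H - {mu}. series_mult (schur la) (schur mu') M) = (\<Sum>mu' \<in> ?H - {mu}. ?s mu')"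
      using IH by (rule sum.cong[OF refl])
    ultimately show ?thesis using sum.remove[OF fH mu] by (metis (no_types, lifting) add_right_cancel)
  qed
qed

lemma LR_coefficient_eq_lr:
  assumes "young_diagram la" "young_diagram mu" "young_diagram (rotated_complement l k nu)"
  shows "LR_coefficient l k la mu nu = int (lr la mu (rotated_complement l k nu))"
proof -
  let ?Y = "diagrams_of_size (card la + card mu)"
  let ?c = "\<lambda>D. if young_diagram D then int (lr la mu D) else 0"
  have sub: "{D. ?c D \<noteq> 0} \<subseteq> ?Y"
    using lr_eq_0_card[OF _ assms(2)] unfolding diagrams_of_size_def by auto
  have "schur_expansion (series_mult (schur la) (schur mu)) ?c"
    unfolding schur_expansion_def
  proof (intro conjI allI impI)
    show "finite {D. ?c D \<noteq> 0}" using sub finite_diagrams_of_size finite_subset by blast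
    show "young_diagram D" if "?c D \<noteq> 0" for D using that by (auto split: if_splits)
    fix M
    have "series_mult (schur la) (schur mu) M = (\<Sum>D \<in> ?Y. int (lr la mu D) * schur D M)"
      by (rule schur_product[OF assms(1,2)])
    also have "\<dots> = (\<Sum>D \<in> ?Y. ?c D * schur D M)"
      by (rule sum.cong) (auto simp: diagrams_of_size_def)
    also have "\<dots> = (\<Sum>D \<in> {D. ?c D \<noteq> 0}. ?c D * schur D M)"
      by (rule sum.mono_neutral_right[OF finite_diagrams_of_size sub]) auto
    finally show "series_mult (schur la) (schur mu) M = (\<Sum>D \<in> {D. ?c D \<noteq> 0}. ?c D * schur D M)" .
  qed
  then show ?thesis unfolding LR_coefficient_def using schur_coeff_eqI assms(3) by simp
qed

section \<open>Complements in a rectangle\<close>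

lemma young_rectangle [simp]: "young_diagram (rectangle l k)"
  unfolding young_diagram_def rectangle_def by auto

lemma finite_rectangle [simp]: "finite (rectangle l k)"
  unfolding rectangle_def by simp

lemma mem_rotated_complement:
  "(i, j) \<in> rotated_complement l k D \<longleftrightarrow> i < l \<and> j < k \<and> (l - 1 - i, k - 1 - j) \<notin> D"
proof
  assume "(i, j) \<in> rotated_complement l k D"
  then obtain a b where "a < l" "b < k" "(a, b) \<notin> D" "i = l - 1 - a" "j = k - 1 - b"
    unfolding rotated_complement_def rectangle_def by auto
  moreover from this have "l - 1 - i = a" "k - 1 - j = b" by auto
  ultimately show "i < l \<and> j < k \<and> (l - 1 - i, k - 1 - j) \<notin> D" by auto
next
  assume h: "i < l \<and> j < k \<and> (l - 1 - i, k - 1 - j) \<notin> D"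
  then show "(i, j) \<in> rotated_complement l k D"
    unfolding rotated_complement_def rectangle_def by (intro image_eqI[of _ _ "(l - 1 - i, k - 1 - j)"]) auto
qed

lemma rotated_complement_subset: "rotated_complement l k D \<subseteq> rectangle l k"
  unfolding rectangle_def by (auto simp: mem_rotated_complement)

lemma young_rotated_complement: "young_diagram D \<Longrightarrow> young_diagram (rotated_complement l k D)"
proof -
  assume y: "young_diagram D"
  show ?thesis
    unfolding young_diagram_def
  proof (intro conjI allI impI)
    show "finite (rotated_complement l k D)"
      using finite_subset[OF rotated_complement_subset finite_rectangle] .
    fix i j i' j' assume h: "(i, j) \<in> rotated_complement l k D" "i' \<le> i" "j' \<le> j"
    have "l - 1 - i \<le> l - 1 - i'" "k - 1 - j \<le> k - 1 - j'" using h by simp_all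
    then show "(i', j') \<in> rotated_complement l k D"
      using h young_down[OF y, of "l - 1 - i'" "k - 1 - j'" "l - 1 - i" "k - 1 - j"]
      unfolding mem_rotated_complement by auto
  qed
qed

lemma rotated_complement_involution:
  "D \<subseteq> rectangle l k \<Longrightarrow> rotated_complement l k (rotated_complement l k D) = D"
  unfolding rectangle_def by (rule set_eqI) (auto simp: mem_rotated_complement)

lemma rotated_complement_rectangle: "rotated_complement l k (rectangle l k) = {}"
  unfolding rotated_complement_def by simp

lemma rotated_complement_empty: "rotated_complement l k {} = rectangle l k"
  unfolding rectangle_def by (rule set_eqI) (auto simp: mem_rotated_complement)

lemma path_rotate_word:
  "path D w E \<Longrightarrow> E \<subseteq> rectangle l k \<Longrightarrow>
    path (rotated_complement l k E) (rotate_word (int k - int l) w) (rotated_complement l k D)"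
proof (induction w arbitrary: D)
  case Nil
  then show ?case using young_rotated_complement[of D l k] by (auto simp: rotate_word_def)
next
  case (Cons c w)
  obtain M where M: "add_box D c M" "path M w E" using Cons.prems(1) by auto
  have sub: "M \<subseteq> rectangle l k" using path_subset[OF M(2)] Cons.prems(2) by blast
  obtain i j where ij: "(i, j) \<notin> D" "M = insert (i, j) D" "int j - int i = c"
    using M(1) by (auto simp: add_box_def)
  have lk: "i < l" "j < k" using sub ij(2) by (auto simp: rectangle_def)
  let ?p = "(l - 1 - i, k - 1 - j)"
  have "?p \<notin> rotated_complement l k M" using ij(2) lk by (auto simp: mem_rotated_complement)
  moreover have "rotated_complement l k D = insert ?p (rotated_complement l k M)"
  proof (rule set_eqI)
    fix q show "q \<in> rotated_complement l k D \<longleftrightarrow> q \<in> insert ?p (rotated_complement l k M)"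
      using ij(1,2) lk by (cases q) (auto simp: mem_rotated_complement)
  qed
  moreover have "int (k - 1 - j) - int (l - 1 - i) = int k - int l - c" using ij(3) lk by auto
  ultimately have "add_box (rotated_complement l k M) (int k - int l - c) (rotated_complement l k D)"
    using M(1) unfolding add_box_def by (blast intro: young_rotated_complement)
  moreover have r: "rotate_word (int k - int l) (c # w) = rotate_word (int k - int l) w @ [int k - int l - c]"
    by (simp add: rotate_word_def)
  ultimately show ?case using Cons.IH[OF M(2) Cons.prems(2)] unfolding r path_append path_single by blast
qed

lemma sorted_wrt_rotate_word: "sorted_wrt (<) (rotate_word n w) \<longleftrightarrow> sorted_wrt (<) w"
  unfolding rotate_word_def by (simp add: sorted_wrt_rev sorted_wrt_map)

lemma increasing_blocks_rotate_word:
  "increasing_blocks al w \<Longrightarrow> increasing_blocks (rev al) (rotate_word n w)"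
proof (induction al arbitrary: w)
  case Nil
  then show ?case by (simp add: rotate_word_def)
next
  case (Cons m al)
  then obtain u v where uv: "w = u @ v" "length u = m" "sorted_wrt (<) u" "increasing_blocks al v" by auto
  have "increasing_blocks [m] (rotate_word n u)" using uv by (simp add: sorted_wrt_rotate_word)
  with Cons.IH[OF uv(4)] have "increasing_blocks (rev al @ [m]) (rotate_word n v @ rotate_word n u)"
    by (subst increasing_blocks_append) blast
  then show ?case unfolding uv(1) rev.simps rotate_word_append .
qed

text \<open>Rotating the chains yields the weight in reverse order, and
  \<open>block_count_rev\<close> restores it.\<close>

lemma block_count_rotated_complement:
  assumes "D \<subseteq> rectangle l k"
  shows "block_count D (rectangle l k) al = block_count {} (rotated_complement l k D) al"
proof -
  let ?r = "rotate_word (int k - int l)"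
  have *: "?r w \<in> block_words {} (rotated_complement l k D) (rev al)"
    if "w \<in> block_words D (rectangle l k) al" for w
    using that path_rotate_word[of D w "rectangle l k" l k] increasing_blocks_rotate_word[of al w]
    unfolding paths_def rotated_complement_rectangle by auto
  have **: "?r w \<in> block_words D (rectangle l k) al"
    if "w \<in> block_words {} (rotated_complement l k D) (rev al)" for w
    using that path_rotate_word[of "{}" w "rotated_complement l k D" l k] increasing_blocks_rotate_word[of "rev al" w]
      rotated_complement_subset[of l k D]
    unfolding paths_def rotated_complement_empty rotated_complement_involution[OF assms] by auto
  have "bij_betw ?r (block_words D (rectangle l k) al)
      (block_words {} (rotated_complement l k D) (rev al))"
    by (rule bij_betw_byWitness[where f' = ?r]) (use * ** in auto)
  then have "block_count D (rectangle l k) al = block_count {} (rotated_complement l k D) (rev al)"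
    unfolding block_count_def by (rule bij_betw_same_card)
  then show ?thesis unfolding block_count_rev .
qed

text \<open>The generating function of the words from \<open>D\<close> to the rectangle is computed
  twice: rectification gives a combination with coefficients \<open>lr D t\<close>, rotation gives
  one Schur function. Independence equates the coefficients. Shapes outside the rectangle do not
  occur, as rectification ends inside it.\<close>

theorem lr_rectangle:
  assumes D: "young_diagram D" "D \<subseteq> rectangle l k" and tau: "young_diagram tau"
  shows "lr D tau (rectangle l k) = (if tau = rotated_complement l k D then 1 else 0)"
proof -
  let ?U = "subdiagrams (rectangle l k)"
  let ?d = "\<lambda>t. int (lr D t (rectangle l k)) - (if t = rotated_complement l k D then 1 else 0)"
  have fin: "finite ?U" by (simp add: finite_subdiagrams)
  have rc: "rotated_complement l k D \<in> ?U"
    unfolding subdiagrams_def using young_rotated_complement[OF D(1)] rotated_complement_subset by auto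
  have z: "(\<Sum>t\<in>?U. ?d t * schur t M) = 0" for M
  proof -
    obtain N where N: "set_mset M \<subseteq> {..<N}" using finite_nat_set_iff_bounded[of "set_mset M"] by auto
    let ?al = "map (count M) [0..<N]"
    have "(\<Sum>t\<in>?U. int (lr D t (rectangle l k)) * schur t M) =
        (\<Sum>t\<in>?U. int (lr D t (rectangle l k) * block_count {} t ?al))"
      by (rule sum.cong) (simp_all add: subdiagrams_def schur_eq_block_count[OF _ N])
    also have "\<dots> = int (block_count {} (rotated_complement l k D) ?al)"
      using block_count_rect[OF D(1), of "rectangle l k" ?al] block_count_rotated_complement[OF D(2), of ?al] by simp
    also have "\<dots> = schur (rotated_complement l k D) M"
      using schur_eq_block_count[OF young_rotated_complement[OF D(1)] N] by simp
    also have "\<dots> = (\<Sum>t\<in>?U. (if t = rotated_complement l k D then 1 else 0) * schur t M)"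
      using fin rc by (simp add: if_distrib[of "\<lambda>x. x * _"] cong: if_cong)
    finally show ?thesis unfolding left_diff_distrib sum_subtractf by simp
  qed
  show ?thesis
  proof (cases "tau \<in> ?U")
    case True
    from schur_independent[OF fin _ z True] show ?thesis by (auto simp: subdiagrams_def split: if_splits)
  next
    case False
    have "lr D tau (rectangle l k) = 0"
    proof (rule ccontr)
      assume "lr D tau (rectangle l k) \<noteq> 0"
      then have "{S \<in> paths D (rectangle l k). rect D S = std_word tau} \<noteq> {}"
        unfolding lr_def by (metis card.empty)
      then obtain S where S: "path D S (rectangle l k)" "rect D S = std_word tau" unfolding paths_def by auto
      from path_rect[OF S(1)] obtain mu where "path {} (std_word tau) mu" "mu \<in> ?U" using S(2) by metis
      then show False using False path_det[OF path_std_word[OF tau]] by blast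
    qed
    then show ?thesis using False rc by auto
  qed
qed

lemma path_rect_rectangle:
  assumes "path D S (rectangle l k)"
  shows "path {} (rect D S) (rotated_complement l k D)"
proof -
  have D: "young_diagram D" "D \<subseteq> rectangle l k" using assms path_young path_subset by auto
  from path_rect[OF assms] obtain mu where mu: "path {} (rect D S) mu" by blast
  have "S \<in> {X \<in> paths D (rectangle l k). rect D X = rect D S}" using assms unfolding paths_def by simp
  then have "lr D mu (rectangle l k) \<noteq> 0"
    unfolding lr_eq_card_rect[OF D(1) mu, symmetric]
    using finite_paths[of D "rectangle l k"] by (subst card_0_eq) auto
  then have "mu = rotated_complement l k D" using lr_rectangle[OF D, of mu] mu path_young by (auto split: if_splits)
  then show ?thesis using mu by simp
qed

lemma ex1_rect_rectangle:
  assumes "young_diagram D" "D \<subseteq> rectangle l k" "path {} T (rotated_complement l k D)"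
  shows "\<exists>!S. path D S (rectangle l k) \<and> rect D S = T"
proof -
  have "card {S \<in> paths D (rectangle l k). rect D S = T} = 1"
    using lr_eq_card_rect[OF assms(1,3)] lr_rectangle[OF assms(1,2) young_rotated_complement[OF assms(1)]] by simp
  then obtain S where "{S \<in> paths D (rectangle l k). rect D S = T} = {S}" by (auto simp: card_1_singleton_iff)
  then show ?thesis unfolding paths_def by (intro ex1I[of _ S]) auto
qed


section \<open>Evacuation and the hexagon\<close>

lemma path_eqI_prefix_shapes:
  assumes "length u = length v" "\<And>i. i \<le> length u \<Longrightarrow> \<exists>E. path {} (take i u) E \<and> path {} (take i v) E"
  shows "u = v"
proof (rule nth_equalityI[OF assms(1)])
  fix i assume i: "i < length u"
  obtain E where E: "path {} (take i u) E" "path {} (take i v) E" using assms(2)[of i] i by auto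
  obtain E' where "path {} (take (Suc i) u) E'" "path {} (take (Suc i) v) E'" using assms(2)[of "Suc i"] i by auto
  then have "path {} (take i u @ [u ! i]) E'" "path {} (take i v @ [v ! i]) E'"
    using i assms(1) by (simp_all add: take_Suc_conv_app_nth)
  then have "add_box E (u ! i) E'" "add_box E (v ! i) E'"
    using E path_det unfolding path_append path_single by blast+
  then show "u ! i = v ! i" by (rule add_box_content)
qed

lemma evac_append_rect:
  assumes "path {} A D" "path D S E"
  obtains X where "evac (A @ S) = evac (rect D S) @ X"
proof -
  obtain B' A' where s: "switch (evac A) S = (B', A')" by fastforce
  then have "B' = rect D S" using rect_eq[OF path_evac[OF assms(1)] assms(2)] by simp
  then show ?thesis using that evac_append[OF s] by simp
qed

text \<open>It suffices to compare the shapes after \<open>i\<close> letters. The first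
  \<open>i\<close> letters of \<open>evac W\<close> are the evacuation of the rectified last
  \<open>i\<close> letters of \<open>W\<close>, so by \<open>path_rect_rectangle\<close> their shape
  is the rotated complement of the shape \<open>M\<close> reached before those letters. Rotation
  gives the same shape directly.\<close>

lemma evac_rectangle:
  assumes W: "path {} W (rectangle l k)"
  shows "evac W = rotate_word (int k - int l) W"
proof (rule path_eqI_prefix_shapes)
  let ?r = "rotate_word (int k - int l)"
  show "length (evac W) = length (?r W)" by simp
  fix i assume "i \<le> length (evac W)"
  then have i: "i \<le> length W" by simp
  define A D where "A = take (length W - i) W" "D = drop (length W - i) W"
  have WD: "W = A @ D" "length D = i" using i unfolding A_D_def by auto
  obtain M where M: "path {} A M" "path M D (rectangle l k)" using W unfolding WD(1) path_append by blast
  obtain X where X: "evac W = evac (rect M D) @ X" using evac_append_rect[OF M] WD(1) by metis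
  have "length (rect M D) = i" using path_rect[OF M(2)] WD(2) by metis
  then have "take i (evac W) = evac (rect M D)" using X by simp
  moreover have "path {} (evac (rect M D)) (rotated_complement l k M)"
    by (rule path_evac[OF path_rect_rectangle[OF M(2)]])
  moreover have "take i (?r W) = ?r D" unfolding WD(1) rotate_word_append using WD(2) by simp
  moreover have "path {} (?r D) (rotated_complement l k M)"
    using path_rotate_word[OF M(2), of l k] unfolding rotated_complement_rectangle by simp
  ultimately show "\<exists>E. path {} (take i (evac W)) E \<and> path {} (take i (?r W)) E" by metis
qed

text \<open>Putting a straight chain of \<open>D\<close> in front of \<open>S\<close> gives a chain
  of the full rectangle. For it evacuation is rotation, and the prefix of length
  \<open>length S\<close> is the claim.\<close>

lemma evac_rect_rectangle:
  assumes "path D S (rectangle l k)"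
  shows "evac (rect D S) = rotate_word (int k - int l) S"
proof -
  have A: "path {} (std_word D) D" using assms path_young path_std_word by blast
  obtain X where X: "evac (std_word D @ S) = evac (rect D S) @ X" using evac_append_rect[OF A assms] .
  have "path {} (std_word D @ S) (rectangle l k)" using A assms unfolding path_append by blast
  from evac_rectangle[OF this] have "evac (rect D S) @ X =
      rotate_word (int k - int l) S @ rotate_word (int k - int l) (std_word D)"
    unfolding X rotate_word_append .
  moreover have "length (rect D S) = length S" using path_rect[OF assms] by metis
  ultimately show ?thesis by simp
qed

lemma knuth_rotate_word: "knuth u v \<Longrightarrow> knuth (rotate_word n u) (rotate_word n v)"
proof -
  have 3: "knuth3 (rotate_word n a) (rotate_word n b)" if "knuth3 a b" for a b
    using that unfolding knuth3_def rotate_word_def by auto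
  show "knuth u v \<Longrightarrow> knuth (rotate_word n u) (rotate_word n v)"
    unfolding knuth_def using 3 by (metis rotate_word_append append_assoc)
qed

lemma knuth_star_rotate_word: "knuth\<^sup>*\<^sup>* u v \<Longrightarrow> knuth\<^sup>*\<^sup>* (rotate_word n u) (rotate_word n v)"
  by (induction rule: rtranclp_induct) (auto intro: rtranclp.rtrancl_into_rtrancl knuth_rotate_word)

text \<open>Rotation exchanges the two arguments of \<open>switch\<close> and preserves Knuth moves,
  which turns the claim into \<open>switch_knuth_star\<close>.\<close>

lemma switch_knuth_star_right:
  assumes "knuth\<^sup>*\<^sup>* B B2" "path D (A @ B) E" "E \<subseteq> rectangle l k" "switch A B = (B', A')"
  shows "snd (switch A B2) = A'"
proof -
  let ?r = "rotate_word (int k - int l)"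
  have "path (rotated_complement l k E) (?r B @ ?r A) (rotated_complement l k D)"
    using path_rotate_word[OF assms(2,3)] unfolding rotate_word_append .
  from switch_knuth_star[OF knuth_star_rotate_word[OF assms(1)] this switch_rotate_word[OF assms(4)]]
  obtain Z where "switch (?r B2) (?r A) = (?r A', Z)" by blast
  from switch_rotate_word[OF this, of "int k - int l"] show ?thesis by simp
qed

text \<open>Both \<open>X\<close> and \<open>B'\<close> below arise by sliding tableaux of the same straight shape through \<open>C\<close>,
  so they are dual equivalent; hence evacuation commutes with switching.\<close>

lemma evac_switch:
  assumes "path {} (B @ C) E" "E \<subseteq> rectangle l k" "switch B C = (C', B')"
  obtains X X' where "evac (B @ C) = evac C' @ X" "switch (evac C') X = (evac B, X')"
    "evac (C' @ B') = evac B @ X'"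
proof -
  obtain M where M: "path {} B M" "path M C E" using assms(1) unfolding path_append by blast
  obtain N where N: "path {} C' N" "path N B' E" using switch_straight[OF M assms(3)] by blast
  obtain X where X: "switch (evac B) C = (C', X)" "knuth\<^sup>*\<^sup>* B' X"
    using switch_straight_indep[OF M(1) path_evac[OF M(1)] M(2) assms(3)] .
  have NX: "path N X E" using switch_straight[OF path_evac[OF M(1)] M(2) X(1)] N(1) path_det by metis
  obtain Y where Y: "switch (evac C') X = (evac B, Y)"
    using switch_straight_indep[OF N(1) path_evac[OF N(1)] NX switch_switch[OF X(1)]] by blast
  obtain X' where X': "switch (evac C') B' = (B, X')"
    using switch_straight_indep[OF N(1) path_evac[OF N(1)] N(2) switch_switch[OF assms(3)]] by blast
  have "path {} (evac C' @ B') E" using path_evac[OF N(1)] N(2) unfolding path_append by blast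
  from switch_knuth_star_right[OF X(2) this assms(2) X'] have "Y = X'" using Y by simp
  then show ?thesis using that evac_append[OF X(1)] Y evac_append[OF X'] by simp
qed

text \<open>For chains ending in the rectangle this replaces the missing braid relation. Both sides
  are evacuated: on one side evacuation turns rectification into rotation, which commutes with
  switching by \<open>switch_rotate_word\<close>; on the other, \<open>evac_switch\<close> moves
  evacuation past the switch. Since \<open>evac\<close> is injective on words of equal length, the
  sides agree.\<close>

theorem rect_switch_rectangle:
  assumes "path D (S @ Z) (rectangle l k)" "switch S Z = (X, Q)"
    "rect D (S @ Z) = T @ Y" "length T = length S" "switch T Y = (T', Q')"
  shows "rect D (X @ Q) = T' @ Q'"
proof -
  let ?r = "rotate_word (int k - int l)"
  have XQ: "path D (X @ Q) (rectangle l k)" using path_switch[OF assms(2,1)] .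
  have TY: "path {} (T @ Y) (rotated_complement l k D)" using path_rect_rectangle[OF assms(1)] assms(3) by simp
  from evac_switch[OF TY rotated_complement_subset assms(5)] obtain U U' where
    U: "evac (T @ Y) = evac T' @ U" "switch (evac T') U = (evac T, U')" "evac (T' @ Q') = evac T @ U'" .
  have "evac (T @ Y) = ?r Z @ ?r S"
    using evac_rect_rectangle[OF assms(1)] unfolding assms(3) rotate_word_append .
  moreover have lY: "length Y = length Z"
    using path_rect[OF assms(1)] assms(3,4) by (metis add_left_cancel length_append)
  moreover have lT: "length T' = length Y" using switch_length[OF assms(5)] by simp
  ultimately have "evac T' = ?r Z" "U = ?r S" using U(1) by auto
  then have "evac T = ?r Q" "U' = ?r X" using U(2) switch_rotate_word[OF assms(2)] by simp_all
  then have "evac (T' @ Q') = evac (rect D (X @ Q))"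
    using U(3) evac_rect_rectangle[OF XQ] unfolding rotate_word_append by simp
  moreover have "length (T' @ Q') = length (rect D (X @ Q))"
    using path_rect[OF XQ] lY lT assms(4) switch_length[OF assms(5)] switch_length[OF assms(2)]
    by (metis add.commute length_append)
  ultimately show ?thesis using evac_inj by metis
qed

section \<open>Growth grids\<close>

definition chain :: "nat \<Rightarrow> (nat \<Rightarrow> diagram) \<Rightarrow> bool" where
  "chain n c \<longleftrightarrow> (\<forall>i\<le>n. young_diagram (c i)) \<and> (\<forall>i<n. adds_one_box (c i) (c (Suc i)))"

definition box_content :: "diagram \<Rightarrow> diagram \<Rightarrow> int" where
  "box_content D E = (THE a. add_box D a E)"

primrec chain_word :: "nat \<Rightarrow> (nat \<Rightarrow> diagram) \<Rightarrow> int list" where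
  "chain_word 0 c = []"
| "chain_word (Suc n) c = box_content (c 0) (c (Suc 0)) # chain_word n (\<lambda>i. c (Suc i))"

lemma box_content_eq: "add_box D a E \<Longrightarrow> box_content D E = a"
  unfolding box_content_def using add_box_content by blast

lemma add_box_box_content:
  "young_diagram D \<Longrightarrow> young_diagram E \<Longrightarrow> adds_one_box D E \<Longrightarrow> add_box D (box_content D E) E"
  using add_box_adds_one_box box_content_eq by blast

lemma length_chain_word [simp]: "length (chain_word n c) = n"
  by (induction n arbitrary: c) auto

lemma chain_Suc: "chain (Suc n) c \<Longrightarrow> chain n (\<lambda>i. c (Suc i))"
  unfolding chain_def by auto

lemma chain_first: "chain (Suc n) c \<Longrightarrow> add_box (c 0) (box_content (c 0) (c (Suc 0))) (c (Suc 0))"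
  unfolding chain_def by (intro add_box_box_content) auto

lemma path_chain_word: "chain n c \<Longrightarrow> path (c 0) (chain_word n c) (c n)"
proof (induction n arbitrary: c)
  case 0
  then show ?case by (simp add: chain_def)
next
  case (Suc n)
  then show ?case using Suc.IH[OF chain_Suc[OF Suc.prems]] chain_first[OF Suc.prems] by auto
qed

lemma chain_word_inj:
  "chain n c \<Longrightarrow> chain n d \<Longrightarrow> c 0 = d 0 \<Longrightarrow> chain_word n c = chain_word n d \<Longrightarrow> i \<le> n \<Longrightarrow> c i = d i"
proof (induction n arbitrary: c d i)
  case (Suc n)
  have "c (Suc 0) = d (Suc 0)"
    using chain_first[OF Suc.prems(1)] chain_first[OF Suc.prems(2)] Suc.prems(3,4) add_box_det by simp
  then have "\<And>j. j \<le> n \<Longrightarrow> c (Suc j) = d (Suc j)"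
    using Suc.IH[OF chain_Suc[OF Suc.prems(1)] chain_Suc[OF Suc.prems(2)]] Suc.prems(4) by simp
  then show ?case using Suc.prems(3,5) by (cases i) auto
qed simp

lemma chain_word_cong: "(\<And>i. i \<le> n \<Longrightarrow> c i = d i) \<Longrightarrow> chain_word n c = chain_word n d"
proof (induction n arbitrary: c d)
  case (Suc n)
  then have "chain_word n (\<lambda>i. c (Suc i)) = chain_word n (\<lambda>i. d (Suc i))" by (intro Suc.IH) simp
  then show ?case using Suc.prems[of 0] Suc.prems[of "Suc 0"] by simp
qed simp

lemma path_chain:
  "path D w E \<Longrightarrow> \<exists>c. chain (length w) c \<and> c 0 = D \<and> c (length w) = E \<and> chain_word (length w) c = w"
proof (induction w arbitrary: D)
  case Nil
  then show ?case by (intro exI[of _ "\<lambda>_. D"]) (auto simp: chain_def)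
next
  case (Cons a w)
  then obtain M where M: "add_box D a M" "path M w E" by auto
  from Cons.IH[OF M(2)] obtain c where c: "chain (length w) c" "c 0 = M" "c (length w) = E" "chain_word (length w) c = w" by blast
  let ?d = "\<lambda>i. case i of 0 \<Rightarrow> D | Suc i \<Rightarrow> c i"
  have "chain (length (a # w)) ?d"
    using c(1,2) M(1) add_box_young[OF M(1)] add_box_adds_one_box[of D M]
    unfolding chain_def by (auto split: nat.splits)
  moreover have "chain_word (length (a # w)) ?d = a # w"
    using c(2,4) box_content_eq[OF M(1)] by simp
  ultimately show ?case using c(3) by (intro exI[of _ ?d]) simp
qed

text \<open>The first index runs along the side whose word is the first argument of \<open>switch\<close>.\<close>

definition grid :: "nat \<Rightarrow> nat \<Rightarrow> (nat \<Rightarrow> nat \<Rightarrow> diagram) \<Rightarrow> bool" where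
  "grid m n g \<longleftrightarrow> (\<forall>x\<le>m. \<forall>y\<le>n. young_diagram (g x y)) \<and>
     (\<forall>x<m. \<forall>y\<le>n. adds_one_box (g x y) (g (Suc x) y)) \<and>
     (\<forall>x\<le>m. \<forall>y<n. adds_one_box (g x y) (g x (Suc y))) \<and>
     (\<forall>x<m. \<forall>y<n. fomin_growth (g x y) (g (Suc x) y) (g x (Suc y)) (g (Suc x) (Suc y)))"

lemma grid_row: "grid m n g \<Longrightarrow> y \<le> n \<Longrightarrow> chain m (\<lambda>x. g x y)"
  unfolding grid_def chain_def by auto

lemma grid_column: "grid m n g \<Longrightarrow> x \<le> m \<Longrightarrow> chain n (g x)"
  unfolding grid_def chain_def by auto

lemma grid_shift: "grid (Suc m) n g \<Longrightarrow> grid m n (\<lambda>x. g (Suc x))"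
  unfolding grid_def by auto

lemma grid_cong: "(\<And>x y. x \<le> m \<Longrightarrow> y \<le> n \<Longrightarrow> g x y = h x y) \<Longrightarrow> grid m n g \<longleftrightarrow> grid m n h"
  unfolding grid_def by auto

lemma slide_columns:
  assumes "\<And>y. y \<le> n \<Longrightarrow> adds_one_box (c y) (d y)"
    "\<And>y. y < n \<Longrightarrow> fomin_growth (c y) (d y) (c (Suc y)) (d (Suc y))"
    "chain n c" "chain n d"
  shows "slide (box_content (c 0) (d 0)) (chain_word n d) = (chain_word n c, box_content (c n) (d n))"
  using assms
proof (induction n arbitrary: c d)
  case (Suc n)
  have y: "young_diagram (c i) \<and> young_diagram (d i)" if "i \<le> Suc n" for i
    using Suc.prems(3,4) that unfolding chain_def by auto
  have s: "add_box (c 0) (box_content (c 0) (d 0)) (d 0)" "add_box (c 1) (box_content (c 1) (d 1)) (d 1)"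
    using Suc.prems(1) y by (auto intro!: add_box_box_content)
  have "fomin_growth (c 0) (d 0) (c 1) (d 1)" using Suc.prems(2)[of 0] by simp
  then have "cross (box_content (c 0) (d 0)) (box_content (d 0) (d 1)) = (box_content (c 0) (c 1), box_content (c 1) (d 1))"
    using fomin_growth_iff_cross[OF s(1) _ _ s(2)] chain_first[OF Suc.prems(3)] chain_first[OF Suc.prems(4)] by simp
  moreover have "slide (box_content (c 1) (d 1)) (chain_word n (\<lambda>i. d (Suc i))) =
      (chain_word n (\<lambda>i. c (Suc i)), box_content (c (Suc n)) (d (Suc n)))"
    using Suc.IH[of "\<lambda>i. c (Suc i)" "\<lambda>i. d (Suc i)"] Suc.prems(1,2) chain_Suc[OF Suc.prems(3)] chain_Suc[OF Suc.prems(4)] by auto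
  ultimately show ?case by simp
qed simp

text \<open>The arguments are read along the boundary through the corner \<open>(m, 0)\<close>, the
  results along the boundary through \<open>(0, n)\<close>. Each step of the recursion processes the
  strip between two adjacent columns.\<close>

theorem switch_grid:
  "grid m n g \<Longrightarrow>
    switch (chain_word m (\<lambda>x. g x 0)) (chain_word n (g m)) = (chain_word n (g 0), chain_word m (\<lambda>x. g x n))"
proof (induction m arbitrary: g)
  case (Suc m)
  have "slide (box_content (g 0 0) (g (Suc 0) 0)) (chain_word n (g (Suc 0))) =
      (chain_word n (g 0), box_content (g 0 n) (g (Suc 0) n))"
    by (rule slide_columns)
      (use Suc.prems grid_column[OF Suc.prems] in \<open>auto simp: grid_def\<close>)
  then show ?case using Suc.IH[OF grid_shift[OF Suc.prems]] by simp
qed simp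

lemma switch_grid_boundary:
  assumes "grid m n g" "\<forall>x\<le>m. g x 0 = p x" "\<forall>y\<le>n. g m y = q y"
  shows "switch (chain_word m p) (chain_word n q) = (chain_word n (g 0), chain_word m (\<lambda>x. g x n))"
  using switch_grid[OF assms(1)] assms(2,3) chain_word_cong[of m "\<lambda>x. g x 0" p] chain_word_cong[of n "g m" q] by simp

lemma fomin_growth_unique: "fomin_growth \<gamma> \<alpha> \<delta> \<beta> \<Longrightarrow> fomin_growth \<gamma> \<alpha> \<delta>' \<beta> \<Longrightarrow> \<delta> = \<delta>'"
  unfolding fomin_growth_def by (auto split: if_splits)

text \<open>The columns are determined from the last one backwards, each of them from its entry in
  row 0 upwards: in every square the only unknown shape is then the one that the growth rule
  computes.\<close>

lemma grid_unique:
  "grid m n g \<Longrightarrow> grid m n h \<Longrightarrow> (\<And>x. x \<le> m \<Longrightarrow> g x 0 = h x 0) \<Longrightarrow> (\<And>y. y \<le> n \<Longrightarrow> g m y = h m y) \<Longrightarrow>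
    x \<le> m \<Longrightarrow> y \<le> n \<Longrightarrow> g x y = h x y"
proof (induction m arbitrary: g h x y)
  case (Suc m)
  have IH: "g (Suc x) y = h (Suc x) y" if "x \<le> m" "y \<le> n" for x y
    using Suc.IH[OF grid_shift[OF Suc.prems(1)] grid_shift[OF Suc.prems(2)] _ _ that] Suc.prems(3,4) by simp
  have "g 0 y = h 0 y" if "y \<le> n" for y
    using that
  proof (induction y)
    case (Suc y)
    have "fomin_growth (g 0 y) (g (Suc 0) y) (g 0 (Suc y)) (g (Suc 0) (Suc y))"
      "fomin_growth (h 0 y) (h (Suc 0) y) (h 0 (Suc y)) (h (Suc 0) (Suc y))"
      using \<open>grid (Suc m) n g\<close> \<open>grid (Suc m) n h\<close> Suc.prems unfolding grid_def by auto
    then show ?case using Suc.IH Suc.prems IH[of 0 y] IH[of 0 "Suc y"] fomin_growth_unique by simp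
  qed (use Suc.prems(3) in simp)
  then show ?case using IH Suc.prems(5,6) by (cases x) auto
qed simp

lemma column_exists:
  assumes "chain n d" "young_diagram e" "adds_one_box e (d 0)"
  shows "\<exists>c. c 0 = e \<and> chain n c \<and> (\<forall>y\<le>n. adds_one_box (c y) (d y)) \<and>
    (\<forall>y<n. fomin_growth (c y) (d y) (c (Suc y)) (d (Suc y)))"
  using assms(1)
proof (induction n)
  case 0
  then show ?case using assms by (intro exI[of _ "\<lambda>_. e"]) (simp add: chain_def)
next
  case (Suc n)
  have "chain n d" using Suc.prems unfolding chain_def by auto
  then obtain c where c: "c 0 = e" "chain n c" "\<forall>y\<le>n. adds_one_box (c y) (d y)"
    "\<forall>y<n. fomin_growth (c y) (d y) (c (Suc y)) (d (Suc y))" using Suc.IH by blast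
  have y: "young_diagram (c n)" "young_diagram (d n)" "young_diagram (d (Suc n))"
    using c(2) Suc.prems unfolding chain_def by auto
  have 1: "add_box (c n) (box_content (c n) (d n)) (d n)"
    using c(3) y by (intro add_box_box_content) auto
  have 2: "add_box (d n) (box_content (d n) (d (Suc n))) (d (Suc n))"
    using Suc.prems y unfolding chain_def by (intro add_box_box_content) auto
  obtain a b where ab: "cross (box_content (c n) (d n)) (box_content (d n) (d (Suc n))) = (a, b)" by fastforce
  from fomin_growth_add_box[OF 1 2 ab] obtain M where M: "add_box (c n) a M" "add_box M b (d (Suc n))" .
  have fom: "fomin_growth (c n) (d n) M (d (Suc n))" using fomin_growth_iff_cross[OF 1 2 M] ab by simp
  have yM: "young_diagram M" "adds_one_box (c n) M" "adds_one_box M (d (Suc n))"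
    using M add_box_young[OF M(1)] add_box_young[OF M(2)] add_box_adds_one_box by blast+
  let ?c = "c(Suc n := M)"
  have "chain (Suc n) ?c" using c(2) yM unfolding chain_def by (auto simp: le_Suc_eq less_Suc_eq)
  moreover have "\<forall>y\<le>Suc n. adds_one_box (?c y) (d y)" using c(3) yM by (auto simp: le_Suc_eq)
  moreover have "\<forall>y<Suc n. fomin_growth (?c y) (d y) (?c (Suc y)) (d (Suc y))"
    using c(4) fom by (auto simp: less_Suc_eq)
  moreover have "?c 0 = e" using c(1) by simp
  ultimately show ?case by blast
qed

lemma grid_exists:
  "chain m p \<Longrightarrow> chain n q \<Longrightarrow> p m = q 0 \<Longrightarrow>
    \<exists>g. grid m n g \<and> (\<forall>x\<le>m. g x 0 = p x) \<and> (\<forall>y\<le>n. g m y = q y)"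
proof (induction m arbitrary: p)
  case 0
  then show ?case by (intro exI[of _ "\<lambda>_. q"]) (simp add: grid_def chain_def)
next
  case (Suc m)
  from Suc.IH[OF chain_Suc[OF Suc.prems(1)] Suc.prems(2,3)] obtain g where
    g: "grid m n g" "\<forall>x\<le>m. g x 0 = p (Suc x)" "\<forall>y\<le>n. g m y = q y" by blast
  have "young_diagram (p 0)" "adds_one_box (p 0) (g 0 0)" using Suc.prems(1) g(2) unfolding chain_def by auto
  from column_exists[OF grid_column[OF g(1), of 0] this] obtain c where
    c: "c 0 = p 0" "chain n c" "\<forall>y\<le>n. adds_one_box (c y) (g 0 y)"
      "\<forall>y<n. fomin_growth (c y) (g 0 y) (c (Suc y)) (g 0 (Suc y))" by auto
  let ?g = "\<lambda>x. case x of 0 \<Rightarrow> c | Suc x \<Rightarrow> g x"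
  have "grid (Suc m) n ?g"
    using g(1) c unfolding grid_def chain_def by (auto split: nat.splits)
  moreover have "\<forall>x\<le>Suc m. ?g x 0 = p x" using g(2) c(1) by (auto split: nat.splits)
  ultimately show ?case using g(3) by (intro exI[of _ ?g]) simp
qed

lemma shape_chain_eq:
  assumes "standard_tableau D T"
  shows "shape_chain D T n = {p \<in> D. T p \<le> n}"
proof (induction n)
  case 0
  have "\<not> T p \<le> 0" if "p \<in> D" for p
    using assms that unfolding standard_tableau_def bij_betw_def by (metis atLeastAtMost_iff imageI le_zero_eq not_one_le_zero)
  then have "{p \<in> D. T p \<le> 0} = {}" by blast
  then show ?case by simp
next
  case (Suc n)
  have "{p \<in> D. T p \<le> Suc n} = {p \<in> D. T p \<le> n} \<union> {p \<in> D. T p = Suc n}"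
    by (simp only: le_Suc_eq) blast
  then show ?case using Suc by simp
qed

lemma chain_shape_chain:
  assumes "young_diagram D" "standard_tableau D T"
  shows "chain (card D) (shape_chain D T)" "shape_chain D T 0 = {}" "shape_chain D T (card D) = D"
proof -
  have bij: "bij_betw T D {1..card D}" using assms(2) unfolding standard_tableau_def by blast
  have mono: "T (i', j') \<le> T (i, j)" if "(i, j) \<in> D" "i' \<le> i" "j' \<le> j" for i j i' j'
  proof -
    have "(i', j) \<in> D" "(i', j') \<in> D" using that young_down[OF assms(1)] by auto
    then have "T (i', j') \<le> T (i', j)" "T (i', j) \<le> T (i, j)"
      using assms(2) that unfolding standard_tableau_def by (auto simp: le_less)
    then show ?thesis by simp
  qed
  have young: "young_diagram {p \<in> D. T p \<le> n}" for n
    unfolding young_diagram_def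
  proof (intro conjI allI impI)
    show "finite {p \<in> D. T p \<le> n}" using young_finite[OF assms(1)] by simp
    fix i j i' j' assume "(i, j) \<in> {p \<in> D. T p \<le> n}" "i' \<le> i" "j' \<le> j"
    then show "(i', j') \<in> {p \<in> D. T p \<le> n}"
      using mono[of i j i' j'] young_down[OF assms(1), of i j i' j'] by auto
  qed
  have "adds_one_box {p \<in> D. T p \<le> n} {p \<in> D. T p \<le> Suc n}" if "n < card D" for n
  proof -
    have "Suc n \<in> T ` D" using bij that unfolding bij_betw_def by auto
    then obtain p where p: "p \<in> D" "T p = Suc n" by auto
    have "q = p" if "q \<in> D" "T q = Suc n" for q
      using bij that p unfolding bij_betw_def inj_on_def by auto
    then have "{q \<in> D. T q \<le> Suc n} = insert p {q \<in> D. T q \<le> n}"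
      unfolding le_Suc_eq using p by blast
    moreover have "p \<notin> {q \<in> D. T q \<le> n}" using p(2) by simp
    ultimately show ?thesis unfolding adds_one_box_def by blast
  qed
  then show "chain (card D) (shape_chain D T)"
    unfolding chain_def shape_chain_eq[OF assms(2)] using young by blast
  show "shape_chain D T (card D) = D"
    unfolding shape_chain_eq[OF assms(2)] using bij unfolding bij_betw_def by auto
qed simp


section \<open>Cartons\<close>

lemma mem_carton_vertices:
  "(x, y, z) \<in> carton_vertices a b c \<longleftrightarrow>
    x \<le> a \<and> y \<le> b \<and> z \<le> c \<and> (x = 0 \<or> x = a \<or> y = 0 \<or> y = b \<or> z = 0 \<or> z = c)"
  unfolding carton_vertices_def carton_faces_def by auto

lemma ball_Collect_prod: "(\<forall>(u, d) \<in> {(u, d). Q u d}. P u d) \<longleftrightarrow> (\<forall>u d. Q u d \<longrightarrow> P u d)"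
  by auto

lemma ball_Collect_triple:
  "(\<forall>(u, d, e) \<in> {(u, d, e). Q u d e}. P u d e) \<longleftrightarrow> (\<forall>u d e. Q u d e \<longrightarrow> P u d e)"
  by auto

lemma carton_edges_iff:
  "(\<forall>(u, d) \<in> carton_edges a b c. P u d) \<longleftrightarrow>
    (\<forall>F \<in> carton_faces a b c. \<forall>d \<in> unit_steps. \<forall>u. u \<in> F \<longrightarrow> u + d \<in> F \<longrightarrow> P u d)"
  unfolding carton_edges_def ball_Collect_prod insert_subset by blast

lemma carton_squares_iff:
  "(\<forall>(u, d, e) \<in> carton_squares a b c. P u d e) \<longleftrightarrow>
    (\<forall>F \<in> carton_faces a b c. \<forall>d \<in> unit_steps. \<forall>e \<in> unit_steps. d \<noteq> e \<longrightarrow>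
      (\<forall>u. u \<in> F \<longrightarrow> u + d \<in> F \<longrightarrow> u + e \<in> F \<longrightarrow> u + d + e \<in> F \<longrightarrow> P u d e))"
  unfolding carton_squares_def ball_Collect_triple insert_subset by blast

text \<open>A carton lists each square with both orders of its two directions, a grid with only one;
  this supplies the other.\<close>

lemma grid_fomin_growth_sym:
  assumes "grid m n g" "x < m" "y < n"
  shows "fomin_growth (g x y) (g x (Suc y)) (g (Suc x) y) (g (Suc x) (Suc y))"
proof -
  let ?b = box_content
  have "add_box (g x y) (?b (g x y) (g (Suc x) y)) (g (Suc x) y)"
    "add_box (g (Suc x) y) (?b (g (Suc x) y) (g (Suc x) (Suc y))) (g (Suc x) (Suc y))"
    "add_box (g x y) (?b (g x y) (g x (Suc y))) (g x (Suc y))"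
    "add_box (g x (Suc y)) (?b (g x (Suc y)) (g (Suc x) (Suc y))) (g (Suc x) (Suc y))"
    using assms unfolding grid_def by (auto intro!: add_box_box_content)
  from fomin_growth_sym[OF this] show ?thesis using assms unfolding grid_def by blast
qed

lemma carton_fillings_iff:
  "f \<in> carton_fillings a b c \<longleftrightarrow>
    f \<in> carton_vertices a b c \<rightarrow>\<^sub>E {D. young_diagram D} \<and>
    grid b c (\<lambda>y z. f (0, y, z)) \<and> grid b c (\<lambda>y z. f (a, y, z)) \<and>
    grid a c (\<lambda>x z. f (x, 0, z)) \<and> grid a c (\<lambda>x z. f (x, b, z)) \<and>
    grid a b (\<lambda>x y. f (x, y, 0)) \<and> grid a b (\<lambda>x y. f (x, y, c))" (is "?L \<longleftrightarrow> ?V \<and> ?G")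
proof
  assume L: ?L
  then have V: ?V
    and E': "\<forall>F \<in> carton_faces a b c. \<forall>d \<in> unit_steps. \<forall>u. u \<in> F \<longrightarrow> u + d \<in> F \<longrightarrow> adds_one_box (f u) (f (u + d))"
    and S': "\<forall>F \<in> carton_faces a b c. \<forall>d \<in> unit_steps. \<forall>e \<in> unit_steps. d \<noteq> e \<longrightarrow>
      (\<forall>u. u \<in> F \<longrightarrow> u + d \<in> F \<longrightarrow> u + e \<in> F \<longrightarrow> u + d + e \<in> F \<longrightarrow>
        fomin_growth (f u) (f (u + d)) (f (u + e)) (f (u + d + e)))"
    unfolding carton_fillings_def carton_edges_iff carton_squares_iff mem_Collect_eq by - (elim conjE, assumption)+
  have E: "adds_one_box (f u) (f (u + d))" if "F \<in> carton_faces a b c" "d \<in> unit_steps" "u \<in> F" "u + d \<in> F" for F d u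
    using E' that by blast
  have S: "fomin_growth (f u) (f (u + d)) (f (u + e)) (f (u + d + e))"
    if "F \<in> carton_faces a b c" "d \<in> unit_steps" "e \<in> unit_steps" "d \<noteq> e"
      "u \<in> F" "u + d \<in> F" "u + e \<in> F" "u + d + e \<in> F" for F d e u
    using S' that by blast
  have Y: "young_diagram (f u)" if "u \<in> carton_vertices a b c" for u using V that by auto
  have x: "grid b c (\<lambda>y z. f (t, y, z))" if "t = 0 \<or> t = a" for t
  proof -
    have F: "{t} \<times> {0..b} \<times> {0..c} \<in> carton_faces a b c" using that unfolding carton_faces_def by auto
    have y: "\<forall>y\<le>b. \<forall>z\<le>c. young_diagram (f (t, y, z))" using that by (auto intro!: Y simp: mem_carton_vertices)
    show ?thesis unfolding grid_def
      using y E[OF F, of "(0, 1, 0)"] E[OF F, of "(0, 0, 1)"] S[OF F, of "(0, 1, 0)" "(0, 0, 1)"]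
      by (auto simp: unit_steps_def)
  qed
  have y: "grid a c (\<lambda>x z. f (x, t, z))" if "t = 0 \<or> t = b" for t
  proof -
    have F: "{0..a} \<times> {t} \<times> {0..c} \<in> carton_faces a b c" using that unfolding carton_faces_def by auto
    have y: "\<forall>x\<le>a. \<forall>z\<le>c. young_diagram (f (x, t, z))" using that by (auto intro!: Y simp: mem_carton_vertices)
    show ?thesis unfolding grid_def
      using y E[OF F, of "(1, 0, 0)"] E[OF F, of "(0, 0, 1)"] S[OF F, of "(1, 0, 0)" "(0, 0, 1)"]
      by (auto simp: unit_steps_def)
  qed
  have z: "grid a b (\<lambda>x y. f (x, y, t))" if "t = 0 \<or> t = c" for t
  proof -
    have F: "{0..a} \<times> {0..b} \<times> {t} \<in> carton_faces a b c" using that unfolding carton_faces_def by auto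
    have y: "\<forall>x\<le>a. \<forall>y\<le>b. young_diagram (f (x, y, t))" using that by (auto intro!: Y simp: mem_carton_vertices)
    show ?thesis unfolding grid_def
      using y E[OF F, of "(1, 0, 0)"] E[OF F, of "(0, 1, 0)"] S[OF F, of "(1, 0, 0)" "(0, 1, 0)"]
      by (auto simp: unit_steps_def)
  qed
  show "?V \<and> ?G" using V x y z by blast
next
  assume R: "?V \<and> ?G"
  define good where "good F \<longleftrightarrow>
     (\<forall>d \<in> unit_steps. \<forall>u. u \<in> F \<longrightarrow> u + d \<in> F \<longrightarrow> adds_one_box (f u) (f (u + d))) \<and>
     (\<forall>d \<in> unit_steps. \<forall>e \<in> unit_steps. d \<noteq> e \<longrightarrow>
      (\<forall>u. u \<in> F \<longrightarrow> u + d \<in> F \<longrightarrow> u + e \<in> F \<longrightarrow> u + d + e \<in> F \<longrightarrow>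
        fomin_growth (f u) (f (u + d)) (f (u + e)) (f (u + d + e))))" for F
  have x: "good ({t} \<times> {0..b} \<times> {0..c})" if g: "grid b c (\<lambda>y z. f (t, y, z))" for t
    unfolding good_def unit_steps_def using g grid_fomin_growth_sym[OF g] by (auto simp: grid_def)
  have y: "good ({0..a} \<times> {t} \<times> {0..c})" if g: "grid a c (\<lambda>x z. f (x, t, z))" for t
    unfolding good_def unit_steps_def using g grid_fomin_growth_sym[OF g] by (auto simp: grid_def)
  have z: "good ({0..a} \<times> {0..b} \<times> {t})" if g: "grid a b (\<lambda>x y. f (x, y, t))" for t
    unfolding good_def unit_steps_def using g grid_fomin_growth_sym[OF g] by (auto simp: grid_def)
  have good: "\<forall>F \<in> carton_faces a b c. good F"
    unfolding carton_faces_def using R x y z by simp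
  have "f \<in> carton_vertices a b c \<rightarrow>\<^sub>E {D. young_diagram D}" using R by blast
  moreover have "\<forall>(u, d) \<in> carton_edges a b c. adds_one_box (f u) (f (u + d))"
    unfolding carton_edges_iff using good unfolding good_def by blast
  moreover have "\<forall>(u, d, e) \<in> carton_squares a b c. fomin_growth (f u) (f (u + d)) (f (u + e)) (f (u + d + e))"
    unfolding carton_squares_iff using good unfolding good_def by blast
  ultimately show ?L unfolding carton_fillings_def by blast
qed

locale carton_data =
  fixes l k :: nat and la mu nu :: diagram and T_la T_mu T_nu :: "nat \<times> nat \<Rightarrow> nat"
  assumes la: "young_diagram la" "la \<subseteq> rectangle l k"
    and mu: "young_diagram mu" "mu \<subseteq> rectangle l k"
    and nu: "young_diagram nu" "nu \<subseteq> rectangle l k"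
    and T_la: "standard_tableau la T_la"
    and T_mu: "standard_tableau mu T_mu"
    and T_nu: "standard_tableau nu T_nu"
begin

abbreviation "a \<equiv> card la"
abbreviation "b \<equiv> card mu"
abbreviation "c \<equiv> card nu"
abbreviation "cla \<equiv> shape_chain la T_la"
abbreviation "cmu \<equiv> shape_chain mu T_mu"
abbreviation "cnu \<equiv> shape_chain nu T_nu"
abbreviation "wla \<equiv> chain_word a cla"
abbreviation "wmu \<equiv> chain_word b cmu"
abbreviation "wnu \<equiv> chain_word c cnu"
abbreviation "\<Lambda> \<equiv> rectangle l k"
abbreviation "\<sigma> \<equiv> rotated_complement l k nu"
abbreviation "Cartons \<equiv> CARTONS l k la mu nu T_la T_mu T_nu"
abbreviation "Words \<equiv> {S \<in> paths la \<sigma>. fst (switch wla S) = wmu}"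
abbreviation "side f \<equiv> chain_word b (\<lambda>y. f (a, y, 0 :: nat))"

lemma path_initial: "path {} wla la" "path {} wmu mu" "path {} wnu nu"
  using path_chain_word[OF chain_shape_chain(1)[OF la(1) T_la]] chain_shape_chain(2,3)[OF la(1) T_la]
    path_chain_word[OF chain_shape_chain(1)[OF mu(1) T_mu]] chain_shape_chain(2,3)[OF mu(1) T_mu]
    path_chain_word[OF chain_shape_chain(1)[OF nu(1) T_nu]] chain_shape_chain(2,3)[OF nu(1) T_nu] by simp_all

lemma sigma: "young_diagram \<sigma>" "\<sigma> \<subseteq> \<Lambda>" "rotated_complement l k \<sigma> = nu"
  using young_rotated_complement[OF nu(1)] rotated_complement_subset rotated_complement_involution[OF nu(2)] by auto

lemma carton_faces_grids:
  assumes "f \<in> Cartons"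
  shows "grid b c (\<lambda>y z. f (0, y, z))" "grid b c (\<lambda>y z. f (a, y, z))"
    "grid a c (\<lambda>x z. f (x, 0, z))" "grid a c (\<lambda>x z. f (x, b, z))"
    "grid a b (\<lambda>x y. f (x, y, 0))" "grid a b (\<lambda>x y. f (x, y, c))"
    "f \<in> extensional (carton_vertices a b c)"
    "\<And>i. i \<le> a \<Longrightarrow> f (i, 0, 0) = cla i" "\<And>i. i \<le> b \<Longrightarrow> f (0, i, 0) = cmu i"
    "\<And>i. i \<le> c \<Longrightarrow> f (0, 0, i) = cnu i" "f (a, b, c) = \<Lambda>"
  using assms unfolding CARTONS_def carton_fillings_iff by (auto simp: PiE_def)

text \<open>The shape at \<open>(a, b, 0)\<close> is not prescribed. The faces \<open>x = a\<close>
  and \<open>y = 0\<close> together rectify the chain \<open>Z\<close> above this vertex to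
  \<open>wnu\<close>, and a chain up to the rectangle rectifies to the rotated complement of its
  start. Hence that complement is \<open>nu\<close>.\<close>

lemma carton_side:
  assumes "f \<in> Cartons"
  defines "Z \<equiv> chain_word c (\<lambda>z. f (a, b, z))"
  shows "path la (side f) \<sigma>" "fst (switch wla (side f)) = wmu" "f (a, b, 0) = \<sigma>"
    "path \<sigma> Z \<Lambda>" "rect \<sigma> Z = wnu"
proof -
  note G = carton_faces_grids[OF assms(1)]
  have fla: "f (a, 0, 0) = la" using G(8)[of a] chain_shape_chain(3)[OF la(1) T_la] by simp
  have wla: "chain_word a (\<lambda>x. f (x, 0, 0)) = wla" by (rule chain_word_cong) (simp add: G(8))
  have wmu: "chain_word b (\<lambda>y. f (0, y, 0)) = wmu" by (rule chain_word_cong) (simp add: G(9))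
  have wnu: "chain_word c (\<lambda>z. f (0, 0, z)) = wnu" by (rule chain_word_cong) (simp add: G(10))
  let ?\<tau> = "f (a, b, 0)"
  have S: "path la (side f) ?\<tau>" using path_chain_word[OF grid_column[OF G(5), of a]] fla by simp
  have Z: "path ?\<tau> Z \<Lambda>" unfolding Z_def using path_chain_word[OF grid_column[OF G(2), of b]] G(11) by simp
  show *: "fst (switch wla (side f)) = wmu" using switch_grid[OF G(5)] wla wmu by simp
  have "switch (side f) Z = (chain_word c (\<lambda>z. f (a, 0, z)), chain_word b (\<lambda>y. f (a, y, c)))"
    unfolding Z_def using switch_grid[OF G(2)] .
  moreover have "switch wla (chain_word c (\<lambda>z. f (a, 0, z))) = (wnu, chain_word a (\<lambda>x. f (x, 0, c)))"
    using switch_grid[OF G(3)] wla wnu by simp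
  ultimately have "fst (switch (wla @ side f) Z) = wnu" using switch_append1 by fastforce
  moreover have "path {} (wla @ side f) ?\<tau>" using path_initial(1) S unfolding path_append by blast
  ultimately have r: "rect ?\<tau> Z = wnu" using rect_eq[OF _ Z] by simp
  then have "rotated_complement l k ?\<tau> = nu" using path_rect_rectangle[OF Z] path_initial(3) path_det by metis
  then show \<tau>: "?\<tau> = \<sigma>" using rotated_complement_involution[of ?\<tau> l k] path_subset[OF Z] by simp
  show "path la (side f) \<sigma>" "path \<sigma> Z \<Lambda>" "rect \<sigma> Z = wnu" using S Z r \<tau> by simp_all
qed

text \<open>The side together with \<open>wla\<close> determines the face \<open>z = 0\<close>. The
  edge above \<open>(a, b, 0)\<close> is the unique chain to the rectangle with rectification
  \<open>wnu\<close>. Every further face then has its row 0 and its last column on edges already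
  known.\<close>

lemma inj_on_side: "inj_on side Cartons"
proof (rule inj_onI)
  fix f g assume f: "f \<in> Cartons" and g: "g \<in> Cartons" and eq: "side f = side g"
  note F = carton_faces_grids[OF f] and G = carton_faces_grids[OF g]
  note Sf = carton_side[OF f] and Sg = carton_side[OF g]
  have S: "f (a, y, 0) = g (a, y, 0)" if "y \<le> b" for y
    by (rule chain_word_inj[OF grid_column[OF F(5)] grid_column[OF G(5)]]) (use that eq F(8) G(8) in auto)
  have eqZ: "chain_word c (\<lambda>z. f (a, b, z)) = chain_word c (\<lambda>z. g (a, b, z))"
    using ex1_rect_rectangle[OF sigma(1,2), of wnu] path_initial(3) sigma(3) Sf(4,5) Sg(4,5) by metis
  have Z: "f (a, b, z) = g (a, b, z)" if "z \<le> c" for z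
    by (rule chain_word_inj[OF grid_column[OF F(2) order_refl] grid_column[OF G(2) order_refl]])
      (use that eqZ Sf(3) Sg(3) in simp_all)
  have 1: "f (x, y, 0) = g (x, y, 0)" if "x \<le> a" "y \<le> b" for x y
    by (rule grid_unique[OF F(5) G(5)]) (use that S F(8) G(8) in auto)
  have 2: "f (a, y, z) = g (a, y, z)" if "y \<le> b" "z \<le> c" for y z
    by (rule grid_unique[OF F(2) G(2)]) (use that 1 Z in auto)
  have 3: "f (x, 0, z) = g (x, 0, z)" if "x \<le> a" "z \<le> c" for x z
    by (rule grid_unique[OF F(3) G(3)]) (use that 1 2 in auto)
  have 4: "f (x, b, z) = g (x, b, z)" if "x \<le> a" "z \<le> c" for x z
    by (rule grid_unique[OF F(4) G(4)]) (use that 1 Z in auto)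
  have 5: "f (0, y, z) = g (0, y, z)" if "y \<le> b" "z \<le> c" for y z
    by (rule grid_unique[OF F(1) G(1)]) (use that 1 4 in auto)
  have 6: "f (x, y, c) = g (x, y, c)" if "x \<le> a" "y \<le> b" for x y
    by (rule grid_unique[OF F(6) G(6)]) (use that 2 3 in auto)
  show "f = g"
  proof (rule extensionalityI[OF F(7) G(7)])
    fix p assume p: "p \<in> carton_vertices a b c"
    obtain x y z where xyz: "p = (x, y, z)" by (cases p)
    show "f p = g p" using p 1 2 3 4 5 6 unfolding xyz mem_carton_vertices by auto
  qed
qed

text \<open>
  In the following proof \<open>g1\<close>, \<open>g2\<close>, \<open>g3\<close>, \<open>g4\<close>, \<open>g5\<close>, \<open>g6\<close> are the faces
  \<open>z = 0\<close>, \<open>x = a\<close>, \<open>y = 0\<close>, \<open>y = b\<close>, \<open>x = 0\<close>, \<open>z = c\<close>.  The last face meets the others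
  correctly by \<open>rect_switch_rectangle\<close> (\<open>QQ\<close>) and by uniqueness of antistraight tableaux with given
  rectification (\<open>PP\<close>).  When \<open>a\<close>, \<open>b\<close> or \<open>c\<close> is 0, two opposite faces coincide.
\<close>

lemma carton_exists:
  assumes "S \<in> Words"
  shows "\<exists>f \<in> Cartons. side f = S"
proof -
  have S: "path la S \<sigma>" "fst (switch wla S) = wmu" using assms unfolding paths_def by auto
  obtain P0 where P0: "switch wla S = (wmu, P0)" using S(2) by (cases "switch wla S") auto
  obtain Z where Z: "path \<sigma> Z \<Lambda>" "rect \<sigma> Z = wnu"
    using ex1_rect_rectangle[OF sigma(1,2), of wnu] path_initial(3) sigma(3) by auto
  have "card \<sigma> = a + b"
    using path_switch[OF P0] path_card[OF S(1)] switch_length[OF P0] by simp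
  then have lS: "length S = b" using path_card[OF S(1)] by simp
  have lZ: "length Z = c" using path_rect[OF Z(1)] Z(2) length_chain_word by metis
  obtain cS where cS: "chain b cS" "cS 0 = la" "cS b = \<sigma>" "chain_word b cS = S"
    using path_chain[OF S(1)] unfolding lS by blast
  obtain cZ where cZ: "chain c cZ" "cZ 0 = \<sigma>" "cZ c = \<Lambda>" "chain_word c cZ = Z"
    using path_chain[OF Z(1)] unfolding lZ by blast
  note L = chain_shape_chain[OF la(1) T_la] and M = chain_shape_chain[OF mu(1) T_mu] and N = chain_shape_chain[OF nu(1) T_nu]
  obtain g1 where g1: "grid a b g1" "\<forall>x\<le>a. g1 x 0 = cla x" "\<forall>y\<le>b. g1 a y = cS y"
    using grid_exists[OF L(1) cS(1)] L(3) cS(2) by auto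
  obtain g2 where g2: "grid b c g2" "\<forall>y\<le>b. g2 y 0 = g1 a y" "\<forall>z\<le>c. g2 b z = cZ z"
    using grid_exists[OF grid_column[OF g1(1) order_refl] cZ(1)] g1(3) cS(3) cZ(2) by auto
  obtain g3 where g3: "grid a c g3" "\<forall>x\<le>a. g3 x 0 = g1 x 0" "\<forall>z\<le>c. g3 a z = g2 0 z"
    using grid_exists[OF grid_row[OF g1(1), of 0] grid_column[OF g2(1), of 0]] g2(2) by auto
  obtain g4 where g4: "grid a c g4" "\<forall>x\<le>a. g4 x 0 = g1 x b" "\<forall>z\<le>c. g4 a z = g2 b z"
    using grid_exists[OF grid_row[OF g1(1) order_refl] grid_column[OF g2(1) order_refl]] g2(2) by auto
  obtain g5 where g5: "grid b c g5" "\<forall>y\<le>b. g5 y 0 = g1 0 y" "\<forall>z\<le>c. g5 b z = g4 0 z"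
    using grid_exists[OF grid_column[OF g1(1), of 0] grid_column[OF g4(1), of 0]] g4(2) by auto
  obtain g6 where g6: "grid a b g6" "\<forall>x\<le>a. g6 x 0 = g3 x c" "\<forall>y\<le>b. g6 a y = g2 y c"
    using grid_exists[OF grid_row[OF g3(1) order_refl] grid_row[OF g2(1) order_refl]] g3(3) by auto
  define P X Q' Y P' Q Q2 P2 where
    "P = chain_word a (\<lambda>x. g3 x c)" and "X = chain_word c (g2 0)" and "Q' = chain_word b (\<lambda>y. g2 y c)" and
    "Y = chain_word c (g4 0)" and "P' = chain_word a (\<lambda>x. g4 x c)" and "Q = chain_word b (\<lambda>y. g5 y c)" and
    "Q2 = chain_word b (g6 0)" and "P2 = chain_word a (\<lambda>x. g6 x b)"
  define U V where "U = chain_word c (g3 0)" and "V = chain_word c (g5 0)"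
  have "switch wla S = (chain_word b (g1 0), chain_word a (\<lambda>x. g1 x b))"
    using switch_grid_boundary[OF g1] cS(4) by simp
  then have s1: "wmu = chain_word b (g1 0)" "P0 = chain_word a (\<lambda>x. g1 x b)" using P0 by simp_all
  have "chain_word b (g1 a) = S" using g1(3) cS(4) chain_word_cong[of b "g1 a" cS] by simp
  then have s2: "switch S Z = (X, Q')"
    using switch_grid_boundary[OF g2] cZ(4) unfolding X_def Q'_def by simp
  have "chain_word a (\<lambda>x. g1 x 0) = wla" using g1(2) by (intro chain_word_cong) simp
  then have s3: "switch wla X = (U, P)"
    using switch_grid_boundary[OF g3] unfolding X_def U_def P_def by simp
  have "chain_word c (g2 b) = Z" using g2(3) cZ(4) chain_word_cong[of c "g2 b" cZ] by simp
  then have s4: "switch P0 Z = (Y, P')"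
    using switch_grid_boundary[OF g4] s1(2) unfolding Y_def P'_def by simp
  have s5: "switch wmu Y = (V, Q)"
    using switch_grid_boundary[OF g5] s1(1) unfolding Y_def V_def Q_def by simp
  have s6: "switch P Q' = (Q2, P2)"
    using switch_grid_boundary[OF g6] unfolding P_def Q'_def Q2_def P2_def by simp
  have AS: "path {} (wla @ S) \<sigma>" using path_initial(1) S(1) unfolding path_append by blast
  have MP: "path {} (wmu @ P0) \<sigma>" using path_switch[OF P0 AS] .
  \<comment> \<open>\<open>U\<close> and \<open>V\<close> are the two candidates for the edge
    \<open>x = y = 0\<close>. They rectify the same chain \<open>Z\<close> past
    \<open>wla @ S\<close> and past \<open>wmu @ P0\<close>, two chains of the same straight
    shape.\<close>
  have U: "U = wnu"
    using rect_eq[OF AS Z(1)] switch_append1[OF s2 s3] Z(2) by simp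
  have V: "V = wnu"
    using rect_eq[OF MP Z(1)] switch_append1[OF s4 s5] Z(2) by simp
  have SZ: "path la (S @ Z) \<Lambda>" using S(1) Z(1) unfolding path_append by blast
  have XQ: "path la (X @ Q') \<Lambda>" using path_switch[OF s2 SZ] .
  have sSZ: "switch wla (S @ Z) = (wmu @ Y, P')" by (rule switch_append2[OF P0 s4])
  have sXQ: "switch wla (X @ Q') = (wnu @ Q2, P2)" using switch_append2[OF s3 s6] U by simp
  have rSZ: "rect la (S @ Z) = wmu @ Y" using rect_eq[OF path_initial(1) SZ] sSZ by simp
  have rXQ: "rect la (X @ Q') = wnu @ Q2" using rect_eq[OF path_initial(1) XQ] sXQ by simp
  have "rect la (X @ Q') = wnu @ Q"
    using rect_switch_rectangle[OF SZ s2 rSZ _ s5] V lS by simp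
  then have QQ: "Q2 = Q" using rXQ by simp
  have PP: "P2 = P'"
  proof -
    let ?\<rho> = "rotated_complement l k la"
    have 1: "path {} (wmu @ Y) ?\<rho>" "path {} (wnu @ Q2) ?\<rho>"
      using path_rect_rectangle[OF SZ] path_rect_rectangle[OF XQ] rSZ rXQ by simp_all
    have "path {} (wla @ S @ Z) \<Lambda>" "path {} (wla @ X @ Q') \<Lambda>"
      using path_initial(1) SZ XQ unfolding path_append by blast+
    from path_switch[OF sSZ this(1)] path_switch[OF sXQ this(2)]
    have 2: "path ?\<rho> P' \<Lambda>" "path ?\<rho> P2 \<Lambda>" using 1 path_det unfolding path_append[of _ "wmu @ Y"] path_append[of _ "wnu @ Q2"] by blast+
    have "rect ?\<rho> P' = wla" "rect ?\<rho> P2 = wla"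
      using rect_eq[OF 1(1) 2(1)] rect_eq[OF 1(2) 2(2)] switch_switch[OF sSZ] switch_switch[OF sXQ] by simp_all
    moreover have "path {} wla (rotated_complement l k ?\<rho>)"
      using path_initial(1) rotated_complement_involution[OF la(2)] by simp
    ultimately show ?thesis
      using ex1_rect_rectangle[OF young_rotated_complement[OF la(1)] rotated_complement_subset] 2 by metis
  qed
  have e000: "g1 0 0 = {}" using g1(2) L(2) by simp
  have e1: "g1 0 y = cmu y" if "y \<le> b" for y
    by (rule chain_word_inj[OF grid_column[OF g1(1)] M(1)]) (use that s1(1) e000 M(2) in auto)
  have e2: "g3 0 z = cnu z" if "z \<le> c" for z
    by (rule chain_word_inj[OF grid_column[OF g3(1)] N(1)]) (use that U U_def e000 g3(2) N(2) in auto)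
  have e3: "g5 0 z = cnu z" if "z \<le> c" for z
    by (rule chain_word_inj[OF grid_column[OF g5(1)] N(1)]) (use that V V_def e000 g5(2) N(2) in auto)
  have e4: "g5 y c = g6 0 y" if "y \<le> b" for y
    by (rule chain_word_inj[OF grid_row[OF g5(1)] grid_column[OF g6(1)]])
      (use that QQ Q_def Q2_def e2 e3 g6(2) in auto)
  have e5: "g4 x c = g6 x b" if "x \<le> a" for x
    by (rule chain_word_inj[OF grid_row[OF g4(1)] grid_row[OF g6(1)]])
      (use that PP P'_def P2_def g5(3) e4[of b] in auto)
  \<comment> \<open>On an edge common to several faces the first matching case decides.
    \<open>F1\<close> to \<open>F6\<close> below check that the other faces agree there.\<close>
  define f where "f = (\<lambda>(x, y, z). if (x, y, z) \<in> carton_vertices a b c then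
      (if x = 0 then g5 y z else if x = a then g2 y z else if y = 0 then g3 x z
       else if y = b then g4 x z else if z = 0 then g1 x y else g6 x y) else undefined)"
  have F5: "f (0, y, z) = g5 y z" if "y \<le> b" "z \<le> c" for y z
    using that unfolding f_def by (simp add: mem_carton_vertices)
  have F2: "f (a, y, z) = g2 y z" if yz: "y \<le> b" "z \<le> c" for y z
  proof (cases "a = 0")
    case True
    have "g5 y z = g2 y z"
      by (rule grid_unique[OF g5(1) g2(1) _ _ yz]) (use True g5(2,3) g2(2) g4(3) in auto)
    then show ?thesis using True F5[OF yz] by simp
  next
    case False
    then show ?thesis using yz unfolding f_def by (simp add: mem_carton_vertices)
  qed
  have F3: "f (x, 0, z) = g3 x z" if "x \<le> a" "z \<le> c" for x z
    using that F5[of 0 z] F2[of 0 z] e2 e3 g3(3)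
    by (cases "x = 0 \<or> x = a") (auto simp: f_def mem_carton_vertices)
  \<comment> \<open>For \<open>b = 0\<close> both faces start from the same row and end in the same
    column, so uniqueness of grids identifies them; \<open>c0\<close> is the analogue for
    \<open>c = 0\<close>.\<close>
  have b0: "g3 x z = g4 x z" if "x \<le> a" "z \<le> c" "b = 0" for x z
    by (rule grid_unique[OF g3(1) g4(1) _ _ that(1,2)]) (use that(3) g3(2,3) g4(2,3) in auto)
  have F4: "f (x, b, z) = g4 x z" if "x \<le> a" "z \<le> c" for x z
    using that F5[of b z] F2[of b z] F3[of x z] b0[of x z] g5(3) g4(3)
    by (cases "x = 0 \<or> x = a \<or> b = 0") (auto simp: f_def mem_carton_vertices)
  have F1: "f (x, y, 0) = g1 x y" if "x \<le> a" "y \<le> b" for x y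
    using that F5[of y 0] F2[of y 0] F3[of x 0] F4[of x 0] g5(2) g2(2) g3(2) g4(2)
    by (cases "x = 0 \<or> x = a \<or> y = 0 \<or> y = b") (auto simp: f_def mem_carton_vertices)
  have c0: "g1 x y = g6 x y" if "x \<le> a" "y \<le> b" "c = 0" for x y
    by (rule grid_unique[OF g1(1) g6(1) _ _ that(1,2)]) (use that(3) g6(2,3) g3(2) g2(2) in auto)
  have F6: "f (x, y, c) = g6 x y" if "x \<le> a" "y \<le> b" for x y
    using that F5[of y c] F2[of y c] F3[of x c] F4[of x c] F1[of x y] c0[of x y] e4 e5 g6(2,3)
    by (cases "x = 0 \<or> x = a \<or> y = 0 \<or> y = b \<or> c = 0") (auto simp: f_def mem_carton_vertices)
  have grids: "grid b c (\<lambda>y z. f (0, y, z))" "grid b c (\<lambda>y z. f (a, y, z))"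
    "grid a c (\<lambda>x z. f (x, 0, z))" "grid a c (\<lambda>x z. f (x, b, z))"
    "grid a b (\<lambda>x y. f (x, y, 0))" "grid a b (\<lambda>x y. f (x, y, c))"
    using grid_cong[OF F5] grid_cong[OF F2] grid_cong[OF F3] grid_cong[OF F4] grid_cong[OF F1] grid_cong[OF F6]
      g1(1) g2(1) g3(1) g4(1) g5(1) g6(1) by simp_all
  have "f \<in> carton_vertices a b c \<rightarrow>\<^sub>E {D. young_diagram D}"
  proof (rule PiE_I)
    fix p assume p: "p \<in> carton_vertices a b c"
    obtain x y z where xyz: "p = (x, y, z)" by (cases p)
    show "f p \<in> {D. young_diagram D}"
      using p grids unfolding xyz mem_carton_vertices grid_def by auto
  next
    fix p assume "p \<notin> carton_vertices a b c"
    then show "f p = undefined" unfolding f_def by (auto split: prod.splits)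
  qed
  then have "f \<in> carton_fillings a b c" unfolding carton_fillings_iff using grids by blast
  moreover have "f (a, b, c) = \<Lambda>" using F2[of b c] g2(3) cZ(3) by simp
  moreover have "f (0, 0, 0) = {}" using F1[of 0 0] e000 by simp
  ultimately have "f \<in> Cartons"
    unfolding CARTONS_def using F1 F5 e1 e3 g1(2) by simp
  moreover have "side f = S" using chain_word_cong[of b "\<lambda>y. f (a, y, 0)" cS] F1 g1(3) cS(4) by simp
  ultimately show ?thesis by blast
qed

lemma bij_betw_side: "bij_betw side Cartons Words"
proof (rule bij_betw_imageI[OF inj_on_side])
  show "side ` Cartons = Words"
  proof
    show "side ` Cartons \<subseteq> Words" using carton_side(1,2) unfolding paths_def by blast
    show "Words \<subseteq> side ` Cartons" using carton_exists by blast
  qed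
qed

lemma card_cartons: "finite Cartons \<and> card Cartons = lr la mu \<sigma>"
  using bij_betw_finite[OF bij_betw_side] bij_betw_same_card[OF bij_betw_side] finite_paths
    lr_eq_card[OF path_initial(1,2)] by simp

end

theorem mainTheorem1:
  fixes l k :: nat
    and la mu nu :: diagram
    and T_la T_mu T_nu :: "nat \<times> nat \<Rightarrow> nat"
  assumes "1 \<le> l" and "1 \<le> k"
    and "young_diagram la" and "la \<subseteq> rectangle l k"
    and "young_diagram mu" and "mu \<subseteq> rectangle l k"
    and "young_diagram nu" and "nu \<subseteq> rectangle l k"
    and "standard_tableau la T_la"
    and "standard_tableau mu T_mu"
    and "standard_tableau nu T_nu"
  shows "finite (CARTONS l k la mu nu T_la T_mu T_nu) \<and>
         LR_coefficient l k la mu nu = int (card (CARTONS l k la mu nu T_la T_mu T_nu))"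
proof -
  interpret carton_data l k la mu nu T_la T_mu T_nu
    using assms by unfold_locales
  show ?thesis
    using card_cartons LR_coefficient_eq_lr[OF assms(3,5) young_rotated_complement[OF assms(7)]] by simp
qed

end
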